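(* Let $a,b,\sigma,r_0>0$ be constants and let $r=\{r_t,t\ge0\}$ be the Cox--Ingersoll--Ross process, i.e. the unique solution of $dr_t=(a-br_t)\,dt+\sigma\sqrt{r_t}\,dW_t$ with initial value $r_0$. For $T>0$ define $$\tilde a_T=\frac{\sigma^2}{2}\cdot\frac{\left(\int_0^T r_t\,dt\right)^2}{T\int_0^T r_t^2\,dt-\left(\int_0^T r_t\,dt\right)^2},\qquad \tilde b_T=\frac{\sigma^2}{2}\cdot\frac{T\int_0^T r_t\,dt}{T\int_0^T r_t^2\,dt-\left(\int_0^T r_t\,dt\right)^2}.$$ Then $(\tilde a_T,\tilde b_T)$ is a strongly consistent estimator of $(a,b)$, that is, $\tilde a_T\to a$ and $\tilde b_T\to b$ almost surely as $T\to\infty$.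
   Context: $W=\{W_t,t\ge0\}$ is a standard Wiener process on a probability space $(\Omega,\mathcal F,\mathbf P)$. The Cox--Ingersoll--Ross process $r$ with parameters $a,b,\sigma>0$ and initial value $r_0>0$ is the unique strong solution (which is nonnegative) of $dr_t=(a-br_t)\,dt+\sigma\sqrt{r_t}\,dW_t$, $r_t|_{t=0}=r_0$. No relation between $2a$ and $\sigma^2$ is assumed. *)

theory Defs
  imports "HOL-Probability.Probability"
begin

section \<open>Wiener process and its augmented filtration\<close>

text \<open>Processes are curried, time first; only times \<open>t \<ge> 0\<close> matter. Paths are
  required to be continuous only almost surely.\<close>

definition wiener_process :: "'a measure \<Rightarrow> (real \<Rightarrow> 'a \<Rightarrow> real) \<Rightarrow> bool" where
  "wiener_process M W \<longleftrightarrow>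
     prob_space M \<and>
     (\<forall>t\<ge>0. W t \<in> borel_measurable M) \<and>
     (AE \<omega> in M. W 0 \<omega> = 0) \<and>
     (AE \<omega> in M. continuous_on {0..} (\<lambda>t. W t \<omega>)) \<and>
     (\<forall>s t. 0 \<le> s \<and> s < t \<longrightarrow>
        distributed M lborel (\<lambda>\<omega>. W t \<omega> - W s \<omega>) (normal_density 0 (sqrt (t - s)))) \<and>
     (\<forall>(n::nat) (t :: nat \<Rightarrow> real). 0 \<le> t 0 \<and> (\<forall>i<n. t i < t (Suc i)) \<longrightarrow>
        prob_space.indep_vars M (\<lambda>_. borel) (\<lambda>i \<omega>. W (t (Suc i)) \<omega> - W (t i) \<omega>) {..<n})"

definition augmented_filtration ::
    "'a measure \<Rightarrow> (real \<Rightarrow> 'a \<Rightarrow> real) \<Rightarrow> real \<Rightarrow> 'a measure" where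
  "augmented_filtration M W t =
     sigma (space M)
       ({W s -` B \<inter> space M | s B. 0 \<le> s \<and> s \<le> t \<and> B \<in> sets borel} \<union> null_sets M)"

lemma augmented_filtration_generator_Pow:
  "{W s -` B \<inter> space M | s B. 0 \<le> s \<and> s \<le> t \<and> B \<in> sets borel} \<union> null_sets M \<subseteq> Pow (space M)"
  by (auto dest: null_setsD2 sets.sets_into_space)

lemma filtration_augmented_filtration: "filtration (space M) (augmented_filtration M W)"
proof
  fix s t :: real assume "s \<le> t"
  then show "sets (augmented_filtration M W s) \<subseteq> sets (augmented_filtration M W t)"
    unfolding augmented_filtration_def
      sets_measure_of[OF augmented_filtration_generator_Pow]
    by (intro sigma_sets_mono' Un_mono order_refl) (blast intro: order_trans)
qed (simp add: augmented_filtration_def space_measure_of[OF augmented_filtration_generator_Pow])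

lemma sets_augmented_filtration_subset:
  assumes "\<And>t. t \<ge> 0 \<Longrightarrow> W t \<in> borel_measurable M"
  shows "sets (augmented_filtration M W t) \<subseteq> sets M"
  unfolding augmented_filtration_def sets_measure_of[OF augmented_filtration_generator_Pow]
  using assms by (intro sets.sigma_sets_subset Un_least subsetI) (auto intro: measurable_sets)


section \<open>Ito integral\<close>

text \<open>The triple \<open>(n, \<tau>, \<xi>)\<close> encodes the simple process
  \<open>\<Sum>i<n. \<xi> i \<cdot> 1\<close> on \<open>(\<tau> i, \<tau> (i+1)]\<close> with bounded \<open>\<xi> i\<close> that is measurable
  at the left end point.\<close>

definition simple_process ::
    "(real \<Rightarrow> 'a measure) \<Rightarrow> nat \<Rightarrow> (nat \<Rightarrow> real) \<Rightarrow> (nat \<Rightarrow> 'a \<Rightarrow> real) \<Rightarrow> bool" where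
  "simple_process F n \<tau> \<xi> \<longleftrightarrow>
     0 \<le> \<tau> 0 \<and> (\<forall>i<n. \<tau> i < \<tau> (Suc i)) \<and>
     (\<forall>i<n. \<xi> i \<in> borel_measurable (F (\<tau> i)) \<and>
            (\<exists>C. \<forall>\<omega>\<in>space (F (\<tau> i)). \<bar>\<xi> i \<omega>\<bar> \<le> C))"

definition simple_process_val ::
    "nat \<Rightarrow> (nat \<Rightarrow> real) \<Rightarrow> (nat \<Rightarrow> 'a \<Rightarrow> real) \<Rightarrow> real \<Rightarrow> 'a \<Rightarrow> real" where
  "simple_process_val n \<tau> \<xi> t \<omega> = (\<Sum>i<n. \<xi> i \<omega> * indicator {\<tau> i<..\<tau> (Suc i)} t)"

definition simple_ito_integral ::
    "(real \<Rightarrow> 'a \<Rightarrow> real) \<Rightarrow> nat \<Rightarrow> (nat \<Rightarrow> real) \<Rightarrow> (nat \<Rightarrow> 'a \<Rightarrow> real) \<Rightarrow> real \<Rightarrow> 'a \<Rightarrow> real" where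
  "simple_ito_integral W n \<tau> \<xi> t \<omega> =
     (\<Sum>i<n. \<xi> i \<omega> * (W (min t (\<tau> (Suc i))) \<omega> - W (min t (\<tau> i)) \<omega>))"

text \<open>\<open>has_ito_integral M F W H I\<close>: the process \<open>I\<close> is (a continuous version of)
  \<open>t \<mapsto> \<integral>\<^sub>0\<^sup>t H dW\<close>, where \<open>H\<close> is adapted with almost surely locally square
  integrable paths. It is the limit, in probability and uniformly on compact time intervals,
  of the integrals of simple processes \<open>S\<^sub>k\<close> with \<open>\<integral>\<^sub>0\<^sup>T (S\<^sub>k - H)\<^sup>2 dt \<longrightarrow> 0\<close> in
  probability; such a limit exists and does not depend on the sequence, up to
  indistinguishability. \<open>F\<close> has to be a filtration for which \<open>W\<close> is a Wiener process.
  The outer measure agrees with \<open>emeasure M\<close> on events; it is used because \<open>M\<close> need not be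
  complete, so that under merely almost sure path regularity the sets below need not be
  measurable.\<close>

definition has_ito_integral ::
    "'a measure \<Rightarrow> (real \<Rightarrow> 'a measure) \<Rightarrow> (real \<Rightarrow> 'a \<Rightarrow> real) \<Rightarrow>
     (real \<Rightarrow> 'a \<Rightarrow> real) \<Rightarrow> (real \<Rightarrow> 'a \<Rightarrow> real) \<Rightarrow> bool" where
  "has_ito_integral M F W H I \<longleftrightarrow>
     (\<forall>t\<ge>0. H t \<in> borel_measurable (F t)) \<and>
     (AE \<omega> in M. \<forall>T\<ge>0. set_borel_measurable lborel {0..T} (\<lambda>t. H t \<omega>) \<and>
                        set_integrable lborel {0..T} (\<lambda>t. (H t \<omega>)\<^sup>2)) \<and>
     (\<forall>t\<ge>0. I t \<in> borel_measurable (F t)) \<and>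
     (AE \<omega> in M. continuous_on {0..} (\<lambda>t. I t \<omega>)) \<and>
     (\<exists>(n :: nat \<Rightarrow> nat) (\<tau> :: nat \<Rightarrow> nat \<Rightarrow> real) (\<xi> :: nat \<Rightarrow> nat \<Rightarrow> 'a \<Rightarrow> real).
        (\<forall>k. simple_process F (n k) (\<tau> k) (\<xi> k)) \<and>
        (\<forall>T>0. \<forall>\<epsilon>>0.
           (\<lambda>k. outer_measure_of M {\<omega>\<in>space M.
              (LINT t:{0..T}|lborel. (simple_process_val (n k) (\<tau> k) (\<xi> k) t \<omega> - H t \<omega>)\<^sup>2) > \<epsilon>})
             \<longlonglongrightarrow> 0) \<and>
        (\<forall>T>0. \<forall>\<epsilon>>0.
           (\<lambda>k. outer_measure_of M {\<omega>\<in>space M.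
              \<exists>t\<in>{0..T}. \<bar>simple_ito_integral W (n k) (\<tau> k) (\<xi> k) t \<omega> - I t \<omega>\<bar> > \<epsilon>})
             \<longlonglongrightarrow> 0))"


section \<open>Stochastic differential equations and the Cox--Ingersoll--Ross process\<close>

text \<open>Strong solution of \<open>dX = \<mu>(X) dt + \<beta>(X) dW\<close>, \<open>X 0 = x0\<close>: \<open>X\<close> is adapted to the
  augmented filtration generated by \<open>W\<close>.\<close>

definition strong_solution ::
    "'a measure \<Rightarrow> (real \<Rightarrow> 'a \<Rightarrow> real) \<Rightarrow> (real \<Rightarrow> real) \<Rightarrow> (real \<Rightarrow> real) \<Rightarrow> real \<Rightarrow>
     (real \<Rightarrow> 'a \<Rightarrow> real) \<Rightarrow> bool" where
  "strong_solution M W \<mu> \<beta> x0 X \<longleftrightarrow>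
     (\<forall>t\<ge>0. X t \<in> borel_measurable (augmented_filtration M W t)) \<and>
     (AE \<omega> in M. continuous_on {0..} (\<lambda>t. X t \<omega>)) \<and>
     (AE \<omega> in M. \<forall>t\<ge>0. set_integrable lborel {0..t} (\<lambda>s. \<mu> (X s \<omega>))) \<and>
     (\<exists>I. has_ito_integral M (augmented_filtration M W) W (\<lambda>t \<omega>. \<beta> (X t \<omega>)) I \<and>
          (AE \<omega> in M. \<forall>t\<ge>0. X t \<omega> = x0 + (LINT s:{0..t}|lborel. \<mu> (X s \<omega>)) + I t \<omega>))"

text \<open>Nonnegativity is stated explicitly because \<^const>\<open>sqrt\<close> is total, with
  \<open>sqrt (- x) = - sqrt x\<close>.\<close>

definition cir_process ::
    "'a measure \<Rightarrow> (real \<Rightarrow> 'a \<Rightarrow> real) \<Rightarrow> real \<Rightarrow> real \<Rightarrow> real \<Rightarrow> real \<Rightarrow>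
     (real \<Rightarrow> 'a \<Rightarrow> real) \<Rightarrow> bool" where
  "cir_process M W a b \<sigma> r0 r \<longleftrightarrow>
     (AE \<omega> in M. \<forall>t\<ge>0. 0 \<le> r t \<omega>) \<and>
     strong_solution M W (\<lambda>x. a - b * x) (\<lambda>x. \<sigma> * sqrt x) r0 r"


section \<open>The estimators\<close>

definition int_r :: "(real \<Rightarrow> 'a \<Rightarrow> real) \<Rightarrow> real \<Rightarrow> 'a \<Rightarrow> real" where
  "int_r r T \<omega> = (LINT t:{0..T}|lborel. r t \<omega>)"

definition int_r2 :: "(real \<Rightarrow> 'a \<Rightarrow> real) \<Rightarrow> real \<Rightarrow> 'a \<Rightarrow> real" where
  "int_r2 r T \<omega> = (LINT t:{0..T}|lborel. (r t \<omega>)\<^sup>2)"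

definition a_est :: "real \<Rightarrow> (real \<Rightarrow> 'a \<Rightarrow> real) \<Rightarrow> real \<Rightarrow> 'a \<Rightarrow> real" where
  "a_est \<sigma> r T \<omega> =
     \<sigma>\<^sup>2 / 2 * ((int_r r T \<omega>)\<^sup>2 / (T * int_r2 r T \<omega> - (int_r r T \<omega>)\<^sup>2))"

definition b_est :: "real \<Rightarrow> (real \<Rightarrow> 'a \<Rightarrow> real) \<Rightarrow> real \<Rightarrow> 'a \<Rightarrow> real" where
  "b_est \<sigma> r T \<omega> =
     \<sigma>\<^sup>2 / 2 * (T * int_r r T \<omega> / (T * int_r2 r T \<omega> - (int_r r T \<omega>)\<^sup>2))"

end

(* The stochastic calculus is reduced to one inequality. For an Ito integral I of H, an adapted process E of
   bounded variation and a constant c, put N = \<integral> (E + c I) dI; pathwise, N is given by integration by parts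
   and \<integral> I dI = (I^2 - \<integral> H^2 dt) / 2. For simple integrands E exp (N - <N> / 2) <= 1 follows from the
   Gaussian moment generating function, and Fatou's lemma carries this over to the limit; no localisation
   is needed because only the inequality is used.

   Applied to the Cox-Ingersoll-Ross process r, deterministic exponential weights give
   E exp (b r_T / \<sigma>^2) <= const. Constant weights +-\<theta> and the weights +-\<theta> r, together with Borel-Cantelli
   along T = n^4, show that \<integral> sqrt r dW and \<integral> r^(3/2) dW are almost surely o(T). The equation for r and Ito's
   formula for r^2 then yield the limits of the time averages of r and r^2 along T = n^4; the integrals are
   monotone in T, which fills the gaps. *)

theory Submission
  imports Defs
begin

section \<open>Independence of Wiener increments and the past\<close>

text \<open>The estimators invert two stationary moments: the time averages of r and r^2 tend to a /
  b and (a + \<sigma>^2 / 2) a / b^2, and the corresponding variance is a \<sigma>^2 / (2 b^2). The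
  two averages are not equally hard. The bracket of \<integral> sqrt r dW is \<integral> r dt, the
  very quantity being averaged, so the error is relative and can be absorbed. The bracket of
  \<integral> r^(3/2) dW is \<integral> r^3 dt, which neither average controls. This is why a moment
  bound uniform in time is required; it also disposes of the boundary terms r_T and r_T^2. The
  horizon n^4 and the weights balance two costs. Borel-Cantelli loses a factor n^2, which leaves
  \<integral> r^3 dt \<le> n^6; both \<theta> n^6 and (ln n) / \<theta> have to be small against
  n^4, and \<theta> = n^-3 achieves this. For the first average \<theta> = 1 / n suffices. Since
  path properties hold only almost surely and M need not be complete, pathwise integrals are not
  known to be measurable. The exponential bounds are therefore delivered through a measurable
  \<open>V\<close> that agrees with the exponential almost surely.\<close>

lemma grid_mono:
  fixes t :: "nat \<Rightarrow> real"
  assumes "\<And>j. j < N \<Longrightarrow> t j < t (Suc j)" "i \<le> j" "j \<le> N"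
  shows "t i \<le> t j"
  using assms(2,3)
proof (induction j)
  case (Suc j)
  then show ?case using assms(1)[of j] by (auto simp: le_Suc_eq)
qed simp

locale wiener =
  fixes M :: "'a measure" and W :: "real \<Rightarrow> 'a \<Rightarrow> real"
  assumes wiener: "wiener_process M W"
begin

sublocale prob_space M
  using wiener by (simp add: wiener_process_def)

abbreviation F :: "real \<Rightarrow> 'a measure" where "F \<equiv> augmented_filtration M W"

lemma W_measurable: "t \<ge> 0 \<Longrightarrow> W t \<in> borel_measurable M"
  using wiener by (simp add: wiener_process_def)

lemma W_0: "AE \<omega> in M. W 0 \<omega> = 0"
  using wiener by (simp add: wiener_process_def)

lemma W_increment_distributed:
  "0 \<le> s \<Longrightarrow> s < t \<Longrightarrow>
    distributed M lborel (\<lambda>\<omega>. W t \<omega> - W s \<omega>) (normal_density 0 (sqrt (t - s)))"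
  using wiener by (simp add: wiener_process_def)

lemma space_F [simp]: "space (F t) = space M"
  by (simp add: augmented_filtration_def space_measure_of[OF augmented_filtration_generator_Pow])

lemma F_mono:
  assumes "s \<le> t" "f \<in> measurable (F s) N" shows "f \<in> measurable (F t) N"
proof -
  have "sets (F s) \<subseteq> sets (F t)"
    by (rule filtration.sets_F_mono[OF filtration_augmented_filtration assms(1)])
  then show ?thesis using assms(2) by (auto simp: measurable_def)
qed

lemma F_subset_M:
  assumes "f \<in> measurable (F s) N" shows "f \<in> measurable M N"
proof -
  have "sets (F s) \<subseteq> sets M"
    by (rule sets_augmented_filtration_subset[OF W_measurable])
  then show ?thesis using assms by (auto simp: measurable_def)
qed

lemma W_measurable_F:
  assumes "0 \<le> s" "s \<le> t" shows "W s \<in> borel_measurable (F t)"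
proof (rule measurableI)
  fix B :: "real set" assume "B \<in> sets borel"
  then show "W s -` B \<inter> space (F t) \<in> sets (F t)"
    unfolding augmented_filtration_def sets_measure_of[OF augmented_filtration_generator_Pow]
      space_measure_of[OF augmented_filtration_generator_Pow]
    using assms by (intro sigma_sets.Basic) auto
qed simp

lemma increment_measurable:
  "0 \<le> s \<Longrightarrow> 0 \<le> t \<Longrightarrow> (\<lambda>\<omega>. W t \<omega> - W s \<omega>) \<in> borel_measurable M"
  by (intro borel_measurable_diff W_measurable)

text \<open>The assumption on \<open>W\<close> speaks of increments over a strictly increasing grid,
  a cylinder of positions. Since \<open>W 0\<close> vanishes almost surely, positions are partial
  sums of increments, so sorting \<open>J\<close> together with 0 and \<open>s\<close> and appending
  \<open>t\<close> turns the cylinder into an event of all increments but the last.\<close>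

lemma cylinder_indep_increment:
  assumes st: "0 \<le> s" "s < t" and J: "finite J" "J \<subseteq> {0..s}"
    and B: "\<And>u. u \<in> J \<Longrightarrow> B u \<in> sets borel" and X: "X \<in> sets borel"
  shows "prob {\<omega>\<in>space M. (\<forall>u\<in>J. W u \<omega> \<in> B u) \<and> W t \<omega> - W s \<omega> \<in> X} =
    prob {\<omega>\<in>space M. \<forall>u\<in>J. W u \<omega> \<in> B u} * prob {\<omega>\<in>space M. W t \<omega> - W s \<omega> \<in> X}"
proof -
  define l where "l = sorted_list_of_set (insert 0 (insert s J))"
  define m where "m = length l - 1"
  have fin: "finite (insert 0 (insert s J))" using J by auto
  have set_l: "set l = insert 0 (insert s J)" unfolding l_def by (rule set_sorted_list_of_set[OF fin])
  have l_ne: "l \<noteq> []" using set_l by auto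
  have sl: "sorted_wrt (<) l" by (simp add: l_def)
  have len: "length l = Suc m" using l_ne by (simp add: m_def)
  have lmono: "i < j \<Longrightarrow> j \<le> m \<Longrightarrow> l ! i < l ! j" for i j
    using sl len by (simp add: sorted_wrt_iff_nth_less)
  have l_range: "0 \<le> l ! i \<and> l ! i \<le> s" if "i \<le> m" for i
  proof -
    have "l ! i \<in> set l" using that len by (intro nth_mem) auto
    then show ?thesis using J(2) st(1) unfolding set_l by auto
  qed
  have l_ex: "\<exists>i\<le>m. l ! i = u" if "u \<in> set l" for u
    using that len by (auto simp: in_set_conv_nth less_Suc_eq_le)
  have l0: "l ! 0 = 0"
  proof -
    obtain i where i: "i \<le> m" "l ! i = 0" using l_ex[of 0] set_l by auto
    then show ?thesis using lmono[of 0 i] l_range[of 0] by (cases "i = 0") auto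
  qed
  have lm: "l ! m = s"
  proof -
    obtain i where i: "i \<le> m" "l ! i = s" using l_ex[of s] set_l by auto
    then show ?thesis using lmono[of i m] l_range[of m] by (cases "i = m") auto
  qed
  define v where "v i = (if i \<le> m then l ! i else t)" for i
  define Y where "Y i \<omega> = W (v (Suc i)) \<omega> - W (v i) \<omega>" for i \<omega>
  have vmono: "v i < v (Suc i)" if "i < Suc m" for i
  proof (cases "i = m")
    case True then show ?thesis using lm st by (simp add: v_def)
  next
    case False then show ?thesis using lmono[of i "Suc i"] that by (simp add: v_def)
  qed
  have v0: "v 0 = 0" using l0 by (simp add: v_def)
  have ind: "indep_vars (\<lambda>_. borel) Y {..<Suc m}"
  proof -
    have "\<forall>(n::nat) v. 0 \<le> v 0 \<and> (\<forall>i<n. v i < v (Suc i)) \<longrightarrow>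
      indep_vars (\<lambda>_. borel) (\<lambda>i \<omega>. W (v (Suc i)) \<omega> - W (v i) \<omega>) {..<n}"
      using wiener unfolding wiener_process_def by blast
    from this[rule_format, of v "Suc m"] show ?thesis using v0 vmono unfolding Y_def by simp
  qed
  \<comment> \<open>The grid has m + 1 increments: those with index below \<open>m\<close> lie in
    the past, and the one with index \<open>m\<close> is the increment from \<open>s\<close> to
    \<open>t\<close>.\<close>
  have ind2: "indep_var (PiM {..<m} (\<lambda>_. borel)) (\<lambda>\<omega>. restrict (\<lambda>i. Y i \<omega>) {..<m})
      (PiM {m} (\<lambda>_. borel)) (\<lambda>\<omega>. restrict (\<lambda>i. Y i \<omega>) {m})"
    by (rule indep_var_restrict[OF ind]) auto
  define C where "C = {x \<in> space (PiM {..<m} (\<lambda>_. borel :: real measure)).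
     \<forall>i\<le>m. l ! i \<in> J \<longrightarrow> (\<Sum>k<i. x k) \<in> B (l ! i)}"
  have C: "C \<in> sets (PiM {..<m} (\<lambda>_. borel))"
  proof -
    have [measurable]: "(\<lambda>x. \<Sum>k<i. x k) \<in> borel_measurable (PiM {..<m} (\<lambda>_. borel :: real measure))"
      if "i \<le> m" for i
      using that by (intro borel_measurable_sum measurable_component_singleton) auto
    have *: "{x \<in> space (PiM {..<m} (\<lambda>_. borel :: real measure)). l ! i \<in> J \<longrightarrow> (\<Sum>k<i. x k) \<in> B (l ! i)}
       \<in> sets (PiM {..<m} (\<lambda>_. borel))" if "i \<le> m" for i
    proof (cases "l ! i \<in> J")
      case True
      note [measurable] = B[OF True]
      show ?thesis using True that by simp measurable
    qed simp
    have "C = (\<Inter>i\<in>{..m}. {x \<in> space (PiM {..<m} (\<lambda>_. borel :: real measure)). l ! i \<in> J \<longrightarrow> (\<Sum>k<i. x k) \<in> B (l ! i)})"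
      by (auto simp: C_def)
    then show ?thesis using * by auto
  qed
  define D where "D = {x \<in> space (PiM {m} (\<lambda>_. borel :: real measure)). x m \<in> X}"
  have D: "D \<in> sets (PiM {m} (\<lambda>_. borel))"
    unfolding D_def using X by measurable
  have Ym: "Y m \<omega> = W t \<omega> - W s \<omega>" for \<omega> by (simp add: Y_def v_def lm)
  have sumY: "(\<Sum>k<i. Y k \<omega>) = W (l ! i) \<omega>" if "i \<le> m" "W 0 \<omega> = 0" for i \<omega>
  proof -
    have "(\<Sum>k<i. Y k \<omega>) = W (v i) \<omega> - W (v 0) \<omega>"
      unfolding Y_def by (rule sum_lessThan_telescope)
    then show ?thesis using that by (simp add: v0) (simp add: v_def)
  qed
  have restr_sum: "(\<Sum>k<i. restrict (\<lambda>i. Y i \<omega>) {..<m} k) = (\<Sum>k<i. Y k \<omega>)" if "i \<le> m" for i \<omega>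
    using that by (intro sum.cong) auto
  have inC: "restrict (\<lambda>i. Y i \<omega>) {..<m} \<in> C \<longleftrightarrow> (\<forall>u\<in>J. W u \<omega> \<in> B u)" if "W 0 \<omega> = 0" for \<omega>
  proof -
    have "restrict (\<lambda>i. Y i \<omega>) {..<m} \<in> C \<longleftrightarrow> (\<forall>i\<le>m. l ! i \<in> J \<longrightarrow> W (l ! i) \<omega> \<in> B (l ! i))"
      using sumY[OF _ that] restr_sum by (auto simp: C_def space_PiM)
    also have "\<dots> \<longleftrightarrow> (\<forall>u\<in>J. W u \<omega> \<in> B u)"
      using l_ex set_l by (metis insertCI)
    finally show ?thesis .
  qed
  have inD: "restrict (\<lambda>i. Y i \<omega>) {m} \<in> D \<longleftrightarrow> W t \<omega> - W s \<omega> \<in> X" for \<omega>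
    by (auto simp: D_def space_PiM Ym)
  have "{\<omega>\<in>space M. W u \<omega> \<in> B u} \<in> events" if "u \<in> J" for u
  proof -
    have "W u \<in> borel_measurable M" using that J(2) W_measurable by auto
    then show ?thesis using B[OF that] by measurable
  qed
  then have WM: "{\<omega>\<in>space M. \<forall>u\<in>J. W u \<omega> \<in> B u} \<in> events"
    using J(1) by (intro sets.sets_Collect_finite_All) auto
  have XM: "{\<omega>\<in>space M. W t \<omega> - W s \<omega> \<in> X} \<in> events"
    using measurable_sets[OF increment_measurable[of s t] X] st by (simp add: vimage_def Int_def conj_commute)
  have CM: "{\<omega>\<in>space M. restrict (\<lambda>i. Y i \<omega>) {..<m} \<in> C} \<in> events"
    using measurable_sets[OF indep_var_rv1[OF ind2] C] by (simp add: vimage_def Int_def conj_commute)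
  have DM: "{\<omega>\<in>space M. restrict (\<lambda>i. Y i \<omega>) {m} \<in> D} \<in> events"
    using measurable_sets[OF indep_var_rv2[OF ind2] D] by (simp add: vimage_def Int_def conj_commute)
  \<comment> \<open>The two events agree where \<open>W 0\<close> vanishes, hence almost
    surely.\<close>
  have "prob {\<omega>\<in>space M. (\<forall>u\<in>J. W u \<omega> \<in> B u) \<and> W t \<omega> - W s \<omega> \<in> X} =
    prob ({\<omega>\<in>space M. restrict (\<lambda>i. Y i \<omega>) {..<m} \<in> C} \<inter> {\<omega>\<in>space M. restrict (\<lambda>i. Y i \<omega>) {m} \<in> D})"
  proof (rule finite_measure_eq_AE)
    show "AE \<omega> in M. (\<omega> \<in> {\<omega>\<in>space M. (\<forall>u\<in>J. W u \<omega> \<in> B u) \<and> W t \<omega> - W s \<omega> \<in> X}) =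
       (\<omega> \<in> {\<omega>\<in>space M. restrict (\<lambda>i. Y i \<omega>) {..<m} \<in> C} \<inter> {\<omega>\<in>space M. restrict (\<lambda>i. Y i \<omega>) {m} \<in> D})"
      using W_0 by eventually_elim (auto simp: inC inD)
    have "{\<omega>\<in>space M. (\<forall>u\<in>J. W u \<omega> \<in> B u) \<and> W t \<omega> - W s \<omega> \<in> X} =
      {\<omega>\<in>space M. \<forall>u\<in>J. W u \<omega> \<in> B u} \<inter> {\<omega>\<in>space M. W t \<omega> - W s \<omega> \<in> X}" by auto
    then show "{\<omega>\<in>space M. (\<forall>u\<in>J. W u \<omega> \<in> B u) \<and> W t \<omega> - W s \<omega> \<in> X} \<in> events"
      using WM XM by auto
  qed (use CM DM in auto)
  also have "\<dots> = prob {\<omega>\<in>space M. restrict (\<lambda>i. Y i \<omega>) {..<m} \<in> C} * prob {\<omega>\<in>space M. restrict (\<lambda>i. Y i \<omega>) {m} \<in> D}"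
  proof (rule indep_setD)
    show "indep_set
      (sigma_sets (space M) {(\<lambda>\<omega>. restrict (\<lambda>i. Y i \<omega>) {..<m}) -` A \<inter> space M | A. A \<in> sets (PiM {..<m} (\<lambda>_. borel))})
      (sigma_sets (space M) {(\<lambda>\<omega>. restrict (\<lambda>i. Y i \<omega>) {m}) -` A \<inter> space M | A. A \<in> sets (PiM {m} (\<lambda>_. borel))})"
      using ind2[unfolded indep_var_eq] by simp
    show "{\<omega>\<in>space M. restrict (\<lambda>i. Y i \<omega>) {..<m} \<in> C} \<in>
      sigma_sets (space M) {(\<lambda>\<omega>. restrict (\<lambda>i. Y i \<omega>) {..<m}) -` A \<inter> space M | A. A \<in> sets (PiM {..<m} (\<lambda>_. borel))}"
      using C by (intro sigma_sets.Basic CollectI exI[of _ C]) auto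
    show "{\<omega>\<in>space M. restrict (\<lambda>i. Y i \<omega>) {m} \<in> D} \<in>
      sigma_sets (space M) {(\<lambda>\<omega>. restrict (\<lambda>i. Y i \<omega>) {m}) -` A \<inter> space M | A. A \<in> sets (PiM {m} (\<lambda>_. borel))}"
      using D by (intro sigma_sets.Basic CollectI exI[of _ D]) auto
  qed
  also have "prob {\<omega>\<in>space M. restrict (\<lambda>i. Y i \<omega>) {..<m} \<in> C} = prob {\<omega>\<in>space M. \<forall>u\<in>J. W u \<omega> \<in> B u}"
  proof (rule finite_measure_eq_AE)
    show "AE \<omega> in M. (\<omega> \<in> {\<omega>\<in>space M. restrict (\<lambda>i. Y i \<omega>) {..<m} \<in> C}) =
       (\<omega> \<in> {\<omega>\<in>space M. \<forall>u\<in>J. W u \<omega> \<in> B u})"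
      using W_0 by eventually_elim (auto simp: inC)
  qed (use CM WM in auto)
  also have "{\<omega>\<in>space M. restrict (\<lambda>i. Y i \<omega>) {m} \<in> D} = {\<omega>\<in>space M. W t \<omega> - W s \<omega> \<in> X}"
    using inD by auto
  finally show ?thesis .
qed

lemma increment_indep_F:
  assumes st: "0 \<le> s" "s < t" and A: "A \<in> sets (F s)" and X: "X \<in> sets borel"
  shows "prob (A \<inter> {\<omega>\<in>space M. W t \<omega> - W s \<omega> \<in> X}) =
    prob A * prob {\<omega>\<in>space M. W t \<omega> - W s \<omega> \<in> X}"
proof -
  \<comment> \<open>working modulo null sets makes the cylinders a \<pi>-system that contains \<open>null_sets M\<close>\<close>
  define G where "G = {A \<in> events. \<exists>J B. finite J \<and> J \<subseteq> {0..s} \<and> (\<forall>u\<in>J. B u \<in> sets borel) \<and>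
     (AE \<omega> in M. \<omega> \<in> A \<longleftrightarrow> (\<forall>u\<in>J. W u \<omega> \<in> B u))}"
  define H where "H = {{\<omega>\<in>space M. W t \<omega> - W s \<omega> \<in> X} | X. X \<in> sets borel}"
  have XM: "{\<omega>\<in>space M. W t \<omega> - W s \<omega> \<in> X} \<in> events" if "X \<in> sets borel" for X
    using measurable_sets[OF increment_measurable[of s t] that] st by (simp add: vimage_def Int_def conj_commute)
  have GH: "indep_set G H"
    unfolding indep_sets2_eq
  proof (intro conjI ballI)
    show "G \<subseteq> events" by (auto simp: G_def)
    show "H \<subseteq> events" using XM by (auto simp: H_def)
    fix A D assume "A \<in> G" "D \<in> H"
    then obtain J B X where A: "A \<in> events" and J: "finite J" "J \<subseteq> {0..s}" "\<forall>u\<in>J. B u \<in> sets borel"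
      and ae: "AE \<omega> in M. \<omega> \<in> A \<longleftrightarrow> (\<forall>u\<in>J. W u \<omega> \<in> B u)"
      and D: "D = {\<omega>\<in>space M. W t \<omega> - W s \<omega> \<in> X}" and X: "X \<in> sets borel"
      unfolding G_def H_def by blast
    have Wm [measurable]: "W u \<in> borel_measurable M" if "u \<in> J" for u using that J(2) W_measurable by auto
    have "{\<omega>\<in>space M. W u \<omega> \<in> B u} \<in> events" if "u \<in> J" for u
      using Wm[OF that] J(3)[rule_format, OF that] by measurable
    then have WM: "{\<omega>\<in>space M. \<forall>u\<in>J. W u \<omega> \<in> B u} \<in> events"
      using J(1) by (intro sets.sets_Collect_finite_All) auto
    have "prob (A \<inter> D) = prob {\<omega>\<in>space M. (\<forall>u\<in>J. W u \<omega> \<in> B u) \<and> W t \<omega> - W s \<omega> \<in> X}"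
    proof (rule finite_measure_eq_AE)
      show "AE \<omega> in M. (\<omega> \<in> A \<inter> D) = (\<omega> \<in> {\<omega>\<in>space M. (\<forall>u\<in>J. W u \<omega> \<in> B u) \<and> W t \<omega> - W s \<omega> \<in> X})"
        using ae AE_space by eventually_elim (auto simp: D)
      have "{\<omega>\<in>space M. (\<forall>u\<in>J. W u \<omega> \<in> B u) \<and> W t \<omega> - W s \<omega> \<in> X} =
        {\<omega>\<in>space M. \<forall>u\<in>J. W u \<omega> \<in> B u} \<inter> D" by (auto simp: D)
      then show "{\<omega>\<in>space M. (\<forall>u\<in>J. W u \<omega> \<in> B u) \<and> W t \<omega> - W s \<omega> \<in> X} \<in> events"
        using WM XM[OF X] D by auto
    qed (use A XM[OF X] D in auto)
    also have "\<dots> = prob {\<omega>\<in>space M. \<forall>u\<in>J. W u \<omega> \<in> B u} * prob D"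
      unfolding D by (rule cylinder_indep_increment[OF st J(1,2) J(3)[rule_format] X])
    also have "prob {\<omega>\<in>space M. \<forall>u\<in>J. W u \<omega> \<in> B u} = prob A"
    proof (rule finite_measure_eq_AE)
      show "AE \<omega> in M. (\<omega> \<in> {\<omega>\<in>space M. \<forall>u\<in>J. W u \<omega> \<in> B u}) = (\<omega> \<in> A)"
        using ae AE_space by eventually_elim auto
    qed (use A WM in auto)
    finally show "prob (A \<inter> D) = prob A * prob D" .
  qed
  have IG: "Int_stable G"
  proof (rule Int_stableI)
    fix A A' assume "A \<in> G" "A' \<in> G"
    then obtain J B J' B' where A: "A \<in> events" "A' \<in> events" and J: "finite J" "J \<subseteq> {0..s}" "\<forall>u\<in>J. B u \<in> sets borel"
      and ae: "AE \<omega> in M. \<omega> \<in> A \<longleftrightarrow> (\<forall>u\<in>J. W u \<omega> \<in> B u)"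
      and J': "finite J'" "J' \<subseteq> {0..s}" "\<forall>u\<in>J'. B' u \<in> sets borel"
      and ae': "AE \<omega> in M. \<omega> \<in> A' \<longleftrightarrow> (\<forall>u\<in>J'. W u \<omega> \<in> B' u)"
      by (auto simp: G_def)
    define B2 where "B2 u = (if u \<in> J then B u else UNIV) \<inter> (if u \<in> J' then B' u else UNIV)" for u
    have "AE \<omega> in M. \<omega> \<in> A \<inter> A' \<longleftrightarrow> (\<forall>u\<in>J \<union> J'. W u \<omega> \<in> B2 u)"
      using ae ae' by eventually_elim (auto simp: B2_def split: if_splits)
    moreover have "\<forall>u\<in>J \<union> J'. B2 u \<in> sets borel" using J J' by (auto simp: B2_def)
    ultimately show "A \<inter> A' \<in> G"
      unfolding G_def using A J J' by (intro CollectI conjI exI[of _ "J \<union> J'"] exI[of _ B2]) auto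
  qed
  have IH: "Int_stable H"
  proof (rule Int_stableI)
    fix A A' assume "A \<in> H" "A' \<in> H"
    then obtain X X' where "A = {\<omega>\<in>space M. W t \<omega> - W s \<omega> \<in> X}" "A' = {\<omega>\<in>space M. W t \<omega> - W s \<omega> \<in> X'}"
      "X \<in> sets borel" "X' \<in> sets borel" by (auto simp: H_def)
    then show "A \<inter> A' \<in> H" unfolding H_def by (intro CollectI exI[of _ "X \<inter> X'"]) auto
  qed
  have ind: "indep_set (sigma_sets (space M) G) (sigma_sets (space M) H)"
    by (rule indep_set_sigma_sets[OF GH IG IH])
  have gen: "{W u -` B \<inter> space M | u B. 0 \<le> u \<and> u \<le> s \<and> B \<in> sets borel} \<union> null_sets M \<subseteq> G"
  proof (intro Un_least subsetI)
    fix A assume "A \<in> {W u -` B \<inter> space M | u B. 0 \<le> u \<and> u \<le> s \<and> B \<in> sets borel}"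
    then obtain u B where A: "A = W u -` B \<inter> space M" "0 \<le> u" "u \<le> s" "B \<in> sets borel" by auto
    have "A \<in> events" using A W_measurable[of u] by (auto intro: measurable_sets)
    moreover have "AE \<omega> in M. \<omega> \<in> A \<longleftrightarrow> (\<forall>u\<in>{u}. W u \<omega> \<in> B)"
      using AE_space by eventually_elim (auto simp: A)
    ultimately show "A \<in> G"
      unfolding G_def using A by (intro CollectI conjI exI[of _ "{u}"] exI[of _ "\<lambda>_. B"]) auto
  next
    fix A assume A: "A \<in> null_sets M"
    \<comment> \<open>A null set enters as the impossible cylinder at time 0.\<close>
    have "AE \<omega> in M. \<omega> \<in> A \<longleftrightarrow> (\<forall>u\<in>{0}. W u \<omega> \<in> {})"
      using AE_not_in[OF A] by eventually_elim auto
    then show "A \<in> G"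
      unfolding G_def using A st by (intro CollectI conjI exI[of _ "{0}"] exI[of _ "\<lambda>_. {}"]) auto
  qed
  have setsF: "sets (F s) \<subseteq> sigma_sets (space M) G"
    unfolding augmented_filtration_def sets_measure_of[OF augmented_filtration_generator_Pow]
    by (rule sigma_sets_mono') (rule gen)
  show ?thesis
    using A X setsF by (intro indep_setD[OF ind]) (auto simp: H_def)
qed

section \<open>Integrating out one increment with the past frozen\<close>

text \<open>Taking the identity as a random variable with values in \<open>F s\<close> makes the
  whole past a single coordinate, whose law is M restricted to \<open>F s\<close>. Independence then
  says that its joint law with the increment is a product measure.\<close>

lemma distr_F_increment:
  assumes st: "0 \<le> s" "s < t"
  shows "distr M (F s \<Otimes>\<^sub>M borel) (\<lambda>\<omega>. (\<omega>, W t \<omega> - W s \<omega>)) =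
    distr M (F s) (\<lambda>\<omega>. \<omega>) \<Otimes>\<^sub>M density lborel (normal_density 0 (sqrt (t - s)))"
proof -
  have [measurable]: "(\<lambda>\<omega>. W t \<omega> - W s \<omega>) \<in> borel_measurable M"
    using st by (intro increment_measurable) auto
  have idm [measurable]: "(\<lambda>\<omega>. \<omega>) \<in> measurable M (F s)"
    by (rule F_subset_M[of _ s]) simp
  have d: "density lborel (normal_density 0 (sqrt (t - s))) = distr M borel (\<lambda>\<omega>. W t \<omega> - W s \<omega>)"
    using distributed_distr_eq_density[OF W_increment_distributed[OF st]]
    by (simp cong: distr_cong)
  interpret A: prob_space "distr M (F s) (\<lambda>\<omega>. \<omega>)"
    by (rule prob_space_distr[OF idm])
  interpret B: prob_space "distr M borel (\<lambda>\<omega>. W t \<omega> - W s \<omega>)"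
    by (rule prob_space_distr) simp
  show ?thesis unfolding d
  proof (rule pair_measure_eqI[symmetric])
    fix A X assume A: "A \<in> sets (distr M (F s) (\<lambda>\<omega>. \<omega>))" and X: "X \<in> sets (distr M borel (\<lambda>\<omega>. W t \<omega> - W s \<omega>))"
    have AM: "A \<in> events" using A
      by (metis sets_distr subsetD sets_augmented_filtration_subset[of W M s, OF W_measurable])
    have e: "(\<lambda>\<omega>. (\<omega>, W t \<omega> - W s \<omega>)) -` (A \<times> X) \<inter> space M = A \<inter> {\<omega>\<in>space M. W t \<omega> - W s \<omega> \<in> X}"
      by auto
    have e2: "(\<lambda>\<omega>. W t \<omega> - W s \<omega>) -` X \<inter> space M = {\<omega>\<in>space M. W t \<omega> - W s \<omega> \<in> X}"
      by auto
    show "emeasure (distr M (F s) (\<lambda>\<omega>. \<omega>)) A * emeasure (distr M borel (\<lambda>\<omega>. W t \<omega> - W s \<omega>)) X =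
      emeasure (distr M (F s \<Otimes>\<^sub>M borel) (\<lambda>\<omega>. (\<omega>, W t \<omega> - W s \<omega>))) (A \<times> X)"
      using A X increment_indep_F[OF st, of A X] sets.sets_into_space[OF AM] by (simp add: emeasure_distr e e2 emeasure_eq_measure ennreal_mult Int_absorb2)
  next
    show "sets (distr M (F s) (\<lambda>\<omega>. \<omega>) \<Otimes>\<^sub>M distr M borel (\<lambda>\<omega>. W t \<omega> - W s \<omega>)) =
      sets (distr M (F s \<Otimes>\<^sub>M borel) (\<lambda>\<omega>. (\<omega>, W t \<omega> - W s \<omega>)))"
      unfolding sets_distr by (intro sets_pair_measure_cong) simp_all
  qed (rule A.sigma_finite_measure_axioms B.sigma_finite_measure_axioms)+
qed

text \<open>A substitute for conditioning on \<open>F s\<close>: by Tonelli for the product law, the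
  argument known at time \<open>s\<close> is frozen while the increment is integrated against its
  Gaussian law.\<close>

lemma nn_integral_F_increment:
  assumes st: "0 \<le> s" "s < t" and f [measurable]: "f \<in> borel_measurable (F s \<Otimes>\<^sub>M borel)"
  shows "(\<integral>\<^sup>+\<omega>. f (\<omega>, W t \<omega> - W s \<omega>) \<partial>M) =
    (\<integral>\<^sup>+\<omega>. (\<integral>\<^sup>+z. f (\<omega>, z) \<partial>density lborel (normal_density 0 (sqrt (t - s)))) \<partial>M)"
proof -
  let ?\<nu> = "density lborel (normal_density 0 (sqrt (t - s)))"
  have [measurable]: "(\<lambda>\<omega>. W t \<omega> - W s \<omega>) \<in> borel_measurable M"
    using st by (intro increment_measurable) auto
  have idm [measurable]: "(\<lambda>\<omega>. \<omega>) \<in> measurable M (F s)"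
    by (rule F_subset_M[of _ s]) simp
  interpret N: prob_space ?\<nu> using st by (intro prob_space_normal_density) simp
  have fm: "f \<in> borel_measurable (distr M (F s) (\<lambda>\<omega>. \<omega>) \<Otimes>\<^sub>M ?\<nu>)"
    by (subst measurable_cong_sets[OF sets_pair_measure_cong refl, of _ "F s" _ borel]) auto
  have "(\<integral>\<^sup>+\<omega>. f (\<omega>, W t \<omega> - W s \<omega>) \<partial>M) =
      (\<integral>\<^sup>+x. f x \<partial>distr M (F s \<Otimes>\<^sub>M borel) (\<lambda>\<omega>. (\<omega>, W t \<omega> - W s \<omega>)))"
    by (subst nn_integral_distr) auto
  also have "\<dots> = (\<integral>\<^sup>+\<omega>. (\<integral>\<^sup>+z. f (\<omega>, z) \<partial>?\<nu>) \<partial>distr M (F s) (\<lambda>\<omega>. \<omega>))"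
    unfolding distr_F_increment[OF st] by (rule N.nn_integral_fst[OF fm, symmetric])
  also have "\<dots> = (\<integral>\<^sup>+\<omega>. (\<integral>\<^sup>+z. f (\<omega>, z) \<partial>?\<nu>) \<partial>M)"
    by (subst nn_integral_distr) (use N.borel_measurable_nn_integral_fst[OF fm] in auto)
  finally show ?thesis .
qed

text \<open>A discrete supermartingale argument: the earlier factors are known when the last
  increment begins, so that increment can be integrated out at a cost of at most 1, and induction
  peels off the rest. A general \<open>h\<close> serves two exponentials, one linear and one
  quadratic in the increment.\<close>

lemma nn_integral_prod_le_1:
  fixes x :: "nat \<Rightarrow> 'a \<Rightarrow> real" and h :: "nat \<Rightarrow> real \<times> real \<Rightarrow> ennreal"
  assumes t: "0 \<le> t 0" "\<And>j. j < N \<Longrightarrow> t j < t (Suc j)"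
    and x: "\<And>j. j < N \<Longrightarrow> x j \<in> borel_measurable (F (t j))"
    and h: "\<And>j. j < N \<Longrightarrow> h j \<in> borel_measurable (borel \<Otimes>\<^sub>M borel)"
    and le: "\<And>j y. j < N \<Longrightarrow>
       (\<integral>\<^sup>+z. h j (y, z) \<partial>density lborel (normal_density 0 (sqrt (t (Suc j) - t j)))) \<le> 1"
  shows "(\<integral>\<^sup>+\<omega>. (\<Prod>j<N. h j (x j \<omega>, W (t (Suc j)) \<omega> - W (t j) \<omega>)) \<partial>M) \<le> 1"
  using t(2) x h le
proof (induction N)
  case 0
  then show ?case by (simp add: emeasure_space_1)
next
  case (Suc N)
  have mono: "t i \<le> t j" if "i \<le> j" "j \<le> N" for i j
    by (rule grid_mono[of "Suc N"]) (use that Suc.prems(1) in auto)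
  have nonneg: "0 \<le> t j" if "j \<le> N" for j
    using mono[of 0 j] t(1) that by simp
  define G where "G \<omega> = (\<Prod>j<N. h j (x j \<omega>, W (t (Suc j)) \<omega> - W (t j) \<omega>))" for \<omega>
  have G: "G \<in> borel_measurable (F (t N))"
    unfolding G_def
  proof (rule borel_measurable_prod_ennreal)
    fix j assume j: "j \<in> {..<N}"
    have [measurable]: "x j \<in> borel_measurable (F (t N))"
      using j mono[of j N] Suc.prems(2)[of j] by (auto intro: F_mono)
    have [measurable]: "W (t j) \<in> borel_measurable (F (t N))" "W (t (Suc j)) \<in> borel_measurable (F (t N))"
      using j mono nonneg by (auto intro!: W_measurable_F)
    have "(\<lambda>\<omega>. W (t (Suc j)) \<omega> - W (t j) \<omega>) \<in> borel_measurable (F (t N))" by measurable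
    then have "(\<lambda>\<omega>. (x j \<omega>, W (t (Suc j)) \<omega> - W (t j) \<omega>)) \<in> F (t N) \<rightarrow>\<^sub>M borel \<Otimes>\<^sub>M borel" by measurable
    moreover have "h j \<in> borel_measurable (borel \<Otimes>\<^sub>M borel)" using j by (intro Suc.prems(3)) auto
    ultimately show "(\<lambda>\<omega>. h j (x j \<omega>, W (t (Suc j)) \<omega> - W (t j) \<omega>)) \<in> borel_measurable (F (t N))"
      by (rule measurable_compose)
  qed
  note [measurable] = G Suc.prems(2)[OF lessI] Suc.prems(3)[OF lessI]
  let ?\<nu> = "density lborel (normal_density 0 (sqrt (t (Suc N) - t N)))"
  have f: "(\<lambda>(\<omega>, z). G \<omega> * h N (x N \<omega>, z)) \<in> borel_measurable (F (t N) \<Otimes>\<^sub>M borel)"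
    by measurable
  have hN: "(\<lambda>z. h N (x N \<omega>, z)) \<in> borel_measurable ?\<nu>" for \<omega>
    by measurable
  have "(\<integral>\<^sup>+\<omega>. (\<Prod>j<Suc N. h j (x j \<omega>, W (t (Suc j)) \<omega> - W (t j) \<omega>)) \<partial>M) =
    (\<integral>\<^sup>+\<omega>. G \<omega> * h N (x N \<omega>, W (t (Suc N)) \<omega> - W (t N) \<omega>) \<partial>M)"
    by (simp add: G_def)
  also have "\<dots> = (\<integral>\<^sup>+\<omega>. (\<integral>\<^sup>+z. G \<omega> * h N (x N \<omega>, z) \<partial>?\<nu>) \<partial>M)"
    using nn_integral_F_increment[OF nonneg[of N] Suc.prems(1)[OF lessI] f] by simp
  also have "\<dots> = (\<integral>\<^sup>+\<omega>. G \<omega> * (\<integral>\<^sup>+z. h N (x N \<omega>, z) \<partial>?\<nu>) \<partial>M)"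
    by (intro nn_integral_cong nn_integral_cmult hN)
  also have "\<dots> \<le> (\<integral>\<^sup>+\<omega>. G \<omega> * 1 \<partial>M)"
    by (intro nn_integral_mono mult_left_mono Suc.prems(4)) auto
  also have "\<dots> \<le> 1"
    unfolding G_def using Suc.IH Suc.prems by simp
  finally show ?case .
qed

end

section \<open>Gaussian exponential moments\<close>

text \<open>Completing the square: the exponential tilt turns the centred Gaussian density into the
  one with mean \<open>x * \<delta>\<close> and the same variance.\<close>

lemma nn_integral_normal_exp:
  fixes x \<delta> :: real
  assumes "\<delta> > 0"
  shows "(\<integral>\<^sup>+z. ennreal (exp (x * z - x\<^sup>2 * \<delta> / 2)) \<partial>density lborel (normal_density 0 (sqrt \<delta>))) \<le> 1"
proof -
  interpret prob_space "density lborel (normal_density (x * \<delta>) (sqrt \<delta>))"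
    using assms by (intro prob_space_normal_density) simp
  have "normal_density 0 (sqrt \<delta>) z * exp (x * z - x\<^sup>2 * \<delta> / 2) = normal_density (x * \<delta>) (sqrt \<delta>) z" for z
  proof -
    have "- (z - 0)\<^sup>2 / (2 * (sqrt \<delta>)\<^sup>2) + (x * z - x\<^sup>2 * \<delta> / 2) = - (z - x * \<delta>)\<^sup>2 / (2 * (sqrt \<delta>)\<^sup>2)"
      using assms by (simp add: field_simps power2_eq_square)
    then show ?thesis unfolding normal_density_def by (simp flip: exp_add)
  qed
  then have "(\<integral>\<^sup>+z. ennreal (exp (x * z - x\<^sup>2 * \<delta> / 2)) \<partial>density lborel (normal_density 0 (sqrt \<delta>))) =
    (\<integral>\<^sup>+z. ennreal (normal_density (x * \<delta>) (sqrt \<delta>) z) \<partial>lborel)"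
    by (subst nn_integral_density) (auto simp flip: ennreal_mult intro!: nn_integral_cong)
  also have "\<dots> = 1"
    using emeasure_space_1 by (simp add: emeasure_density)
  finally show ?thesis by simp
qed

text \<open>The tilt by \<open>\<theta> * z\<^sup>2\<close> rescales the variance from \<delta> to
  \<delta> / c with c = 1 - 2 \<theta> \<delta>, so without the correction the integral is exp (-
  \<theta> \<delta>) / sqrt c. This is 1 up to second order in \<theta> \<delta>, and the term 4
  (\<theta> \<delta>)^2 pays for the second order while |\<theta>| \<delta> is at most 1/4.\<close>

lemma nn_integral_normal_exp_square:
  fixes \<theta> \<delta> :: real
  assumes "\<delta> > 0" and \<theta>: "\<bar>\<theta>\<bar> * \<delta> \<le> 1 / 4"
  shows "(\<integral>\<^sup>+z. ennreal (exp (\<theta> * (z\<^sup>2 - \<delta>) - 4 * (\<theta> * \<delta>)\<^sup>2)) \<partial>density lborel (normal_density 0 (sqrt \<delta>))) \<le> 1"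
proof -
  define c where "c = 1 - 2 * \<theta> * \<delta>"
  have "\<theta> * \<delta> \<le> \<bar>\<theta>\<bar> * \<delta>" using assms by (intro mult_right_mono) auto
  then have c: "c \<ge> 1 / 2" unfolding c_def using \<theta> by linarith
  define s where "s = sqrt (\<delta> / c)"
  interpret prob_space "density lborel (normal_density 0 s)"
    using assms c by (intro prob_space_normal_density) (simp add: s_def)
  have key: "exp (- (\<theta> * \<delta>) - 4 * (\<theta> * \<delta>)\<^sup>2) \<le> sqrt c"
  proof -
    define y where "y = \<theta> * \<delta>"
    have y: "\<bar>y\<bar> \<le> 1 / 4" using \<theta> assms(1) by (simp add: y_def abs_mult)
    \<comment> \<open>The lower bound - x - 2 x^2 for ln (1 - x) at x = 2 y produces the 8, hence
      after halving the 4 of the statement; for negative \<open>y\<close> the better constant 4 is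
      available.\<close>
    have "- 2 * y - 8 * y\<^sup>2 \<le> ln (1 - 2 * y)"
    proof (cases "y \<ge> 0")
      case True
      then show ?thesis using ln_one_minus_pos_lower_bound[of "2 * y"] y by (simp add: power_mult_distrib)
    next
      case False
      have "- 2 * y - 4 * y\<^sup>2 \<le> ln (1 - 2 * y)"
        using ln_one_plus_pos_lower_bound[of "- 2 * y"] y False by (simp add: power_mult_distrib)
      moreover have "4 * y\<^sup>2 \<le> 8 * y\<^sup>2" by simp
      ultimately show ?thesis by linarith
    qed
    moreover have "c = 1 - 2 * y" by (simp add: c_def y_def)
    ultimately have "- y - 4 * y\<^sup>2 \<le> ln c / 2" by simp
    then have "exp (- y - 4 * y\<^sup>2) \<le> exp (ln c / 2)" by simp
    also have "\<dots> = sqrt c" using c by (simp add: powr_half_sqrt[symmetric] powr_def)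
    finally show ?thesis by (simp add: y_def)
  qed
  have eq: "normal_density 0 (sqrt \<delta>) z * exp (\<theta> * (z\<^sup>2 - \<delta>) - 4 * (\<theta> * \<delta>)\<^sup>2)
    = (exp (- (\<theta> * \<delta>) - 4 * (\<theta> * \<delta>)\<^sup>2) / sqrt c) * normal_density 0 s z" (is "?l = ?r") for z
  proof -
    have s2: "s\<^sup>2 = \<delta> / c" using assms c by (simp add: s_def)
    have "- z\<^sup>2 / (2 * \<delta>) + \<theta> * z\<^sup>2 = - z\<^sup>2 / (2 * s\<^sup>2)"
      unfolding s2 using assms c by (simp add: c_def field_simps)
    then have ex: "- (z - 0)\<^sup>2 / (2 * (sqrt \<delta>)\<^sup>2) + (\<theta> * (z\<^sup>2 - \<delta>) - 4 * (\<theta> * \<delta>)\<^sup>2) =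
      (- (\<theta> * \<delta>) - 4 * (\<theta> * \<delta>)\<^sup>2) + - (z - 0)\<^sup>2 / (2 * s\<^sup>2)"
      using assms(1) by (simp add: right_diff_distrib)
    have sq: "1 / sqrt (2 * pi * (sqrt \<delta>)\<^sup>2) = 1 / sqrt c * (1 / sqrt (2 * pi * s\<^sup>2))"
      unfolding s2 using assms c by (simp add: real_sqrt_mult real_sqrt_divide)
    have "?l = 1 / sqrt (2 * pi * (sqrt \<delta>)\<^sup>2) *
      exp (- (z - 0)\<^sup>2 / (2 * (sqrt \<delta>)\<^sup>2) + (\<theta> * (z\<^sup>2 - \<delta>) - 4 * (\<theta> * \<delta>)\<^sup>2))"
      unfolding normal_density_def exp_add by (simp only: mult.assoc)
    also have "\<dots> = ?r"
      unfolding ex sq normal_density_def exp_add by (simp only: mult_ac times_divide_eq_left times_divide_eq_right mult_1)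
    finally show ?thesis .
  qed
  have "(\<integral>\<^sup>+z. ennreal (exp (\<theta> * (z\<^sup>2 - \<delta>) - 4 * (\<theta> * \<delta>)\<^sup>2)) \<partial>density lborel (normal_density 0 (sqrt \<delta>))) =
    (\<integral>\<^sup>+z. ennreal ((exp (- (\<theta> * \<delta>) - 4 * (\<theta> * \<delta>)\<^sup>2) / sqrt c) * normal_density 0 s z) \<partial>lborel)"
    by (subst nn_integral_density) (simp_all add: eq[simplified] flip: ennreal_mult)
  also have "\<dots> \<le> (\<integral>\<^sup>+z. ennreal (normal_density 0 s z) \<partial>lborel)"
    using key c by (intro nn_integral_mono ennreal_leI mult_left_le_one_le) auto
  also have "\<dots> = 1"
    using emeasure_space_1 by (simp add: emeasure_density)
  finally show ?thesis .
qed

section \<open>Refinement of simple processes\<close>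

text \<open>The grid consists of the points of \<open>P\<close> in the interval together with an
  equidistant subdivision, sorted. As both are contained in the grid, no cell has a point of
  \<open>P\<close> in its interior and none is longer than T / m.\<close>

lemma ex_grid:
  fixes P :: "real set"
  assumes "finite P" and T: "T > 0" and "\<epsilon> > 0"
  obtains N :: nat and t :: "nat \<Rightarrow> real" where "t 0 = 0" "t N = T"
    "\<And>j. j < N \<Longrightarrow> t j < t (Suc j)" "\<And>j. j < N \<Longrightarrow> t (Suc j) - t j \<le> \<epsilon>"
    "\<And>j p. j < N \<Longrightarrow> p \<in> P \<Longrightarrow> p \<le> t j \<or> t (Suc j) \<le> p"
proof -
  obtain m :: nat where m: "T / \<epsilon> < real m" using reals_Archimedean2 by blast
  have m0: "m > 0" using m T \<open>\<epsilon> > 0\<close> by (metis divide_pos_pos less_trans of_nat_0_less_iff)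
  have mT: "T / m \<le> \<epsilon>" using m m0 \<open>\<epsilon> > 0\<close> by (simp add: field_simps)
  define Q where "Q = {0, T} \<union> (P \<inter> {0..T}) \<union> (\<lambda>i. T * real i / m) ` {..m}"
  have fQ: "finite Q" using assms by (simp add: Q_def)
  have Q_range: "q \<in> Q \<Longrightarrow> 0 \<le> q \<and> q \<le> T" for q
    using T m0 by (auto simp: Q_def field_simps)
  define l where "l = sorted_list_of_set Q"
  have set_l: "set l = Q" unfolding l_def by (rule set_sorted_list_of_set[OF fQ])
  have sl: "sorted_wrt (<) l" by (simp add: l_def)
  define N where "N = length l - 1"
  have len: "length l = Suc N" using set_l by (cases l) (auto simp: N_def Q_def)
  have lmono: "i < j \<Longrightarrow> j \<le> N \<Longrightarrow> l ! i < l ! j" for i j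
    using sl len by (simp add: sorted_wrt_iff_nth_less)
  have lQ: "l ! i \<in> Q" if "i \<le> N" for i using that len set_l nth_mem[of i l] by auto
  have l_ex: "\<exists>i\<le>N. l ! i = u" if "u \<in> Q" for u
    using that len set_l by (auto simp: in_set_conv_nth less_Suc_eq_le)
  have between: "p \<le> l ! j \<or> l ! Suc j \<le> p" if j: "j < N" and p: "p \<in> Q" for j p
  proof -
    obtain i where i: "i \<le> N" "l ! i = p" using l_ex[OF p] by auto
    show ?thesis
    proof (cases "i \<le> j")
      case True then show ?thesis using i j lmono[of i j] by (cases "i = j") auto
    next
      case False then show ?thesis using i j lmono[of "Suc j" i] by (cases "i = Suc j") auto
    qed
  qed
  show ?thesis
  proof
    show "l ! 0 = 0"
    proof -
      obtain i where "i \<le> N" "l ! i = 0" using l_ex[of 0] by (auto simp: Q_def)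
      then show ?thesis using lmono[of 0 i] Q_range[OF lQ[of 0]] by (cases "i = 0") auto
    qed
    show "l ! N = T"
    proof -
      obtain i where "i \<le> N" "l ! i = T" using l_ex[of T] by (auto simp: Q_def)
      then show ?thesis using lmono[of i N] Q_range[OF lQ[of N]] by (cases "i = N") auto
    qed
    fix j assume j: "j < N"
    show lt: "l ! j < l ! Suc j" using lmono[of j "Suc j"] j by auto
    have range: "0 \<le> l ! j" "l ! Suc j \<le> T" using Q_range[OF lQ[of j]] Q_range[OF lQ[of "Suc j"]] j by auto
    \<comment> \<open>\<open>i\<close> numbers the equidistant cell that contains
      \<open>l ! j\<close>; its right end point belongs to \<open>Q\<close>, so the next grid point
      cannot lie beyond it.\<close>
    define i where "i = nat \<lfloor>l ! j * m / T\<rfloor>"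
    have i: "real i \<le> l ! j * m / T" "l ! j * m / T < real i + 1"
      using range T by (auto simp: i_def)
    have "real i < m"
    proof -
      have "l ! j * m / T < m" using lt range T m0 by (simp add: field_simps)
      then show ?thesis using i by linarith
    qed
    then have "T * real (Suc i) / m \<in> Q" unfolding Q_def by (intro UnI2 image_eqI[of _ _ "Suc i"]) auto
    moreover have "l ! j < T * real (Suc i) / m" using i T m0 by (simp add: field_simps)
    ultimately have "l ! Suc j \<le> T * real (Suc i) / m" using between[OF j] by fastforce
    also have "\<dots> = T * real i / m + T / m" by (simp add: distrib_left add_divide_distrib)
    also have "T * real i / m \<le> l ! j" using i T m0 by (simp add: field_simps)
    finally show "l ! Suc j - l ! j \<le> \<epsilon>" using mT by simp
    fix p assume p: "p \<in> P"
    show "p \<le> l ! j \<or> l ! Suc j \<le> p"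
    proof (cases "p \<in> {0..T}")
      case True then show ?thesis using between[OF j] p by (auto simp: Q_def)
    next
      case False then show ?thesis using range lt by auto
    qed
  qed
qed

context wiener
begin

lemma simple_process_val_bounded:
  assumes "simple_process F n \<tau> \<xi>"
  obtains C where "C > 0" "\<And>s \<omega>. \<omega> \<in> space M \<Longrightarrow> \<bar>simple_process_val n \<tau> \<xi> s \<omega>\<bar> \<le> C"
proof -
  have "\<forall>i<n. \<exists>C. \<forall>\<omega>\<in>space M. \<bar>\<xi> i \<omega>\<bar> \<le> C"
    using assms by (simp add: simple_process_def)
  then obtain c where c: "\<And>i \<omega>. i < n \<Longrightarrow> \<omega> \<in> space M \<Longrightarrow> \<bar>\<xi> i \<omega>\<bar> \<le> c i"
    by metis
  show ?thesis
  proof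
    show "(\<Sum>i<n. \<bar>c i\<bar>) + 1 > 0" by (simp add: add_nonneg_pos sum_nonneg)
    fix s \<omega> assume \<omega>: "\<omega> \<in> space M"
    have "\<bar>simple_process_val n \<tau> \<xi> s \<omega>\<bar> \<le> (\<Sum>i<n. \<bar>\<xi> i \<omega> * indicator {\<tau> i<..\<tau> (Suc i)} s\<bar>)"
      unfolding simple_process_val_def by (rule sum_abs)
    also have "\<dots> \<le> (\<Sum>i<n. \<bar>c i\<bar>)"
      by (intro sum_mono) (use c \<omega> in \<open>force simp: indicator_def\<close>)
    finally show "\<bar>simple_process_val n \<tau> \<xi> s \<omega>\<bar> \<le> (\<Sum>i<n. \<bar>c i\<bar>) + 1" by simp
  qed
qed

text \<open>Once no break point lies inside a cell, the simple process is constant on each left-open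
  cell and its integral gains \<open>\<eta> j\<close> times one Wiener increment there. Arbitrarily
  short cells are what the quadratic variation estimate asks for.\<close>

lemma simple_process_refine:
  assumes sp: "simple_process F n \<tau> \<xi>" and "T > 0" "\<epsilon> > 0"
  obtains N :: nat and t :: "nat \<Rightarrow> real" and \<eta> :: "nat \<Rightarrow> 'a \<Rightarrow> real"
  where "t 0 = 0" "t N = T"
    "\<And>j. j < N \<Longrightarrow> t j < t (Suc j)" "\<And>j. j < N \<Longrightarrow> t (Suc j) - t j \<le> \<epsilon>"
    "\<And>j. j < N \<Longrightarrow> \<eta> j \<in> borel_measurable (F (t j))"
    "\<And>j s \<omega>. j < N \<Longrightarrow> t j < s \<Longrightarrow> s \<le> t (Suc j) \<Longrightarrow> simple_process_val n \<tau> \<xi> s \<omega> = \<eta> j \<omega>"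
    "\<And>j \<omega>. j < N \<Longrightarrow> simple_ito_integral W n \<tau> \<xi> (t (Suc j)) \<omega> - simple_ito_integral W n \<tau> \<xi> (t j) \<omega> =
       \<eta> j \<omega> * (W (t (Suc j)) \<omega> - W (t j) \<omega>)"
proof -
  obtain N t where t: "t 0 = 0" "t N = T" "\<And>j. j < N \<Longrightarrow> t j < t (Suc j)" "\<And>j. j < N \<Longrightarrow> t (Suc j) - t j \<le> \<epsilon>"
    and P: "\<And>j p. j < N \<Longrightarrow> p \<in> \<tau> ` {..n} \<Longrightarrow> p \<le> t j \<or> t (Suc j) \<le> p"
    using ex_grid[of "\<tau> ` {..n}" T \<epsilon>] assms(2,3) by blast
  \<comment> \<open>Pieces are left-open and right-closed, so the right end point shows the value on
    the whole cell.\<close>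
  define \<eta> where "\<eta> j = simple_process_val n \<tau> \<xi> (t (Suc j))" for j
  have \<tau>: "\<tau> i \<le> t j \<or> t (Suc j) \<le> \<tau> i" if "j < N" "i \<le> n" for i j
    using P[of j "\<tau> i"] that by auto
  have ind: "indicator {\<tau> i<..\<tau> (Suc i)} s = (indicator {\<tau> i<..\<tau> (Suc i)} (t (Suc j)) :: real)"
    if "j < N" "i < n" "t j < s" "s \<le> t (Suc j)" for i j s
    using \<tau>[of j i] \<tau>[of j "Suc i"] that by (auto simp: indicator_def)
  show ?thesis
  proof (rule that[of t N \<eta>])
    fix j assume j: "j < N"
    show "\<eta> j \<in> borel_measurable (F (t j))"
      unfolding \<eta>_def simple_process_val_def
    proof (rule borel_measurable_sum)
      fix i assume i: "i \<in> {..<n}"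
      show "(\<lambda>\<omega>. \<xi> i \<omega> * indicator {\<tau> i<..\<tau> (Suc i)} (t (Suc j))) \<in> borel_measurable (F (t j))"
      proof (cases "\<tau> i < t (Suc j)")
        case True
        \<comment> \<open>A piece that is active on the cell began no later than its left end, so
          its coefficient is already known at \<open>t j\<close>.\<close>
        then have "\<tau> i \<le> t j" using \<tau>[of j i] i j by auto
        then have "\<xi> i \<in> borel_measurable (F (t j))"
          using sp i by (auto simp: simple_process_def intro: F_mono)
        then show ?thesis by measurable
      qed (simp add: indicator_def)
    qed
    show "simple_process_val n \<tau> \<xi> s \<omega> = \<eta> j \<omega>" if "t j < s" "s \<le> t (Suc j)" for s \<omega>
      unfolding \<eta>_def simple_process_val_def using ind[OF j _ that] by (intro sum.cong) auto
    show "simple_ito_integral W n \<tau> \<xi> (t (Suc j)) \<omega> - simple_ito_integral W n \<tau> \<xi> (t j) \<omega> =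
       \<eta> j \<omega> * (W (t (Suc j)) \<omega> - W (t j) \<omega>)" for \<omega>
    proof -
      have "W (min (t (Suc j)) (\<tau> (Suc i))) \<omega> - W (min (t (Suc j)) (\<tau> i)) \<omega> -
        (W (min (t j) (\<tau> (Suc i))) \<omega> - W (min (t j) (\<tau> i)) \<omega>) =
        indicator {\<tau> i<..\<tau> (Suc i)} (t (Suc j)) * (W (t (Suc j)) \<omega> - W (t j) \<omega>)" if i: "i < n" for i
      proof -
        have lt: "\<tau> i < \<tau> (Suc i)" using sp i by (simp add: simple_process_def)
        consider "\<tau> (Suc i) \<le> t j" | "\<tau> i \<le> t j" "t (Suc j) \<le> \<tau> (Suc i)" | "t (Suc j) \<le> \<tau> i"
          using \<tau>[OF j, of i] \<tau>[OF j, of "Suc i"] i by auto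
        then show ?thesis
          by cases (use t(3)[OF j] lt in \<open>auto simp: min_def indicator_def\<close>)
      qed
      then show ?thesis
        unfolding simple_ito_integral_def \<eta>_def simple_process_val_def sum_subtractf[symmetric] sum_distrib_right
        by (intro sum.cong) (auto simp: right_diff_distrib[symmetric] mult.assoc)
    qed
  qed (use t in auto)
qed

section \<open>Quadratic variation along fine grids\<close>

text \<open>An exponential Markov inequality, applied to the sum and to its negative, with the bound
  for the exponential of a squared Gaussian. The mesh \<delta> depends only on \<open>T\<close>,
  \<open>C\<close> and \<epsilon>, so it can be fixed before the grid is constructed.\<close>

lemma grid_quadratic_variation:
  assumes "T > 0" "C > 0" "\<epsilon> > 0"
  obtains \<delta> where "\<delta> > 0"
    "\<And>(N::nat) t \<eta>. t 0 = 0 \<Longrightarrow> t N = T \<Longrightarrow> (\<And>j. j < N \<Longrightarrow> t j < t (Suc j)) \<Longrightarrow>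
      (\<And>j. j < N \<Longrightarrow> t (Suc j) - t j \<le> \<delta>) \<Longrightarrow>
      (\<And>j. j < N \<Longrightarrow> \<eta> j \<in> borel_measurable (F (t j))) \<Longrightarrow>
      (\<And>j \<omega>. j < N \<Longrightarrow> \<omega> \<in> space M \<Longrightarrow> \<bar>\<eta> j \<omega>\<bar> \<le> C) \<Longrightarrow>
      \<exists>B\<in>events. emeasure M B \<le> ennreal \<epsilon> \<and> (\<forall>\<omega>\<in>space M - B.
        \<bar>\<Sum>j<N. (\<eta> j \<omega>)\<^sup>2 * ((W (t (Suc j)) \<omega> - W (t j) \<omega>)\<^sup>2 - (t (Suc j) - t j))\<bar> \<le> \<epsilon>)"
proof -
  \<comment> \<open>\<alpha> is the exponent in Markov's inequality, large enough that exp (4 -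
    \<alpha> \<epsilon>) is at most \<epsilon> / 2, half of the allowed probability for each sign.
    The 4 bounds the accumulated second order corrections.\<close>
  define \<alpha> where "\<alpha> = (4 + \<bar>ln (\<epsilon> / 2)\<bar>) / \<epsilon>"
  have \<alpha>: "\<alpha> > 0" using assms by (simp add: \<alpha>_def add_pos_nonneg)
  have \<alpha>\<epsilon>: "exp (4 - \<alpha> * \<epsilon>) \<le> \<epsilon> / 2"
  proof -
    have "4 - \<alpha> * \<epsilon> \<le> ln (\<epsilon> / 2)" using assms by (simp add: \<alpha>_def)
    then have "exp (4 - \<alpha> * \<epsilon>) \<le> exp (ln (\<epsilon> / 2))" by simp
    then show ?thesis using assms by simp
  qed
  \<comment> \<open>The first bound keeps each \<alpha> \<eta>^2 d within the range 1/4 of the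
    Gaussian estimate; the second makes the sum of the squares of these quantities at most 1,
    because the cell lengths d add up to \<open>T\<close>.\<close>
  define \<delta> where "\<delta> = min (1 / (4 * \<alpha> * C\<^sup>2)) (1 / (\<alpha>\<^sup>2 * C ^ 4 * T))"
  have \<delta>: "\<delta> > 0" using \<alpha> assms by (simp add: \<delta>_def)
  have \<delta>1: "\<alpha> * C\<^sup>2 * \<delta> \<le> 1 / 4"
  proof -
    have "\<alpha> * C\<^sup>2 * \<delta> \<le> \<alpha> * C\<^sup>2 * (1 / (4 * \<alpha> * C\<^sup>2))"
      using \<alpha> by (intro mult_left_mono) (auto simp: \<delta>_def)
    then show ?thesis using \<alpha> assms by simp
  qed
  have \<delta>2: "\<alpha>\<^sup>2 * C ^ 4 * T * \<delta> \<le> 1"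
  proof -
    have "\<alpha>\<^sup>2 * C ^ 4 * T * \<delta> \<le> \<alpha>\<^sup>2 * C ^ 4 * T * (1 / (\<alpha>\<^sup>2 * C ^ 4 * T))"
      using \<alpha> assms by (intro mult_left_mono) (auto simp: \<delta>_def)
    then show ?thesis using \<alpha> assms by simp
  qed
  show ?thesis
  proof (rule that[OF \<delta>])
    fix N t \<eta>
    assume t: "t 0 = 0" "t N = T" "\<And>j. j < N \<Longrightarrow> t j < t (Suc j)"
      "\<And>j. j < N \<Longrightarrow> t (Suc j) - t j \<le> \<delta>"
      and \<eta>: "\<And>j. j < N \<Longrightarrow> \<eta> j \<in> borel_measurable (F (t j))"
      and C: "\<And>j \<omega>. j < N \<Longrightarrow> \<omega> \<in> space M \<Longrightarrow> \<bar>\<eta> j \<omega>\<bar> \<le> C"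
    define d where "d j = t (Suc j) - t j" for j
    define dW where "dW j \<omega> = W (t (Suc j)) \<omega> - W (t j) \<omega>" for j \<omega>
    define Q where "Q \<omega> = (\<Sum>j<N. (\<eta> j \<omega>)\<^sup>2 * ((dW j \<omega>)\<^sup>2 - d j))" for \<omega>
    have d: "0 < d j" "d j \<le> \<delta>" if "j < N" for j using t that by (auto simp: d_def)
    have t_nonneg: "0 \<le> t j" if "j \<le> N" for j using grid_mono[of N t 0 j] t that by auto
    have sum_d: "(\<Sum>j<N. d j) = T" unfolding d_def sum_lessThan_telescope using t by simp
    have Q [measurable]: "Q \<in> borel_measurable M"
      unfolding Q_def dW_def
      using \<eta>[THEN F_subset_M] t_nonneg
      by (intro borel_measurable_sum borel_measurable_times borel_measurable_power borel_measurable_diff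
          borel_measurable_const W_measurable) auto
    \<comment> \<open>Here \<sigma> is a sign, used with the values 1 and -1 to bound
      \<open>Q\<close> from both sides.\<close>
    have tail: "emeasure M {\<omega>\<in>space M. \<sigma> * Q \<omega> > \<epsilon>} \<le> ennreal (\<epsilon> / 2)" if \<sigma>: "\<bar>\<sigma>\<bar> = 1" for \<sigma> :: real
    proof -
      \<comment> \<open>Outside the range of the Gaussian estimate \<open>h\<close> is set to 0, so
        that its integral is at most 1 for every \<open>y\<close>; for |y| at most \<open>C\<close>
        the cut-off never acts.\<close>
      define h :: "nat \<Rightarrow> real \<times> real \<Rightarrow> ennreal" where
        "h j = (\<lambda>(y, z). if \<bar>\<sigma> * \<alpha> * y\<^sup>2\<bar> * d j \<le> 1 / 4
           then ennreal (exp (\<sigma> * \<alpha> * y\<^sup>2 * (z\<^sup>2 - d j) - 4 * (\<sigma> * \<alpha> * y\<^sup>2 * d j)\<^sup>2)) else 0)" for j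
      define V where "V \<omega> = (\<Prod>j<N. h j (\<eta> j \<omega>, W (t (Suc j)) \<omega> - W (t j) \<omega>))" for \<omega>
      have hm: "h j \<in> borel_measurable (borel \<Otimes>\<^sub>M borel)" for j
        unfolding h_def by measurable
      have V_le: "(\<integral>\<^sup>+\<omega>. V \<omega> \<partial>M) \<le> 1"
        unfolding V_def
      proof (rule nn_integral_prod_le_1)
        fix j y assume j: "j < N"
        show "(\<integral>\<^sup>+z. h j (y, z) \<partial>density lborel (normal_density 0 (sqrt (t (Suc j) - t j)))) \<le> 1"
          using nn_integral_normal_exp_square[OF d(1)[OF j], of "\<sigma> * \<alpha> * y\<^sup>2"]
          by (cases "\<bar>\<sigma> * \<alpha> * y\<^sup>2\<bar> * d j \<le> 1 / 4") (simp_all add: h_def flip: d_def)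
      qed (use t \<eta> hm in auto)
      have V_meas: "V \<in> borel_measurable M"
        unfolding V_def
      proof (rule borel_measurable_prod_ennreal)
        fix j assume j: "j \<in> {..<N}"
        have "(\<lambda>\<omega>. W (t (Suc j)) \<omega> - W (t j) \<omega>) \<in> borel_measurable M"
          using j t_nonneg by (intro increment_measurable) auto
        moreover have "\<eta> j \<in> borel_measurable M" using j \<eta> F_subset_M by blast
        ultimately have "(\<lambda>\<omega>. (\<eta> j \<omega>, W (t (Suc j)) \<omega> - W (t j) \<omega>)) \<in> M \<rightarrow>\<^sub>M borel \<Otimes>\<^sub>M borel" by measurable
        then show "(\<lambda>\<omega>. h j (\<eta> j \<omega>, W (t (Suc j)) \<omega> - W (t j) \<omega>)) \<in> borel_measurable M"
          by (rule measurable_compose[OF _ hm])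
      qed
      have V_ge: "ennreal (exp (\<alpha> * (\<sigma> * Q \<omega>) - 4)) \<le> V \<omega>" if \<omega>: "\<omega> \<in> space M" for \<omega>
      proof -
        have \<eta>2: "(\<eta> j \<omega>)\<^sup>2 \<le> C\<^sup>2" if "j < N" for j
          using C[OF that \<omega>] assms by (simp add: abs_le_square_iff[symmetric])
        have le: "\<alpha> * (\<eta> j \<omega>)\<^sup>2 * d j \<le> \<alpha> * C\<^sup>2 * \<delta>" if "j < N" for j
          using \<eta>2[OF that] d[OF that] \<alpha> by (intro mult_mono) auto
        have "V \<omega> = (\<Prod>j<N. ennreal (exp (\<sigma> * \<alpha> * (\<eta> j \<omega>)\<^sup>2 * ((dW j \<omega>)\<^sup>2 - d j) - 4 * (\<sigma> * \<alpha> * (\<eta> j \<omega>)\<^sup>2 * d j)\<^sup>2)))"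
          unfolding V_def
        proof (rule prod.cong)
          fix j assume "j \<in> {..<N}"
          then have "\<alpha> * (\<eta> j \<omega>)\<^sup>2 * d j \<le> 1 / 4" using le[of j] \<delta>1 by (meson lessThan_iff order_trans)
          then have "\<bar>\<sigma> * \<alpha> * (\<eta> j \<omega>)\<^sup>2\<bar> * d j \<le> 1 / 4"
            using \<alpha> \<sigma> by (simp add: abs_mult)
          then show "h j (\<eta> j \<omega>, W (t (Suc j)) \<omega> - W (t j) \<omega>) =
            ennreal (exp (\<sigma> * \<alpha> * (\<eta> j \<omega>)\<^sup>2 * ((dW j \<omega>)\<^sup>2 - d j) - 4 * (\<sigma> * \<alpha> * (\<eta> j \<omega>)\<^sup>2 * d j)\<^sup>2))"
            by (simp add: h_def dW_def)
        qed simp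
        also have "\<dots> = ennreal (exp (\<Sum>j<N. \<sigma> * \<alpha> * (\<eta> j \<omega>)\<^sup>2 * ((dW j \<omega>)\<^sup>2 - d j) - 4 * (\<sigma> * \<alpha> * (\<eta> j \<omega>)\<^sup>2 * d j)\<^sup>2))"
          by (simp add: prod_ennreal exp_sum)
        also have "(\<Sum>j<N. \<sigma> * \<alpha> * (\<eta> j \<omega>)\<^sup>2 * ((dW j \<omega>)\<^sup>2 - d j) - 4 * (\<sigma> * \<alpha> * (\<eta> j \<omega>)\<^sup>2 * d j)\<^sup>2) =
          \<alpha> * (\<sigma> * Q \<omega>) - 4 * (\<Sum>j<N. (\<sigma> * \<alpha> * (\<eta> j \<omega>)\<^sup>2 * d j)\<^sup>2)"
          unfolding Q_def sum_distrib_left sum_subtractf by (simp add: mult_ac)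
        finally have V: "V \<omega> = ennreal (exp (\<alpha> * (\<sigma> * Q \<omega>) - 4 * (\<Sum>j<N. (\<sigma> * \<alpha> * (\<eta> j \<omega>)\<^sup>2 * d j)\<^sup>2)))" .
        have "(\<Sum>j<N. (\<sigma> * \<alpha> * (\<eta> j \<omega>)\<^sup>2 * d j)\<^sup>2) \<le> (\<Sum>j<N. \<alpha>\<^sup>2 * C ^ 4 * \<delta> * d j)"
        proof (rule sum_mono)
          fix j assume j: "j \<in> {..<N}"
          have "(\<sigma> * \<alpha> * (\<eta> j \<omega>)\<^sup>2 * d j)\<^sup>2 = \<alpha>\<^sup>2 * ((\<eta> j \<omega>)\<^sup>2)\<^sup>2 * d j * d j"
            using \<sigma> by (simp add: power_mult_distrib power2_eq_square[of "d j"] abs_square_eq_1[symmetric])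
          also have "\<alpha>\<^sup>2 * ((\<eta> j \<omega>)\<^sup>2)\<^sup>2 \<le> \<alpha>\<^sup>2 * (C\<^sup>2)\<^sup>2"
            using \<eta>2[of j] j by (intro mult_left_mono power_mono[of "(\<eta> j \<omega>)\<^sup>2"]) auto
          then have "\<alpha>\<^sup>2 * ((\<eta> j \<omega>)\<^sup>2)\<^sup>2 * d j * d j \<le> \<alpha>\<^sup>2 * (C\<^sup>2)\<^sup>2 * \<delta> * d j"
            using d[of j] j by (intro mult_right_mono[of _ _ "d j"] mult_mono[of "\<alpha>\<^sup>2 * _"]) auto
          finally show "(\<sigma> * \<alpha> * (\<eta> j \<omega>)\<^sup>2 * d j)\<^sup>2 \<le> \<alpha>\<^sup>2 * C ^ 4 * \<delta> * d j"
            by simp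
        qed
        also have "\<dots> = \<alpha>\<^sup>2 * C ^ 4 * T * \<delta>" unfolding sum_distrib_left[symmetric] sum_d by (simp only: mult_ac)
        also have "\<dots> \<le> 1" by (rule \<delta>2)
        finally show ?thesis unfolding V by (intro ennreal_leI) simp
      qed
      have "emeasure M {\<omega>\<in>space M. \<sigma> * Q \<omega> > \<epsilon>} \<le> emeasure M {\<omega>\<in>space M. 1 \<le> ennreal (exp (4 - \<alpha> * \<epsilon>)) * V \<omega>}"
      proof (rule emeasure_mono)
        show "{\<omega>\<in>space M. 1 \<le> ennreal (exp (4 - \<alpha> * \<epsilon>)) * V \<omega>} \<in> events"
          using V_meas by measurable
        show "{\<omega>\<in>space M. \<sigma> * Q \<omega> > \<epsilon>} \<subseteq> {\<omega>\<in>space M. 1 \<le> ennreal (exp (4 - \<alpha> * \<epsilon>)) * V \<omega>}"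
        proof safe
          fix \<omega> assume \<omega>: "\<omega> \<in> space M" "\<epsilon> < \<sigma> * Q \<omega>"
          have "(1::real) \<le> exp (4 - \<alpha> * \<epsilon>) * exp (\<alpha> * (\<sigma> * Q \<omega>) - 4)"
            using \<omega>(2) \<alpha> by (simp flip: exp_add)
          then have "(1::ennreal) \<le> ennreal (exp (4 - \<alpha> * \<epsilon>)) * ennreal (exp (\<alpha> * (\<sigma> * Q \<omega>) - 4))"
            by (subst ennreal_mult[symmetric]) auto
          also have "\<dots> \<le> ennreal (exp (4 - \<alpha> * \<epsilon>)) * V \<omega>"
            by (intro mult_left_mono V_ge \<omega>) auto
          finally show "1 \<le> ennreal (exp (4 - \<alpha> * \<epsilon>)) * V \<omega>" .
        qed
      qed
      also have "\<dots> \<le> ennreal (exp (4 - \<alpha> * \<epsilon>)) * (\<integral>\<^sup>+\<omega>. V \<omega> * indicator (space M) \<omega> \<partial>M)"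
        using V_meas by (intro nn_integral_Markov_inequality) auto
      also have "(\<integral>\<^sup>+\<omega>. V \<omega> * indicator (space M) \<omega> \<partial>M) = (\<integral>\<^sup>+\<omega>. V \<omega> \<partial>M)"
        by (intro nn_integral_cong) simp
      also have "ennreal (exp (4 - \<alpha> * \<epsilon>)) * (\<integral>\<^sup>+\<omega>. V \<omega> \<partial>M) \<le> ennreal (exp (4 - \<alpha> * \<epsilon>)) * 1"
        by (intro mult_left_mono V_le) auto
      also have "\<dots> \<le> ennreal (\<epsilon> / 2)" using \<alpha>\<epsilon> by (simp add: ennreal_leI)
      finally show ?thesis .
    qed
    let ?B = "{\<omega>\<in>space M. 1 * Q \<omega> > \<epsilon>} \<union> {\<omega>\<in>space M. (-1) * Q \<omega> > \<epsilon>}"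
    have "emeasure M ?B \<le> emeasure M {\<omega>\<in>space M. 1 * Q \<omega> > \<epsilon>} + emeasure M {\<omega>\<in>space M. (-1) * Q \<omega> > \<epsilon>}"
      by (rule emeasure_subadditive; measurable)
    also have "\<dots> \<le> ennreal (\<epsilon> / 2) + ennreal (\<epsilon> / 2)"
      by (intro add_mono tail) auto
    also have "\<dots> = ennreal \<epsilon>" using assms by (simp flip: ennreal_plus)
    finally have "emeasure M ?B \<le> ennreal \<epsilon>" .
    moreover have "?B \<in> events" by measurable
    moreover have "\<forall>\<omega>\<in>space M - ?B. \<bar>Q \<omega>\<bar> \<le> \<epsilon>" by auto
    ultimately show "\<exists>B\<in>events. emeasure M B \<le> ennreal \<epsilon> \<and> (\<forall>\<omega>\<in>space M - B.
        \<bar>\<Sum>j<N. (\<eta> j \<omega>)\<^sup>2 * ((W (t (Suc j)) \<omega> - W (t j) \<omega>)\<^sup>2 - (t (Suc j) - t j))\<bar> \<le> \<epsilon>)"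
      unfolding Q_def dW_def d_def by blast
  qed
qed

end

section \<open>Riemann sums along a refining sequence of grids\<close>

lemma set_integral_grid:
  fixes f :: "real \<Rightarrow> real" and t :: "nat \<Rightarrow> real"
  assumes t: "\<And>j. j < N \<Longrightarrow> t j < t (Suc j)" and f: "set_integrable lborel {t 0..t N} f"
  shows "(LINT s:{t 0..t N}|lborel. f s) = (\<Sum>j<N. LINT s:{t j..t (Suc j)}|lborel. f s)"
  using assms
proof (induction N)
  case 0
  have "AE x in lborel. indicator {t 0..t 0} x *\<^sub>R f x = 0"
    using AE_lborel_singleton[of "t 0"] by eventually_elim (auto simp: indicator_def)
  then have "(LINT s:{t 0..t 0}|lborel. f s) = 0"
    unfolding set_lebesgue_integral_def by (rule integral_eq_zero_AE)
  then show ?case by simp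
next
  case (Suc N)
  have le: "t 0 \<le> t N"
    by (rule grid_mono[of "Suc N"]) (use Suc.prems(1) in auto)
  have lt: "t N < t (Suc N)" using Suc.prems(1) by simp
  have int: "set_integrable lborel {t 0..t N} f" "set_integrable lborel {t N..t (Suc N)} f"
    by (rule set_integrable_subset[OF Suc.prems(2)]; use le lt in auto)+
  have "{t 0..t (Suc N)} = {t 0..t N} \<union> {t N..t (Suc N)}" using le lt by auto
  then have "(LINT s:{t 0..t (Suc N)}|lborel. f s) =
      (LINT s:{t 0..t N}|lborel. f s) + (LINT s:{t N..t (Suc N)}|lborel. f s)"
    using int AE_lborel_singleton[of "t N"]
    by (simp only:) (intro set_integral_Un_AE; auto elim!: eventually_mono)
  then show ?case using Suc int by simp
qed

lemma set_integrable_continuous_mult: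
  fixes f g :: "real \<Rightarrow> real"
  assumes g: "continuous_on {a..b} g" and f: "set_integrable lborel {a..b} f"
  shows "set_integrable lborel {a..b} (\<lambda>s. g s * f s)"
proof -
  have "bounded (g ` {a..b})" by (intro compact_imp_bounded compact_continuous_image g compact_Icc)
  then obtain B where B: "\<And>s. s \<in> {a..b} \<Longrightarrow> \<bar>g s\<bar> \<le> B" unfolding bounded_iff by fastforce
  have 1: "(\<lambda>s. indicator {a..b} s *\<^sub>R g s) \<in> borel_measurable lborel"
    using borel_measurable_continuous_on_indicator[OF _ g] by simp
  have 2: "integrable lborel (\<lambda>s. B * \<bar>indicator {a..b} s *\<^sub>R f s\<bar>)"
    using f unfolding set_integrable_def by (intro integrable_mult_right integrable_abs)
  have 3: "(\<lambda>s. (indicator {a..b} s *\<^sub>R g s) * (indicator {a..b} s *\<^sub>R f s)) \<in> borel_measurable lborel"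
    using f 1 unfolding set_integrable_def by (intro borel_measurable_times) auto
  show ?thesis
    unfolding set_integrable_def
  proof (rule Bochner_Integration.integrable_bound[OF 2])
    show "(\<lambda>s. indicator {a..b} s *\<^sub>R (g s * f s)) \<in> borel_measurable lborel"
      using 3 by (rule measurable_cong[THEN iffD1, rotated]) (auto simp: indicator_def)
    show "AE s in lborel. norm (indicator {a..b} s *\<^sub>R (g s * f s)) \<le> norm (B * \<bar>indicator {a..b} s *\<^sub>R f s\<bar>)"
    proof (intro AE_I2)
      fix s show "norm (indicator {a..b} s *\<^sub>R (g s * f s)) \<le> norm (B * \<bar>indicator {a..b} s *\<^sub>R f s\<bar>)"
        using B[of s] by (auto simp: indicator_def abs_mult intro!: mult_right_mono)
    qed
  qed
qed

text \<open>Each value \<open>c j\<close> is weighted with the exact integral of \<open>f\<close>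
  over its cell, so the error comes from the oscillation of \<open>g\<close> alone and
  \<open>f\<close> enters through its L1 norm.\<close>

lemma riemann_sum_bound:
  fixes f g :: "real \<Rightarrow> real" and t c :: "nat \<Rightarrow> real"
  assumes t: "\<And>j. j < N \<Longrightarrow> t j < t (Suc j)" and f: "set_integrable lborel {t 0..t N} f"
    and g: "continuous_on {t 0..t N} g"
    and close: "\<And>j s. j < N \<Longrightarrow> s \<in> {t j..t (Suc j)} \<Longrightarrow> \<bar>c j - g s\<bar> \<le> \<epsilon>"
  shows "\<bar>(\<Sum>j<N. c j * (LINT s:{t j..t (Suc j)}|lborel. f s)) - (LINT s:{t 0..t N}|lborel. g s * f s)\<bar>
    \<le> \<epsilon> * (LINT s:{t 0..t N}|lborel. \<bar>f s\<bar>)"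
proof -
  have mono: "t i \<le> t j" if "i \<le> j" "j \<le> N" for i j
    by (rule grid_mono[of N]) (use that t in auto)
  have sub: "{t j..t (Suc j)} \<subseteq> {t 0..t N}" if "j < N" for j
    using mono[of 0 j] mono[of "Suc j" N] that by auto
  have gf: "set_integrable lborel {t 0..t N} (\<lambda>s. g s * f s)"
    by (rule set_integrable_continuous_mult[OF g f])
  have fj: "set_integrable lborel {t j..t (Suc j)} f"
    and gfj: "set_integrable lborel {t j..t (Suc j)} (\<lambda>s. g s * f s)" if "j < N" for j
    by (rule set_integrable_subset[OF f] set_integrable_subset[OF gf]; use sub[OF that] in auto)+
  have eqj: "c j * (LINT s:{t j..t (Suc j)}|lborel. f s) - (LINT s:{t j..t (Suc j)}|lborel. g s * f s) =
    (LINT s:{t j..t (Suc j)}|lborel. c j * f s - g s * f s)" if "j < N" for j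
    using fj[OF that] gfj[OF that] by (simp add: set_integral_diff(2))
  have "\<bar>(\<Sum>j<N. c j * (LINT s:{t j..t (Suc j)}|lborel. f s)) - (LINT s:{t 0..t N}|lborel. g s * f s)\<bar>
    = \<bar>\<Sum>j<N. (LINT s:{t j..t (Suc j)}|lborel. c j * f s - g s * f s)\<bar>"
    using set_integral_grid[of N t "\<lambda>s. g s * f s", OF _ gf] t by (simp add: eqj flip: sum_subtractf)
  also have "\<dots> \<le> (\<Sum>j<N. \<bar>LINT s:{t j..t (Suc j)}|lborel. c j * f s - g s * f s\<bar>)"
    by (rule sum_abs)
  also have "\<dots> \<le> (\<Sum>j<N. LINT s:{t j..t (Suc j)}|lborel. \<epsilon> * \<bar>f s\<bar>)"
  proof (rule sum_mono)
    fix j assume "j \<in> {..<N}" then have j: "j < N" by simp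
    have i: "set_integrable lborel {t j..t (Suc j)} (\<lambda>s. c j * f s - g s * f s)"
      using fj[OF j] gfj[OF j] by (intro set_integral_diff set_integrable_mult_right) auto
    have "\<bar>LINT s:{t j..t (Suc j)}|lborel. c j * f s - g s * f s\<bar> \<le>
      (LINT s:{t j..t (Suc j)}|lborel. \<bar>c j * f s - g s * f s\<bar>)"
      using set_integral_norm_bound[OF i] by simp
    also have "\<dots> \<le> (LINT s:{t j..t (Suc j)}|lborel. \<epsilon> * \<bar>f s\<bar>)"
    proof (rule set_integral_mono)
      show "set_integrable lborel {t j..t (Suc j)} (\<lambda>s. \<bar>c j * f s - g s * f s\<bar>)"
        using i by (rule set_integrable_abs)
      show "set_integrable lborel {t j..t (Suc j)} (\<lambda>s. \<epsilon> * \<bar>f s\<bar>)"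
        using fj[OF j] by (intro set_integrable_mult_right set_integrable_abs) auto
      show "\<bar>c j * f s - g s * f s\<bar> \<le> \<epsilon> * \<bar>f s\<bar>" if "s \<in> {t j..t (Suc j)}" for s
        using close[OF j that] by (simp add: left_diff_distrib[symmetric] abs_mult mult_right_mono)
    qed
    finally show "\<bar>LINT s:{t j..t (Suc j)}|lborel. c j * f s - g s * f s\<bar> \<le> (LINT s:{t j..t (Suc j)}|lborel. \<epsilon> * \<bar>f s\<bar>)" .
  qed
  also have "\<dots> = (LINT s:{t 0..t N}|lborel. \<epsilon> * \<bar>f s\<bar>)"
    using f by (intro set_integral_grid[of N t "\<lambda>s. \<epsilon> * \<bar>f s\<bar>", symmetric] t set_integrable_mult_right set_integrable_abs) auto
  finally show ?thesis by simp
qed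

text \<open>Uniform convergence and uniform continuity of the limit together allow an approximant at
  a tag to be compared with the limit anywhere in the same cell.\<close>

lemma uniform_limit_mesh:
  fixes f :: "nat \<Rightarrow> real \<Rightarrow> real"
  assumes u: "uniform_limit {a..b} f g sequentially" and g: "continuous_on {a..b} g"
    and \<delta>: "\<delta> \<longlonglongrightarrow> 0" and "\<epsilon> > 0"
  shows "\<forall>\<^sub>F k in sequentially. \<forall>x\<in>{a..b}. \<forall>y\<in>{a..b}. \<bar>x - y\<bar> \<le> \<delta> k \<longrightarrow> \<bar>f k x - g y\<bar> \<le> \<epsilon>"
proof -
  have "uniformly_continuous_on {a..b} g" by (intro compact_uniformly_continuous g compact_Icc)
  then obtain d where d: "d > 0" "\<And>x y. x \<in> {a..b} \<Longrightarrow> y \<in> {a..b} \<Longrightarrow> dist x y < d \<Longrightarrow> dist (g x) (g y) < \<epsilon> / 2"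
    using \<open>\<epsilon> > 0\<close> unfolding uniformly_continuous_on_def by (metis half_gt_zero)
  have "\<forall>\<^sub>F k in sequentially. \<forall>x\<in>{a..b}. dist (f k x) (g x) < \<epsilon> / 2"
    using u \<open>\<epsilon> > 0\<close> unfolding uniform_limit_iff by (meson half_gt_zero)
  moreover have "\<forall>\<^sub>F k in sequentially. \<delta> k < d"
    using \<delta> d(1) by (rule order_tendstoD(2))
  ultimately show ?thesis
  proof eventually_elim
    case (elim k)
    show ?case
    proof (intro ballI impI)
      fix x y assume xy: "x \<in> {a..b}" "y \<in> {a..b}" "\<bar>x - y\<bar> \<le> \<delta> k"
      have "\<bar>f k x - g x\<bar> < \<epsilon> / 2" using elim(1) xy(1) by (simp add: dist_real_def)
      moreover have "\<bar>g x - g y\<bar> < \<epsilon> / 2" using d(2)[OF xy(1,2)] xy(3) elim(2) by (simp add: dist_real_def)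
      ultimately show "\<bar>f k x - g y\<bar> \<le> \<epsilon>" by linarith
    qed
  qed
qed

text \<open>Weight and density both change with k, and the densities are merely bounded in L1. The
  comparison is therefore with the integral of \<open>\<Phi>0\<close> against \<open>f k\<close>,
  whose own limit is settled separately. The free tag \<open>p\<close> covers the left end points of
  Ito sums as well as the right end points that summation by parts produces.\<close>

lemma riemann_sum_tendsto:
  fixes f \<Phi> :: "nat \<Rightarrow> real \<Rightarrow> real" and t p :: "nat \<Rightarrow> nat \<Rightarrow> real" and T :: real
  assumes t: "\<And>k. t k 0 = 0" "\<And>k. t k (N k) = T" "\<And>k j. j < N k \<Longrightarrow> t k j < t k (Suc j)"
      "\<And>k j. j < N k \<Longrightarrow> t k (Suc j) - t k j \<le> \<delta> k" "\<delta> \<longlonglongrightarrow> 0"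
    and \<Phi>: "uniform_limit {0..T} \<Phi> \<Phi>0 sequentially" "continuous_on {0..T} \<Phi>0"
    and f: "\<And>k. set_integrable lborel {0..T} (f k)" "\<And>k. (LINT s:{0..T}|lborel. \<bar>f k s\<bar>) \<le> B"
    and p: "\<And>k j. j < N k \<Longrightarrow> p k j \<in> {t k j..t k (Suc j)}"
  shows "(\<lambda>k. (\<Sum>j<N k. \<Phi> k (p k j) * (LINT s:{t k j..t k (Suc j)}|lborel. f k s))
     - (LINT s:{0..T}|lborel. \<Phi>0 s * f k s)) \<longlonglongrightarrow> 0"
proof (rule LIMSEQ_I)
  fix r :: real assume r: "r > 0"
  have B: "B \<ge> 0"
  proof -
    have "0 \<le> (LINT s:{0..T}|lborel. \<bar>f 0 s\<bar>)" unfolding set_lebesgue_integral_def by (intro integral_nonneg_AE) auto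
    then show ?thesis using f(2)[of 0] by linarith
  qed
  define \<epsilon> where "\<epsilon> = r / (2 * (B + 1))"
  have \<epsilon>: "\<epsilon> > 0" using r B by (simp add: \<epsilon>_def)
  have \<epsilon>B: "\<epsilon> * B < r"
  proof -
    have "\<epsilon> * (2 * (B + 1)) = r" using B by (simp add: \<epsilon>_def)
    moreover have "\<epsilon> * B \<le> \<epsilon> * (B + 1)" using \<epsilon> by simp
    moreover have "0 < \<epsilon> * (B + 1)" using \<epsilon> B by simp
    ultimately show ?thesis by (simp add: algebra_simps)
  qed
  have "\<forall>\<^sub>F k in sequentially. norm ((\<Sum>j<N k. \<Phi> k (p k j) * (LINT s:{t k j..t k (Suc j)}|lborel. f k s))
     - (LINT s:{0..T}|lborel. \<Phi>0 s * f k s) - 0) < r"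
    using uniform_limit_mesh[OF \<Phi> t(5) \<epsilon>]
  proof eventually_elim
    case (elim k)
    have mono: "t k i \<le> t k j" if "i \<le> j" "j \<le> N k" for i j
      by (rule grid_mono[of "N k"]) (use that t(3) in auto)
    have "\<bar>(\<Sum>j<N k. \<Phi> k (p k j) * (LINT s:{t k j..t k (Suc j)}|lborel. f k s)) - (LINT s:{t k 0..t k (N k)}|lborel. \<Phi>0 s * f k s)\<bar>
      \<le> \<epsilon> * (LINT s:{t k 0..t k (N k)}|lborel. \<bar>f k s\<bar>)"
    proof (rule riemann_sum_bound)
      fix j s assume j: "j < N k" and s: "s \<in> {t k j..t k (Suc j)}"
      have "p k j \<in> {0..T}" "s \<in> {0..T}"
        using p[OF j] s mono[of 0 j] mono[of "Suc j" "N k"] j t(1,2)[of k] by auto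
      moreover have "\<bar>p k j - s\<bar> \<le> \<delta> k" using p[OF j] s t(4)[OF j] by auto
      ultimately show "\<bar>\<Phi> k (p k j) - \<Phi>0 s\<bar> \<le> \<epsilon>" using elim by blast
    qed (use t f \<Phi> in auto)
    also have "\<dots> \<le> \<epsilon> * B" using f(2)[of k] \<epsilon> t(1,2)[of k] by (intro mult_left_mono) auto
    finally show ?case using \<epsilon>B t(1,2)[of k] by simp
  qed
  then show "\<exists>no. \<forall>k\<ge>no. norm ((\<Sum>j<N k. \<Phi> k (p k j) * (LINT s:{t k j..t k (Suc j)}|lborel. f k s))
     - (LINT s:{0..T}|lborel. \<Phi>0 s * f k s) - 0) < r"
    by (simp add: eventually_sequentially)
qed

text \<open>L2 convergence passes to squares: S^2 - H^2 = D^2 + 2 H D with D = S - H, and the cross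
  term is split by 2 |H D| \<le> \<rho> H^2 + D^2 / \<rho>, where \<rho> is fixed before k
  grows.\<close>

lemma weighted_square_tendsto:
  fixes S :: "nat \<Rightarrow> real \<Rightarrow> real" and H G :: "real \<Rightarrow> real"
  assumes G: "continuous_on {0..T} G"
    and H2: "set_integrable lborel {0..T} (\<lambda>s. (H s)\<^sup>2)"
    and S2: "\<And>k. set_integrable lborel {0..T} (\<lambda>s. (S k s)\<^sup>2)"
    and D2: "\<And>k. set_integrable lborel {0..T} (\<lambda>s. (S k s - H s)\<^sup>2)"
    and lim: "(\<lambda>k. LINT s:{0..T}|lborel. (S k s - H s)\<^sup>2) \<longlonglongrightarrow> 0"
  shows "(\<lambda>k. LINT s:{0..T}|lborel. G s * (S k s)\<^sup>2) \<longlonglongrightarrow> (LINT s:{0..T}|lborel. G s * (H s)\<^sup>2)"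
proof (rule LIMSEQ_I)
  fix r :: real assume r: "r > 0"
  have "bounded (G ` {0..T})" by (intro compact_imp_bounded compact_continuous_image G compact_Icc)
  then obtain B0 where B0: "\<And>s. s \<in> {0..T} \<Longrightarrow> \<bar>G s\<bar> \<le> B0" unfolding bounded_iff by fastforce
  define B where "B = max 1 B0"
  have B: "B > 0" "\<And>s. s \<in> {0..T} \<Longrightarrow> \<bar>G s\<bar> \<le> B" using B0 by (auto simp: B_def le_max_iff_disj)
  define h where "h = (LINT s:{0..T}|lborel. (H s)\<^sup>2)"
  have h: "h \<ge> 0" unfolding h_def set_lebesgue_integral_def by (intro integral_nonneg_AE) auto
  \<comment> \<open>Chosen so that the part of the error that does not vanish with k, namely
    \<open>B * \<rho> * h\<close>, is at most \<open>r / 2\<close>; the + 1 covers h = 0.\<close>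
  define \<rho> where "\<rho> = r / (2 * B * (h + 1))"
  have \<rho>: "\<rho> > 0" using r B h by (simp add: \<rho>_def)
  have \<rho>h: "B * \<rho> * h \<le> r / 2"
  proof -
    have "B * \<rho> * h \<le> B * \<rho> * (h + 1)" using B \<rho> by (intro mult_left_mono) auto
    also have "\<dots> = r / 2"
    proof -
      have "2 * B * (h + 1) > 0" using B h by simp
      then have "\<rho> * (2 * B * (h + 1)) = r" unfolding \<rho>_def by (metis less_irrefl nonzero_divide_eq_eq)
      then show ?thesis by (simp add: mult_ac)
    qed
    finally show ?thesis .
  qed
  have bound: "\<bar>(LINT s:{0..T}|lborel. G s * (S k s)\<^sup>2) - (LINT s:{0..T}|lborel. G s * (H s)\<^sup>2)\<bar> \<le>
      B * (1 + 1 / \<rho>) * (LINT s:{0..T}|lborel. (S k s - H s)\<^sup>2) + B * \<rho> * h" for k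
  proof -
    have i: "set_integrable lborel {0..T} (\<lambda>s. G s * (S k s)\<^sup>2)" "set_integrable lborel {0..T} (\<lambda>s. G s * (H s)\<^sup>2)"
      using G S2 H2 by (auto intro: set_integrable_continuous_mult)
    have "\<bar>(LINT s:{0..T}|lborel. G s * (S k s)\<^sup>2) - (LINT s:{0..T}|lborel. G s * (H s)\<^sup>2)\<bar> =
      \<bar>LINT s:{0..T}|lborel. G s * (S k s)\<^sup>2 - G s * (H s)\<^sup>2\<bar>"
      using i by (simp add: set_integral_diff)
    also have "\<dots> \<le> (LINT s:{0..T}|lborel. \<bar>G s * (S k s)\<^sup>2 - G s * (H s)\<^sup>2\<bar>)"
      using set_integral_norm_bound[OF set_integral_diff(1)[OF i]] by simp
    also have "\<dots> \<le> (LINT s:{0..T}|lborel. B * (1 + 1 / \<rho>) * (S k s - H s)\<^sup>2 + B * \<rho> * (H s)\<^sup>2)"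
    proof (rule set_integral_mono)
      show "set_integrable lborel {0..T} (\<lambda>s. \<bar>G s * (S k s)\<^sup>2 - G s * (H s)\<^sup>2\<bar>)"
        using i by (intro set_integrable_abs set_integral_diff)
      show "set_integrable lborel {0..T} (\<lambda>s. B * (1 + 1 / \<rho>) * (S k s - H s)\<^sup>2 + B * \<rho> * (H s)\<^sup>2)"
        using D2 H2 by (intro set_integral_add set_integrable_mult_right) auto
      fix s assume s: "s \<in> {0..T}"
      define D where "D = S k s - H s"
      have "2 * \<bar>H s * D\<bar> \<le> \<rho> * (H s)\<^sup>2 + D\<^sup>2 / \<rho>"
      proof -
        have "0 \<le> (\<rho> * \<bar>H s\<bar> - \<bar>D\<bar>)\<^sup>2 / \<rho>" using \<rho> by simp
        also have "\<dots> = \<rho> * (H s)\<^sup>2 + D\<^sup>2 / \<rho> - 2 * \<bar>H s * D\<bar>"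
          using \<rho> by (simp add: power2_diff power_mult_distrib abs_mult field_simps power2_eq_square)
        finally show ?thesis by simp
      qed
      then have "\<bar>D\<^sup>2 + 2 * (H s * D)\<bar> \<le> (1 + 1 / \<rho>) * D\<^sup>2 + \<rho> * (H s)\<^sup>2"
        using abs_triangle_ineq[of "D\<^sup>2" "2 * (H s * D)"] by (simp add: distrib_right abs_mult)
      moreover have "(S k s)\<^sup>2 - (H s)\<^sup>2 = D\<^sup>2 + 2 * (H s * D)" by (simp add: D_def power2_eq_square algebra_simps)
      ultimately have 1: "\<bar>(S k s)\<^sup>2 - (H s)\<^sup>2\<bar> \<le> (1 + 1 / \<rho>) * D\<^sup>2 + \<rho> * (H s)\<^sup>2" by simp
      have "\<bar>G s * (S k s)\<^sup>2 - G s * (H s)\<^sup>2\<bar> = \<bar>G s\<bar> * \<bar>(S k s)\<^sup>2 - (H s)\<^sup>2\<bar>"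
        by (simp add: right_diff_distrib[symmetric] abs_mult)
      also have "\<dots> \<le> B * ((1 + 1 / \<rho>) * D\<^sup>2 + \<rho> * (H s)\<^sup>2)"
        using B s 1 by (intro mult_mono) auto
      finally show "\<bar>G s * (S k s)\<^sup>2 - G s * (H s)\<^sup>2\<bar> \<le> B * (1 + 1 / \<rho>) * (S k s - H s)\<^sup>2 + B * \<rho> * (H s)\<^sup>2"
        by (simp add: D_def algebra_simps)
    qed
    also have "\<dots> = B * (1 + 1 / \<rho>) * (LINT s:{0..T}|lborel. (S k s - H s)\<^sup>2) + B * \<rho> * h"
      using D2 H2 by (subst set_integral_add) (auto simp: h_def)
    finally show ?thesis .
  qed
  have "(\<lambda>k. B * (1 + 1 / \<rho>) * (LINT s:{0..T}|lborel. (S k s - H s)\<^sup>2)) \<longlonglongrightarrow> B * (1 + 1 / \<rho>) * 0"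
    by (intro tendsto_intros lim)
  then have "\<forall>\<^sub>F k in sequentially. B * (1 + 1 / \<rho>) * (LINT s:{0..T}|lborel. (S k s - H s)\<^sup>2) < r / 2"
    using r by (intro order_tendstoD(2)) auto
  then have "\<forall>\<^sub>F k in sequentially. norm ((LINT s:{0..T}|lborel. G s * (S k s)\<^sup>2) - (LINT s:{0..T}|lborel. G s * (H s)\<^sup>2)) < r"
  proof eventually_elim
    case (elim k)
    have "\<bar>(LINT s:{0..T}|lborel. G s * (S k s)\<^sup>2) - (LINT s:{0..T}|lborel. G s * (H s)\<^sup>2)\<bar> < r"
      using elim bound[of k] \<rho>h by linarith
    then show ?case by simp
  qed
  then show "\<exists>no. \<forall>k\<ge>no. norm ((LINT s:{0..T}|lborel. G s * (S k s)\<^sup>2) - (LINT s:{0..T}|lborel. G s * (H s)\<^sup>2)) < r"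
    by (simp add: eventually_sequentially)
qed

section \<open>Summation by parts and the limit of the exponent\<close>

lemma sum_by_parts:
  fixes x y :: "nat \<Rightarrow> 'b::comm_ring_1"
  shows "(\<Sum>j<n. x j * (y (Suc j) - y j)) = x n * y n - x 0 * y 0 - (\<Sum>j<n. y (Suc j) * (x (Suc j) - x j))"
  by (induction n) (simp_all add: algebra_simps)

text \<open>The sum of squares on the right is the discrete source of the Ito correction: for a
  stochastic integral it tends to the bracket and not to 0.\<close>

lemma sum_square_by_parts:
  fixes y :: "nat \<Rightarrow> real"
  shows "(\<Sum>j<n. y j * (y (Suc j) - y j)) = ((y n)\<^sup>2 - (y 0)\<^sup>2 - (\<Sum>j<n. (y (Suc j) - y j)\<^sup>2)) / 2"
  by (induction n) (simp_all add: field_simps power2_eq_square)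

text \<open>The limit is the exponent \<open>N\<^sub>T - \<langle>N\<rangle>\<^sub>T / 2\<close> for \<open>N = \<integral> (E + c I) dI\<close>: integration by parts takes
  care of \<open>\<integral> E dI\<close>, and \<open>\<integral> I dI = (I\<^sup>2 - \<langle>I\<rangle>) / 2\<close>.\<close>

lemma exponent_tendsto:
  fixes t \<eta> dW :: "nat \<Rightarrow> nat \<Rightarrow> real" and J S :: "nat \<Rightarrow> real \<Rightarrow> real" and H I e E :: "real \<Rightarrow> real"
  assumes t: "\<And>k. t k 0 = 0" "\<And>k. t k (N k) = T" "\<And>k j. j < N k \<Longrightarrow> t k j < t k (Suc j)"
      "\<And>k j. j < N k \<Longrightarrow> t k (Suc j) - t k j \<le> \<delta> k" "\<delta> \<longlonglongrightarrow> 0"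
    and S: "\<And>k j s. j < N k \<Longrightarrow> t k j < s \<Longrightarrow> s \<le> t k (Suc j) \<Longrightarrow> S k s = \<eta> k j"
      "\<And>k. S k \<in> borel_measurable borel"
    and J: "\<And>k. J k 0 = 0" "\<And>k j. j < N k \<Longrightarrow> J k (t k (Suc j)) - J k (t k j) = \<eta> k j * dW k j"
    and H: "set_borel_measurable lborel {0..T} H" "set_integrable lborel {0..T} (\<lambda>s. (H s)\<^sup>2)"
    and lim: "(\<lambda>k. LINT s:{0..T}|lborel. (S k s - H s)\<^sup>2) \<longlonglongrightarrow> 0"
      "uniform_limit {0..T} J I sequentially"
      "(\<lambda>k. \<Sum>j<N k. (\<eta> k j)\<^sup>2 * ((dW k j)\<^sup>2 - (t k (Suc j) - t k j))) \<longlonglongrightarrow> 0"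
    and I: "continuous_on {0..T} I"
    and E: "continuous_on {0..T} E" "set_integrable lborel {0..T} e"
      "\<And>x y. 0 \<le> x \<Longrightarrow> x \<le> y \<Longrightarrow> y \<le> T \<Longrightarrow> E y - E x = (LINT s:{x..y}|lborel. e s)"
  shows "(\<lambda>k. (\<Sum>j<N k. (E (t k j) + c * J k (t k j)) * \<eta> k j * dW k j)
        - (\<Sum>j<N k. ((E (t k j) + c * J k (t k j)) * \<eta> k j)\<^sup>2 * (t k (Suc j) - t k j)) / 2)
     \<longlonglongrightarrow> E T * I T - (LINT s:{0..T}|lborel. I s * e s) + c * ((I T)\<^sup>2 - (LINT s:{0..T}|lborel. (H s)\<^sup>2)) / 2
        - (LINT s:{0..T}|lborel. (E s + c * I s)\<^sup>2 * (H s)\<^sup>2) / 2"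
proof -
  have mono: "t k i \<le> t k j" if "i \<le> j" "j \<le> N k" for i j k
    by (rule grid_mono[of "N k"]) (use that t(3) in auto)
  have T: "0 \<le> T" using mono[of 0 "N 0" 0] t(1,2)[of 0] by simp
  have range: "t k j \<in> {0..T}" if "j \<le> N k" for k j
    using mono[of 0 j k] mono[of j "N k" k] t(1,2)[of k] that by simp
  have S2: "set_integrable lborel {0..T} (\<lambda>s. (S k s)\<^sup>2)" for k
  proof -
    \<comment> \<open>The cells are left-open and miss the point 0, hence the separate term for
      \<open>S k 0\<close>.\<close>
    define B where "B = \<bar>S k 0\<bar> + (\<Sum>j<N k. \<bar>\<eta> k j\<bar>)"
    have B: "\<bar>S k s\<bar> \<le> B" if s: "s \<in> {0..T}" for s
    proof (cases "s = 0")
      case True then show ?thesis by (simp add: B_def sum_nonneg)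
    next
      case False
      define j where "j = (LEAST j. s \<le> t k j)"
      have ex: "s \<le> t k (N k)" using s t(2)[of k] by simp
      have j: "s \<le> t k j" unfolding j_def by (rule LeastI[of "\<lambda>j. s \<le> t k j", OF ex])
      have jN: "j \<le> N k" unfolding j_def by (rule Least_le[of "\<lambda>j. s \<le> t k j", OF ex])
      have "j \<noteq> 0" using j False s t(1)[of k] by (metis antisym atLeastAtMost_iff)
      then obtain i where i: "j = Suc i" by (cases j) auto
      have "\<not> s \<le> t k i" using not_less_Least[of i "\<lambda>j. s \<le> t k j"] i j_def by simp
      then have "S k s = \<eta> k i" using S(1)[of i k s] j jN i by simp
      moreover have "\<bar>\<eta> k i\<bar> \<le> (\<Sum>j<N k. \<bar>\<eta> k j\<bar>)" using jN i by (intro member_le_sum) auto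
      ultimately show ?thesis by (simp add: B_def)
    qed
    have "set_integrable lborel {0..T} (\<lambda>s. B\<^sup>2)"
      by (intro borel_integrable_atLeastAtMost' continuous_intros)
    then show ?thesis
    proof (rule set_integrable_bound)
      show "set_borel_measurable lborel {0..T} (\<lambda>s. (S k s)\<^sup>2)"
        unfolding set_borel_measurable_def using S(2)[of k] by measurable
      show "AE s in lborel. s \<in> {0..T} \<longrightarrow> norm ((S k s)\<^sup>2) \<le> norm (B\<^sup>2)"
        by (intro AE_I2) (auto simp: abs_le_square_iff[symmetric] intro!: order_trans[OF B abs_ge_self])
    qed
  qed
  have D2: "set_integrable lborel {0..T} (\<lambda>s. (S k s - H s)\<^sup>2)" for k
  proof -
    have "set_integrable lborel {0..T} (\<lambda>s. 2 * (S k s)\<^sup>2 + 2 * (H s)\<^sup>2)"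
      using S2[of k] H(2) by (intro set_integral_add set_integrable_mult_right) auto
    then show ?thesis
    proof (rule set_integrable_bound)
      have m: "(\<lambda>s. (indicator {0..T} s * S k s - indicator {0..T} s *\<^sub>R H s)\<^sup>2) \<in> borel_measurable lborel"
        using S(2)[of k] H(1) unfolding set_borel_measurable_def by measurable
      show "set_borel_measurable lborel {0..T} (\<lambda>s. (S k s - H s)\<^sup>2)"
        unfolding set_borel_measurable_def
        using m by (rule measurable_cong[THEN iffD1, rotated]) (auto simp: indicator_def)
      show "AE s in lborel. s \<in> {0..T} \<longrightarrow> norm ((S k s - H s)\<^sup>2) \<le> norm (2 * (S k s)\<^sup>2 + 2 * (H s)\<^sup>2)"
      proof (intro AE_I2 impI)
        fix s
        have "0 \<le> (S k s + H s)\<^sup>2" by simp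
        then have "(S k s - H s)\<^sup>2 \<le> 2 * (S k s)\<^sup>2 + 2 * (H s)\<^sup>2"
          by (simp add: power2_diff power2_sum)
        then show "norm ((S k s - H s)\<^sup>2) \<le> norm (2 * (S k s)\<^sup>2 + 2 * (H s)\<^sup>2)"
          by simp
      qed
    qed
  qed
  have Sj: "(LINT s:{t k j..t k (Suc j)}|lborel. (S k s)\<^sup>2) = (\<eta> k j)\<^sup>2 * (t k (Suc j) - t k j)" if j: "j < N k" for k j
  proof -
    have "(LINT s:{t k j..t k (Suc j)}|lborel. (S k s)\<^sup>2) = (LINT s:{t k j..t k (Suc j)}|lborel. (\<eta> k j)\<^sup>2)"
    proof (rule set_lebesgue_integral_cong_AE)
      show "AE s\<in>{t k j..t k (Suc j)} in lborel. (S k s)\<^sup>2 = (\<eta> k j)\<^sup>2"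
        using AE_lborel_singleton[of "t k j"] by eventually_elim (use S(1)[OF j] in auto)
    qed (use S(2)[of k] in measurable)
    then show ?thesis using t(3)[OF j] by (simp add: set_lebesgue_integral_def)
  qed
  have S_lim: "(\<lambda>k. LINT s:{0..T}|lborel. G s * (S k s)\<^sup>2) \<longlonglongrightarrow> (LINT s:{0..T}|lborel. G s * (H s)\<^sup>2)"
    if "continuous_on {0..T} G" for G
    by (rule weighted_square_tendsto[OF that H(2) S2 D2 lim(1)])
  have S_lim1: "(\<lambda>k. LINT s:{0..T}|lborel. (S k s)\<^sup>2) \<longlonglongrightarrow> (LINT s:{0..T}|lborel. (H s)\<^sup>2)"
    using S_lim[of "\<lambda>_. 1"] by simp
  have S_sum: "(LINT s:{0..T}|lborel. (S k s)\<^sup>2) = (\<Sum>j<N k. (\<eta> k j)\<^sup>2 * (t k (Suc j) - t k j))" for k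
  proof -
    have "(LINT s:{t k 0..t k (N k)}|lborel. (S k s)\<^sup>2) = (\<Sum>j<N k. (LINT s:{t k j..t k (Suc j)}|lborel. (S k s)\<^sup>2))"
      using S2[of k] t(1,2)[of k] by (intro set_integral_grid t(3)) auto
    then show ?thesis using Sj[of _ k] t(1,2)[of k] by simp
  qed
  have J_lim: "(\<lambda>k. J k s) \<longlonglongrightarrow> I s" if "s \<in> {0..T}" for s
    by (rule tendsto_uniform_limitI[OF lim(2) that])
  \<comment> \<open>This is \<integral> E dI. Summation by parts moves the increments onto
    \<open>E\<close>, where they are integrals of \<open>e\<close>. It leaves \<open>J\<close> at
    right end points, which is harmless in the limit because the integral of |e| is finite.\<close>
  have part1: "(\<lambda>k. \<Sum>j<N k. E (t k j) * (\<eta> k j * dW k j)) \<longlonglongrightarrow> E T * I T - (LINT s:{0..T}|lborel. I s * e s)"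
  proof -
    have eq: "(\<Sum>j<N k. E (t k j) * (\<eta> k j * dW k j)) =
        E T * J k T - (\<Sum>j<N k. J k (t k (Suc j)) * (LINT s:{t k j..t k (Suc j)}|lborel. e s))" for k
    proof -
      have "(\<Sum>j<N k. E (t k j) * (\<eta> k j * dW k j)) = (\<Sum>j<N k. E (t k j) * (J k (t k (Suc j)) - J k (t k j)))"
        using J(2)[of _ k] by simp
      also have "\<dots> = E T * J k T - (\<Sum>j<N k. J k (t k (Suc j)) * (E (t k (Suc j)) - E (t k j)))"
        unfolding sum_by_parts[of "\<lambda>j. E (t k j)" "\<lambda>j. J k (t k j)"] using t(1,2)[of k] J(1)[of k] by simp
      also have "(\<Sum>j<N k. J k (t k (Suc j)) * (E (t k (Suc j)) - E (t k j))) =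
         (\<Sum>j<N k. J k (t k (Suc j)) * (LINT s:{t k j..t k (Suc j)}|lborel. e s))"
        using range[of _ k] t(3)[of _ k] by (intro sum.cong refl arg_cong2[where f="(*)"] E(3)) (auto simp: less_imp_le Suc_le_eq)
      finally show ?thesis .
    qed
    have "(\<lambda>k. (\<Sum>j<N k. J k (t k (Suc j)) * (LINT s:{t k j..t k (Suc j)}|lborel. e s))
       - (LINT s:{0..T}|lborel. I s * e s)) \<longlonglongrightarrow> 0"
      using t(3)
      by (intro riemann_sum_tendsto[where \<delta>=\<delta> and B="LINT s:{0..T}|lborel. \<bar>e s\<bar>"] t lim(2) I E(2)) (auto simp: less_imp_le)
    then have "(\<lambda>k. (\<Sum>j<N k. J k (t k (Suc j)) * (LINT s:{t k j..t k (Suc j)}|lborel. e s))) \<longlonglongrightarrow> (LINT s:{0..T}|lborel. I s * e s)"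
      by (simp add: LIM_zero_iff)
    then show ?thesis unfolding eq using J_lim[of T] T by (intro tendsto_intros) auto
  qed
  \<comment> \<open>This is \<integral> I dI. The squared increments of \<open>J\<close> split into
    a fluctuation that tends to 0 and the exact integral of \<open>(S k s)\<^sup>2\<close>.\<close>
  have part2: "(\<lambda>k. \<Sum>j<N k. J k (t k j) * (\<eta> k j * dW k j)) \<longlonglongrightarrow> ((I T)\<^sup>2 - (LINT s:{0..T}|lborel. (H s)\<^sup>2)) / 2"
  proof -
    have eq: "(\<Sum>j<N k. J k (t k j) * (\<eta> k j * dW k j)) =
        ((J k T)\<^sup>2 - ((\<Sum>j<N k. (\<eta> k j)\<^sup>2 * ((dW k j)\<^sup>2 - (t k (Suc j) - t k j))) + (LINT s:{0..T}|lborel. (S k s)\<^sup>2))) / 2" for k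
    proof -
      have "(\<Sum>j<N k. J k (t k j) * (\<eta> k j * dW k j)) = (\<Sum>j<N k. J k (t k j) * (J k (t k (Suc j)) - J k (t k j)))"
        using J(2)[of _ k] by simp
      also have "\<dots> = ((J k T)\<^sup>2 - (\<Sum>j<N k. (J k (t k (Suc j)) - J k (t k j))\<^sup>2)) / 2"
        unfolding sum_square_by_parts[of "\<lambda>j. J k (t k j)"] using t(1,2)[of k] J(1)[of k] by simp
      also have "(\<Sum>j<N k. (J k (t k (Suc j)) - J k (t k j))\<^sup>2) =
        (\<Sum>j<N k. (\<eta> k j)\<^sup>2 * ((dW k j)\<^sup>2 - (t k (Suc j) - t k j))) + (LINT s:{0..T}|lborel. (S k s)\<^sup>2)"
        unfolding S_sum sum.distrib[symmetric] using J(2)[of _ k] by (intro sum.cong) (auto simp: power_mult_distrib algebra_simps)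
      finally show ?thesis .
    qed
    have "(\<lambda>k. ((J k T)\<^sup>2 - ((\<Sum>j<N k. (\<eta> k j)\<^sup>2 * ((dW k j)\<^sup>2 - (t k (Suc j) - t k j))) + (LINT s:{0..T}|lborel. (S k s)\<^sup>2))) / 2)
       \<longlonglongrightarrow> ((I T)\<^sup>2 - (0 + (LINT s:{0..T}|lborel. (H s)\<^sup>2))) / 2"
      using J_lim[of T] T by (intro tendsto_intros lim(3) S_lim1) auto
    then show ?thesis unfolding eq by simp
  qed
  have part3: "(\<lambda>k. \<Sum>j<N k. ((E (t k j) + c * J k (t k j)) * \<eta> k j)\<^sup>2 * (t k (Suc j) - t k j)) \<longlonglongrightarrow>
    (LINT s:{0..T}|lborel. (E s + c * I s)\<^sup>2 * (H s)\<^sup>2)"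
  proof -
    define K where "K k s = (E s + c * J k s)\<^sup>2" for k s
    define K0 where "K0 s = (E s + c * I s)\<^sup>2" for s
    have K0: "continuous_on {0..T} K0" unfolding K0_def by (intro continuous_intros E I)
    have "bounded ((\<lambda>s. E s + c * I s) ` {0..T})"
      by (intro compact_imp_bounded compact_continuous_image continuous_intros E I) auto
    moreover have "uniform_limit {0..T} (\<lambda>k s. E s + c * J k s) (\<lambda>s. E s + c * I s) sequentially"
      by (intro uniform_limit_intros lim(2))
    ultimately have K: "uniform_limit {0..T} K K0 sequentially"
      unfolding K_def K0_def power2_eq_square by (intro uniform_lim_mult)
    \<comment> \<open>A convergent sequence is bounded; this supplies the uniform L1 bound on the
      densities \<open>(S k s)\<^sup>2\<close>.\<close>
    obtain B where B: "\<And>k. \<bar>LINT s:{0..T}|lborel. (S k s)\<^sup>2\<bar> \<le> B"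
      using convergent_imp_Bseq[OF convergentI[OF S_lim1]] by (auto simp: Bseq_def)
    have "(\<lambda>k. (\<Sum>j<N k. K k (t k j) * (LINT s:{t k j..t k (Suc j)}|lborel. (S k s)\<^sup>2))
       - (LINT s:{0..T}|lborel. K0 s * (S k s)\<^sup>2)) \<longlonglongrightarrow> 0"
    proof (rule riemann_sum_tendsto[where \<delta>=\<delta> and B=B, OF t K K0 S2])
      show "(LINT s:{0..T}|lborel. \<bar>(S k s)\<^sup>2\<bar>) \<le> B" for k using B[of k] by simp
      show "t k j \<in> {t k j..t k (Suc j)}" if "j < N k" for k j using t(3)[OF that] by simp
    qed
    from tendsto_add[OF this S_lim[OF K0]]
    have "(\<lambda>k. \<Sum>j<N k. K k (t k j) * (LINT s:{t k j..t k (Suc j)}|lborel. (S k s)\<^sup>2)) \<longlonglongrightarrow> (LINT s:{0..T}|lborel. K0 s * (H s)\<^sup>2)"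
      by simp
    moreover have "(\<Sum>j<N k. K k (t k j) * (LINT s:{t k j..t k (Suc j)}|lborel. (S k s)\<^sup>2)) =
      (\<Sum>j<N k. ((E (t k j) + c * J k (t k j)) * \<eta> k j)\<^sup>2 * (t k (Suc j) - t k j))" for k
      by (intro sum.cong) (auto simp: Sj K_def power_mult_distrib)
    ultimately show ?thesis by (simp add: K0_def)
  qed
  have "(\<lambda>k. ((\<Sum>j<N k. E (t k j) * (\<eta> k j * dW k j)) + c * (\<Sum>j<N k. J k (t k j) * (\<eta> k j * dW k j)))
        - (\<Sum>j<N k. ((E (t k j) + c * J k (t k j)) * \<eta> k j)\<^sup>2 * (t k (Suc j) - t k j)) / 2)
     \<longlonglongrightarrow> ((E T * I T - (LINT s:{0..T}|lborel. I s * e s)) + c * (((I T)\<^sup>2 - (LINT s:{0..T}|lborel. (H s)\<^sup>2)) / 2))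
        - (LINT s:{0..T}|lborel. (E s + c * I s)\<^sup>2 * (H s)\<^sup>2) / 2"
    by (intro tendsto_intros part1 part2 part3) auto
  moreover have "(\<Sum>j<N k. E (t k j) * (\<eta> k j * dW k j)) + c * (\<Sum>j<N k. J k (t k j) * (\<eta> k j * dW k j)) =
    (\<Sum>j<N k. (E (t k j) + c * J k (t k j)) * \<eta> k j * dW k j)" for k
    unfolding sum_distrib_left sum.distrib[symmetric] by (intro sum.cong) (auto simp: algebra_simps)
  ultimately show ?thesis by simp
qed

section \<open>The exponential inequality for Ito integrals\<close>

lemma simple_process_val_borel: "(\<lambda>s. simple_process_val n \<tau> \<xi> s \<omega>) \<in> borel_measurable borel"
  unfolding simple_process_val_def by measurable

text \<open>The exceptional sets need not be measurable. Their outer measure is attained on a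
  measurable superset, and to such supersets Borel-Cantelli applies.\<close>

lemma outer_measure_of_superset:
  assumes lim: "(\<lambda>k. outer_measure_of M (A k)) \<longlonglongrightarrow> 0" and A: "\<And>k. A k \<subseteq> space M" and "\<epsilon> > 0"
  shows "\<forall>\<^sub>F k in sequentially. \<exists>B\<in>sets M. A k \<subseteq> B \<and> emeasure M B < ennreal \<epsilon>"
proof -
  have "\<forall>\<^sub>F k in sequentially. outer_measure_of M (A k) < ennreal \<epsilon>"
    using lim \<open>\<epsilon> > 0\<close> by (intro order_tendstoD(2)) auto
  then show ?thesis
  proof eventually_elim
    case (elim k)
    then show ?case using outer_measure_of_attain[OF A] by metis
  qed
qed

context wiener
begin

lemma borel_cantelli_geometric:
  assumes B: "\<And>k. B k \<in> events" "\<And>k. emeasure M (B k) \<le> ennreal ((1 / 2) ^ k)"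
  shows "AE \<omega> in M. \<forall>\<^sub>F k in sequentially. \<omega> \<in> space M - B k"
proof (rule borel_cantelli_AE1)
  show "summable (\<lambda>k. prob (B k))"
  proof (rule summable_comparison_test')
    show "summable (\<lambda>k. (1 / 2) ^ k :: real)" by (intro summable_geometric) simp
    show "norm (prob (B k)) \<le> (1 / 2) ^ k" if "k \<ge> 0" for k
      using B(2)[of k] by (simp add: emeasure_eq_measure)
  qed
qed (use B in \<open>auto simp: less_top[symmetric]\<close>)

text \<open>Convergence in probability becomes almost sure along a subsequence whose exceptional
  events have probability at most 2^-m. The grid for the m-th process is then refined until its
  quadratic variation error obeys the same bound, so that one index serves all three limits.\<close>

lemma ito_integral_approximation:
  assumes ito: "has_ito_integral M F W H I" and T: "T > 0"
  obtains N :: "nat \<Rightarrow> nat" and t :: "nat \<Rightarrow> nat \<Rightarrow> real" and \<eta> :: "nat \<Rightarrow> nat \<Rightarrow> 'a \<Rightarrow> real"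
    and S J :: "nat \<Rightarrow> real \<Rightarrow> 'a \<Rightarrow> real"
  where "\<And>k. t k 0 = 0" "\<And>k. t k (N k) = T" "\<And>k j. j < N k \<Longrightarrow> t k j < t k (Suc j)"
    "\<And>k j. j < N k \<Longrightarrow> t k (Suc j) - t k j \<le> (1 / 2) ^ k"
    "\<And>k j. j < N k \<Longrightarrow> \<eta> k j \<in> borel_measurable (F (t k j))"
    "\<And>k j s \<omega>. j < N k \<Longrightarrow> t k j < s \<Longrightarrow> s \<le> t k (Suc j) \<Longrightarrow> S k s \<omega> = \<eta> k j \<omega>"
    "\<And>k \<omega>. (\<lambda>s. S k s \<omega>) \<in> borel_measurable borel"
    "\<And>k \<omega>. J k 0 \<omega> = 0"
    "\<And>k j \<omega>. j < N k \<Longrightarrow> J k (t k (Suc j)) \<omega> - J k (t k j) \<omega> = \<eta> k j \<omega> * (W (t k (Suc j)) \<omega> - W (t k j) \<omega>)"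
    "AE \<omega> in M. (\<lambda>k. LINT s:{0..T}|lborel. (S k s \<omega> - H s \<omega>)\<^sup>2) \<longlonglongrightarrow> 0"
    "AE \<omega> in M. uniform_limit {0..T} (\<lambda>k s. J k s \<omega>) (\<lambda>s. I s \<omega>) sequentially"
    "AE \<omega> in M. (\<lambda>k. \<Sum>j<N k. (\<eta> k j \<omega>)\<^sup>2 * ((W (t k (Suc j)) \<omega> - W (t k j) \<omega>)\<^sup>2 - (t k (Suc j) - t k j))) \<longlonglongrightarrow> 0"
proof -
  have "\<exists>(n :: nat \<Rightarrow> nat) (\<tau> :: nat \<Rightarrow> nat \<Rightarrow> real) (\<xi> :: nat \<Rightarrow> nat \<Rightarrow> 'a \<Rightarrow> real).
        (\<forall>k. simple_process F (n k) (\<tau> k) (\<xi> k)) \<and>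
        (\<forall>T>0. \<forall>\<epsilon>>0.
           (\<lambda>k. outer_measure_of M {\<omega>\<in>space M.
              (LINT t:{0..T}|lborel. (simple_process_val (n k) (\<tau> k) (\<xi> k) t \<omega> - H t \<omega>)\<^sup>2) > \<epsilon>})
             \<longlonglongrightarrow> 0) \<and>
        (\<forall>T>0. \<forall>\<epsilon>>0.
           (\<lambda>k. outer_measure_of M {\<omega>\<in>space M.
              \<exists>t\<in>{0..T}. \<bar>simple_ito_integral W (n k) (\<tau> k) (\<xi> k) t \<omega> - I t \<omega>\<bar> > \<epsilon>})
             \<longlonglongrightarrow> 0)"
    using ito unfolding has_ito_integral_def by (elim conjE)
  then obtain n :: "nat \<Rightarrow> nat" and \<tau> :: "nat \<Rightarrow> nat \<Rightarrow> real" and \<xi> :: "nat \<Rightarrow> nat \<Rightarrow> 'a \<Rightarrow> real"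
    where sp0: "\<forall>k. simple_process F (n k) (\<tau> k) (\<xi> k)"
    and l1: "\<forall>T>0. \<forall>\<epsilon>>0.
           (\<lambda>k. outer_measure_of M {\<omega>\<in>space M.
              (LINT t:{0..T}|lborel. (simple_process_val (n k) (\<tau> k) (\<xi> k) t \<omega> - H t \<omega>)\<^sup>2) > \<epsilon>})
             \<longlonglongrightarrow> 0"
    and l2: "\<forall>T>0. \<forall>\<epsilon>>0.
           (\<lambda>k. outer_measure_of M {\<omega>\<in>space M.
              \<exists>t\<in>{0..T}. \<bar>simple_ito_integral W (n k) (\<tau> k) (\<xi> k) t \<omega> - I t \<omega>\<bar> > \<epsilon>})
             \<longlonglongrightarrow> 0"
    by (elim exE conjE)
  note sp = sp0[rule_format]
  note lim1 = l1[rule_format, OF T] and lim2 = l2[rule_format, OF T]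
  let ?S = "\<lambda>k. simple_process_val (n k) (\<tau> k) (\<xi> k)"
  let ?J = "\<lambda>k. simple_ito_integral W (n k) (\<tau> k) (\<xi> k)"
  define U where "U k m = {\<omega>\<in>space M. (LINT s:{0..T}|lborel. (?S k s \<omega> - H s \<omega>)\<^sup>2) > (1 / 2) ^ m}" for k m :: nat
  define V where "V k m = {\<omega>\<in>space M. \<exists>s\<in>{0..T}. \<bar>?J k s \<omega> - I s \<omega>\<bar> > (1 / 2) ^ m}" for k m :: nat
  have "\<exists>k. (\<exists>A\<in>events. U k m \<subseteq> A \<and> emeasure M A < ennreal ((1 / 2) ^ m)) \<and>
      (\<exists>B\<in>events. V k m \<subseteq> B \<and> emeasure M B < ennreal ((1 / 2) ^ m))" for m :: nat
  proof -
    have pos: "(1 / 2 :: real) ^ m > 0" by simp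
    have "\<forall>\<^sub>F k in sequentially. (\<exists>A\<in>events. U k m \<subseteq> A \<and> emeasure M A < ennreal ((1 / 2) ^ m)) \<and>
      (\<exists>B\<in>events. V k m \<subseteq> B \<and> emeasure M B < ennreal ((1 / 2) ^ m))"
      unfolding U_def V_def by (intro eventually_conj outer_measure_of_superset lim1 lim2 pos) auto
    then show ?thesis by (rule eventually_happens'[OF sequentially_bot])
  qed
  then obtain \<kappa> A B where A: "\<And>m. A m \<in> events" "\<And>m. emeasure M (A m) < ennreal ((1 / 2) ^ m)" "\<And>m. U (\<kappa> m) m \<subseteq> A m"
    and B: "\<And>m. B m \<in> events" "\<And>m. emeasure M (B m) < ennreal ((1 / 2) ^ m)" "\<And>m. V (\<kappa> m) m \<subseteq> B m"
    by metis
  have SA: "(LINT s:{0..T}|lborel. (?S (\<kappa> m) s \<omega> - H s \<omega>)\<^sup>2) \<le> (1 / 2) ^ m" if "\<omega> \<in> space M - A m" for m \<omega>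
    using that A(3)[of m] unfolding U_def subset_eq by (auto simp: not_less[symmetric])
  have JB: "\<bar>?J (\<kappa> m) s \<omega> - I s \<omega>\<bar> \<le> (1 / 2) ^ m" if "\<omega> \<in> space M - B m" "s \<in> {0..T}" for m \<omega> s
  proof (rule ccontr)
    assume "\<not> \<bar>?J (\<kappa> m) s \<omega> - I s \<omega>\<bar> \<le> (1 / 2) ^ m"
    then have "\<omega> \<in> V (\<kappa> m) m" using that unfolding V_def by (auto simp: not_le)
    then show False using that B(3)[of m] by auto
  qed
  define S where "S m = ?S (\<kappa> m)" for m
  define J where "J m = ?J (\<kappa> m)" for m
  \<comment> \<open>\<open>P\<close> bundles grid, step values and exceptional event, so that a
    single choice for each \<open>m\<close> delivers mutually compatible sequences.\<close>
  define P where "P m N t \<eta> D \<longleftrightarrow> t 0 = 0 \<and> t N = T \<and> (\<forall>j<N. t j < t (Suc j)) \<and> (\<forall>j<N. t (Suc j) - t j \<le> (1 / 2) ^ m) \<and>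
    (\<forall>j<N. \<eta> j \<in> borel_measurable (F (t j))) \<and>
    (\<forall>j<N. \<forall>s \<omega>. t j < s \<longrightarrow> s \<le> t (Suc j) \<longrightarrow> S m s \<omega> = \<eta> j \<omega>) \<and>
    (\<forall>j<N. \<forall>\<omega>. J m (t (Suc j)) \<omega> - J m (t j) \<omega> = \<eta> j \<omega> * (W (t (Suc j)) \<omega> - W (t j) \<omega>)) \<and>
    D \<in> events \<and> emeasure M D \<le> ennreal ((1 / 2) ^ m) \<and>
    (\<forall>\<omega>\<in>space M - D. \<bar>\<Sum>j<N. (\<eta> j \<omega>)\<^sup>2 * ((W (t (Suc j)) \<omega> - W (t j) \<omega>)\<^sup>2 - (t (Suc j) - t j))\<bar> \<le> (1 / 2) ^ m)"
    for m N :: nat and t :: "nat \<Rightarrow> real" and \<eta> :: "nat \<Rightarrow> 'a \<Rightarrow> real" and D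
  have "\<exists>N t \<eta> D. P m N t \<eta> D" for m :: nat
  proof -
    obtain C where C: "C > 0" "\<And>s \<omega>. \<omega> \<in> space M \<Longrightarrow> \<bar>S m s \<omega>\<bar> \<le> C"
      unfolding S_def using simple_process_val_bounded[OF sp] by blast
    have pos: "(1 / 2 :: real) ^ m > 0" by simp
    show ?thesis
    proof (rule grid_quadratic_variation[OF T C(1) pos])
      fix \<delta> :: real
      assume \<delta>: "\<delta> > 0"
        "\<And>(N::nat) t \<eta>. t 0 = 0 \<Longrightarrow> t N = T \<Longrightarrow> (\<And>j. j < N \<Longrightarrow> t j < t (Suc j)) \<Longrightarrow>
        (\<And>j. j < N \<Longrightarrow> t (Suc j) - t j \<le> \<delta>) \<Longrightarrow>
        (\<And>j. j < N \<Longrightarrow> \<eta> j \<in> borel_measurable (F (t j))) \<Longrightarrow>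
        (\<And>j \<omega>. j < N \<Longrightarrow> \<omega> \<in> space M \<Longrightarrow> \<bar>\<eta> j \<omega>\<bar> \<le> C) \<Longrightarrow>
        \<exists>B\<in>events. emeasure M B \<le> ennreal ((1 / 2) ^ m) \<and> (\<forall>\<omega>\<in>space M - B.
          \<bar>\<Sum>j<N. (\<eta> j \<omega>)\<^sup>2 * ((W (t (Suc j)) \<omega> - W (t j) \<omega>)\<^sup>2 - (t (Suc j) - t j))\<bar> \<le> (1 / 2) ^ m)"
      \<comment> \<open>The mesh meets two demands: \<delta> for the quadratic variation, and 2^-m
        so that it tends to 0.\<close>
      have pos2: "min \<delta> ((1 / 2) ^ m) > 0" using \<delta>(1) by simp
      show "\<exists>N t \<eta> D. P m N t \<eta> D"
      proof (rule simple_process_refine[OF sp[of "\<kappa> m"] T pos2, folded S_def J_def])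
        fix N :: nat and t :: "nat \<Rightarrow> real" and \<eta> :: "nat \<Rightarrow> 'a \<Rightarrow> real"
        assume N: "t 0 = 0" "t N = T"
          "\<And>j. j < N \<Longrightarrow> t j < t (Suc j)" "\<And>j. j < N \<Longrightarrow> t (Suc j) - t j \<le> min \<delta> ((1 / 2) ^ m)"
          "\<And>j. j < N \<Longrightarrow> \<eta> j \<in> borel_measurable (F (t j))"
          "\<And>j s \<omega>. j < N \<Longrightarrow> t j < s \<Longrightarrow> s \<le> t (Suc j) \<Longrightarrow> S m s \<omega> = \<eta> j \<omega>"
          "\<And>j \<omega>. j < N \<Longrightarrow> J m (t (Suc j)) \<omega> - J m (t j) \<omega> = \<eta> j \<omega> * (W (t (Suc j)) \<omega> - W (t j) \<omega>)"
        have "\<exists>D\<in>events. emeasure M D \<le> ennreal ((1 / 2) ^ m) \<and> (\<forall>\<omega>\<in>space M - D.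
            \<bar>\<Sum>j<N. (\<eta> j \<omega>)\<^sup>2 * ((W (t (Suc j)) \<omega> - W (t j) \<omega>)\<^sup>2 - (t (Suc j) - t j))\<bar> \<le> (1 / 2) ^ m)"
        proof (rule \<delta>(2))
          show "\<bar>\<eta> j \<omega>\<bar> \<le> C" if "j < N" "\<omega> \<in> space M" for j \<omega>
            using N(6)[OF that(1), of "t (Suc j)" \<omega>] N(3)[OF that(1)] C(2)[OF that(2), of "t (Suc j)"] by simp
        qed (use N in \<open>auto\<close>)
        then obtain D where "D \<in> events" "emeasure M D \<le> ennreal ((1 / 2) ^ m)" "\<forall>\<omega>\<in>space M - D.
            \<bar>\<Sum>j<N. (\<eta> j \<omega>)\<^sup>2 * ((W (t (Suc j)) \<omega> - W (t j) \<omega>)\<^sup>2 - (t (Suc j) - t j))\<bar> \<le> (1 / 2) ^ m" by blast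
        then have "P m N t \<eta> D" unfolding P_def using N(1-3,5-7) N(4)[unfolded min.bounded_iff]
          by (intro conjI allI impI) (assumption | simp)+
        then show "\<exists>N t \<eta> D. P m N t \<eta> D" by blast
      qed
    qed
  qed
  then obtain N t \<eta> D where P: "\<And>m. P m (N m) (t m) (\<eta> m) (D m)" by metis
  note P' = P[unfolded P_def]
  have D: "D k \<in> events" "emeasure M (D k) \<le> ennreal ((1 / 2) ^ k)"
    "\<forall>\<omega>\<in>space M - D k. \<bar>\<Sum>j<N k. (\<eta> k j \<omega>)\<^sup>2 * ((W (t k (Suc j)) \<omega> - W (t k j) \<omega>)\<^sup>2 - (t k (Suc j) - t k j))\<bar> \<le> (1 / 2) ^ k" for k
    using P'[of k] by - (elim conjE, assumption)+
  have half: "(\<lambda>m. (1 / 2 :: real) ^ m) \<longlonglongrightarrow> 0" by (rule LIMSEQ_power_zero) simp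
  show ?thesis
  proof (rule that[of t N \<eta> S J])
    show "J k 0 \<omega> = 0" for k \<omega>
    proof -
      have "0 \<le> \<tau> (\<kappa> k) i" if "i \<le> n (\<kappa> k)" for i
        using grid_mono[of "n (\<kappa> k)" "\<tau> (\<kappa> k)" 0 i] sp[of "\<kappa> k"] that by (force simp: simple_process_def)
      then show ?thesis unfolding J_def simple_ito_integral_def by (intro sum.neutral) (auto simp: min_def)
    qed
    show "(\<lambda>s. S k s \<omega>) \<in> borel_measurable borel" for k \<omega>
      unfolding S_def by (rule simple_process_val_borel)
    have "AE \<omega> in M. \<forall>\<^sub>F k in sequentially. \<omega> \<in> space M - A k"
      using A by (intro borel_cantelli_geometric) (auto intro: less_imp_le)
    then show "AE \<omega> in M. (\<lambda>k. LINT s:{0..T}|lborel. (S k s \<omega> - H s \<omega>)\<^sup>2) \<longlonglongrightarrow> 0"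
    proof eventually_elim
      case (elim \<omega>)
      show ?case
      proof (rule tendsto_sandwich[OF _ _ tendsto_const half])
        show "\<forall>\<^sub>F k in sequentially. 0 \<le> (LINT s:{0..T}|lborel. (S k s \<omega> - H s \<omega>)\<^sup>2)"
          unfolding set_lebesgue_integral_def by (intro always_eventually allI integral_nonneg_AE) auto
        show "\<forall>\<^sub>F k in sequentially. (LINT s:{0..T}|lborel. (S k s \<omega> - H s \<omega>)\<^sup>2) \<le> (1 / 2) ^ k"
          using elim by eventually_elim (simp add: S_def SA)
      qed
    qed
    have "AE \<omega> in M. \<forall>\<^sub>F k in sequentially. \<omega> \<in> space M - B k"
      using B by (intro borel_cantelli_geometric) (auto intro: less_imp_le)
    then show "AE \<omega> in M. uniform_limit {0..T} (\<lambda>k s. J k s \<omega>) (\<lambda>s. I s \<omega>) sequentially"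
    proof eventually_elim
      case (elim \<omega>)
      show ?case
      proof (rule uniform_limitI)
        fix e :: real assume "e > 0"
        then have "\<forall>\<^sub>F k in sequentially. (1 / 2) ^ k < e" by (rule order_tendstoD(2)[OF half])
        then show "\<forall>\<^sub>F k in sequentially. \<forall>s\<in>{0..T}. dist (J k s \<omega>) (I s \<omega>) < e"
          using elim
        proof eventually_elim
          case (elim k)
          then show ?case using JB[OF elim(2)] unfolding J_def dist_real_def by fastforce
        qed
      qed
    qed
    have "AE \<omega> in M. \<forall>\<^sub>F k in sequentially. \<omega> \<in> space M - D k"
      using D(1,2) by (intro borel_cantelli_geometric) auto
    then show "AE \<omega> in M. (\<lambda>k. \<Sum>j<N k. (\<eta> k j \<omega>)\<^sup>2 * ((W (t k (Suc j)) \<omega> - W (t k j) \<omega>)\<^sup>2 - (t k (Suc j) - t k j))) \<longlonglongrightarrow> 0"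
    proof eventually_elim
      case (elim \<omega>)
      show ?case
      proof (rule Lim_null_comparison[OF _ half])
        show "\<forall>\<^sub>F k in sequentially. norm (\<Sum>j<N k. (\<eta> k j \<omega>)\<^sup>2 * ((W (t k (Suc j)) \<omega> - W (t k j) \<omega>)\<^sup>2 - (t k (Suc j) - t k j))) \<le> (1 / 2) ^ k"
          using elim by eventually_elim (use D(3) in auto)
      qed
    qed
    show "t k 0 = 0" "t k (N k) = T" for k using P'[of k] by - (elim conjE, assumption)+
    fix k j assume j: "j < N k"
    show "t k j < t k (Suc j)" using P'[of k] j by (elim conjE) simp
    show "t k (Suc j) - t k j \<le> (1 / 2) ^ k" using P'[of k] j by (elim conjE) simp
    show "\<eta> k j \<in> borel_measurable (F (t k j))" using P'[of k] j by (elim conjE) simp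
    show "S k s \<omega> = \<eta> k j \<omega>" if "t k j < s" "s \<le> t k (Suc j)" for s \<omega>
      using P'[of k] j that by (elim conjE) simp
    show "J k (t k (Suc j)) \<omega> - J k (t k j) \<omega> = \<eta> k j \<omega> * (W (t k (Suc j)) \<omega> - W (t k j) \<omega>)" for \<omega>
      using P'[of k] j by (elim conjE) simp
  qed
qed

text \<open>\<open>V\<close> is the lower limit of the discrete exponentials and measurable as such,
  while the exponential that it equals almost surely contains pathwise integrals. The probabilistic
  content sits in the discrete bound; the exponent itself converges path by path.\<close>

lemma exp_ito_integral_le_1:
  assumes ito: "has_ito_integral M F W H I" and T: "T > 0"
    and Em: "\<And>s. 0 \<le> s \<Longrightarrow> s \<le> T \<Longrightarrow> E s \<in> borel_measurable (F s)"
    and Ec: "AE \<omega> in M. continuous_on {0..T} (\<lambda>s. E s \<omega>)"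
    and e: "AE \<omega> in M. set_integrable lborel {0..T} (\<lambda>s. e s \<omega>)"
    and Ee: "AE \<omega> in M. \<forall>x y. 0 \<le> x \<longrightarrow> x \<le> y \<longrightarrow> y \<le> T \<longrightarrow> E y \<omega> - E x \<omega> = (LINT s:{x..y}|lborel. e s \<omega>)"
  obtains V where "V \<in> borel_measurable M" "(\<integral>\<^sup>+\<omega>. V \<omega> \<partial>M) \<le> 1"
    "AE \<omega> in M. V \<omega> = ennreal (exp (E T \<omega> * I T \<omega> - (LINT s:{0..T}|lborel. I s \<omega> * e s \<omega>)
        + c * ((I T \<omega>)\<^sup>2 - (LINT s:{0..T}|lborel. (H s \<omega>)\<^sup>2)) / 2
        - (LINT s:{0..T}|lborel. (E s \<omega> + c * I s \<omega>)\<^sup>2 * (H s \<omega>)\<^sup>2) / 2))"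
proof -
  have H: "AE \<omega> in M. set_borel_measurable lborel {0..T} (\<lambda>s. H s \<omega>) \<and> set_integrable lborel {0..T} (\<lambda>s. (H s \<omega>)\<^sup>2)"
    using ito T unfolding has_ito_integral_def by (auto elim!: eventually_mono)
  have Ic: "AE \<omega> in M. continuous_on {0..} (\<lambda>s. I s \<omega>)"
    using ito unfolding has_ito_integral_def by auto
  show ?thesis
  proof (rule ito_integral_approximation[OF ito T])
    fix N :: "nat \<Rightarrow> nat" and t :: "nat \<Rightarrow> nat \<Rightarrow> real" and \<eta> :: "nat \<Rightarrow> nat \<Rightarrow> 'a \<Rightarrow> real" and S J :: "nat \<Rightarrow> real \<Rightarrow> 'a \<Rightarrow> real"
    assume t: "\<And>k. t k 0 = 0" "\<And>k. t k (N k) = T" "\<And>k j. j < N k \<Longrightarrow> t k j < t k (Suc j)"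
      "\<And>k j. j < N k \<Longrightarrow> t k (Suc j) - t k j \<le> (1 / 2) ^ k"
      and \<eta>: "\<And>k j. j < N k \<Longrightarrow> \<eta> k j \<in> borel_measurable (F (t k j))"
      and S: "\<And>k j s \<omega>. j < N k \<Longrightarrow> t k j < s \<Longrightarrow> s \<le> t k (Suc j) \<Longrightarrow> S k s \<omega> = \<eta> k j \<omega>"
      "\<And>k \<omega>. (\<lambda>s. S k s \<omega>) \<in> borel_measurable borel"
      and J: "\<And>k \<omega>. J k 0 \<omega> = 0"
      "\<And>k j \<omega>. j < N k \<Longrightarrow> J k (t k (Suc j)) \<omega> - J k (t k j) \<omega> = \<eta> k j \<omega> * (W (t k (Suc j)) \<omega> - W (t k j) \<omega>)"
      and lim: "AE \<omega> in M. (\<lambda>k. LINT s:{0..T}|lborel. (S k s \<omega> - H s \<omega>)\<^sup>2) \<longlonglongrightarrow> 0"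
      "AE \<omega> in M. uniform_limit {0..T} (\<lambda>k s. J k s \<omega>) (\<lambda>s. I s \<omega>) sequentially"
      "AE \<omega> in M. (\<lambda>k. \<Sum>j<N k. (\<eta> k j \<omega>)\<^sup>2 * ((W (t k (Suc j)) \<omega> - W (t k j) \<omega>)\<^sup>2 - (t k (Suc j) - t k j))) \<longlonglongrightarrow> 0"
    have range: "0 \<le> t k j \<and> t k j \<le> T" if "j \<le> N k" for k j
      using grid_mono[of "N k" "t k" 0 j] grid_mono[of "N k" "t k" j "N k"] t(1,2)[of k] t(3)[of _ k] that by auto
    have le: "t k i \<le> t k j" if "i \<le> j" "j \<le> N k" for k i j
      using grid_mono[of "N k" "t k" i j] t(3)[of _ k] that by auto
    define dW where "dW k j \<omega> = W (t k (Suc j)) \<omega> - W (t k j) \<omega>" for k j \<omega>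
    define d where "d k j = t k (Suc j) - t k j" for k j
    define x where "x k j \<omega> = (E (t k j) \<omega> + c * J k (t k j) \<omega>) * \<eta> k j \<omega>" for k j \<omega>
    \<comment> \<open>\<open>J\<close> is known only through its value 0 at time 0 and its
      increments along the grid, so adaptedness at the grid points is obtained recursively.\<close>
    have Jm: "J k (t k j) \<in> borel_measurable (F (t k j))" if "j \<le> N k" for k j
      using that
    proof (induction j)
      case 0
      have "J k (t k 0) = (\<lambda>_. 0)" using J(1)[of k] t(1)[of k] by auto
      then show ?case by simp
    next
      case (Suc j)
      have eq: "J k (t k (Suc j)) = (\<lambda>\<omega>. J k (t k j) \<omega> + \<eta> k j \<omega> * (W (t k (Suc j)) \<omega> - W (t k j) \<omega>))"
      proof
        fix \<omega> show "J k (t k (Suc j)) \<omega> = J k (t k j) \<omega> + \<eta> k j \<omega> * (W (t k (Suc j)) \<omega> - W (t k j) \<omega>)"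
          using J(2)[of j k \<omega>] Suc.prems by simp
      qed
      have "t k j \<le> t k (Suc j)" using le[of j "Suc j" k] Suc.prems by simp
      then show ?case unfolding eq
        using Suc \<eta>[of j k] range[of j k] range[of "Suc j" k]
        by (intro borel_measurable_add borel_measurable_times borel_measurable_diff W_measurable_F)
          (auto intro: F_mono)
    qed
    have xm: "x k j \<in> borel_measurable (F (t k j))" if "j < N k" for k j
      unfolding x_def using that Em[of "t k j"] range[of j k] Jm[of j k] \<eta>[of j k]
      by (intro borel_measurable_add borel_measurable_times borel_measurable_const) auto
    define h :: "nat \<Rightarrow> nat \<Rightarrow> real \<times> real \<Rightarrow> ennreal" where
      "h k j = (\<lambda>(y, z). ennreal (exp (y * z - y\<^sup>2 * d k j / 2)))" for k j
    have hm: "h k j \<in> borel_measurable (borel \<Otimes>\<^sub>M borel)" for k j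
      unfolding h_def by measurable
    define V where "V k \<omega> = (\<Prod>j<N k. h k j (x k j \<omega>, W (t k (Suc j)) \<omega> - W (t k j) \<omega>))" for k \<omega>
    have V_le: "(\<integral>\<^sup>+\<omega>. V k \<omega> \<partial>M) \<le> 1" for k
      unfolding V_def
    proof (rule nn_integral_prod_le_1)
      fix j y assume j: "j < N k"
      show "(\<integral>\<^sup>+z. h k j (y, z) \<partial>density lborel (normal_density 0 (sqrt (t k (Suc j) - t k j)))) \<le> 1"
        using nn_integral_normal_exp[of "d k j" y] t(3)[OF j] by (simp add: h_def d_def)
    qed (use t xm hm in auto)
    have V_meas: "V k \<in> borel_measurable M" for k
      unfolding V_def
    proof (rule borel_measurable_prod_ennreal)
      fix j assume j: "j \<in> {..<N k}"
      have "(\<lambda>\<omega>. W (t k (Suc j)) \<omega> - W (t k j) \<omega>) \<in> borel_measurable M"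
        using j range[of j k] range[of "Suc j" k] by (intro increment_measurable) auto
      moreover have "x k j \<in> borel_measurable M" using j xm F_subset_M by blast
      ultimately have "(\<lambda>\<omega>. (x k j \<omega>, W (t k (Suc j)) \<omega> - W (t k j) \<omega>)) \<in> M \<rightarrow>\<^sub>M borel \<Otimes>\<^sub>M borel" by measurable
      then show "(\<lambda>\<omega>. h k j (x k j \<omega>, W (t k (Suc j)) \<omega> - W (t k j) \<omega>)) \<in> borel_measurable M"
        by (rule measurable_compose[OF _ hm])
    qed
    have V_eq: "V k \<omega> = ennreal (exp ((\<Sum>j<N k. x k j \<omega> * dW k j \<omega>) - (\<Sum>j<N k. (x k j \<omega>)\<^sup>2 * d k j) / 2))" for k \<omega>
    proof -
      have "V k \<omega> = ennreal (exp (\<Sum>j<N k. x k j \<omega> * dW k j \<omega> - (x k j \<omega>)\<^sup>2 * d k j / 2))"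
        unfolding V_def h_def by (simp add: prod_ennreal exp_sum dW_def)
      then show ?thesis by (simp add: sum_subtractf sum_divide_distrib)
    qed
    define L where "L \<omega> = E T \<omega> * I T \<omega> - (LINT s:{0..T}|lborel. I s \<omega> * e s \<omega>)
          + c * ((I T \<omega>)\<^sup>2 - (LINT s:{0..T}|lborel. (H s \<omega>)\<^sup>2)) / 2
          - (LINT s:{0..T}|lborel. (E s \<omega> + c * I s \<omega>)\<^sup>2 * (H s \<omega>)\<^sup>2) / 2" for \<omega>
    have half: "(\<lambda>m. (1 / 2 :: real) ^ m) \<longlonglongrightarrow> 0" by (rule LIMSEQ_power_zero) simp
    have "AE \<omega> in M. (\<lambda>k. V k \<omega>) \<longlonglongrightarrow> ennreal (exp (L \<omega>))"
      using lim H Ic Ec e Ee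
    proof eventually_elim
      case (elim \<omega>)
      have "(\<lambda>k. (\<Sum>j<N k. (E (t k j) \<omega> + c * J k (t k j) \<omega>) * \<eta> k j \<omega> * dW k j \<omega>)
          - (\<Sum>j<N k. ((E (t k j) \<omega> + c * J k (t k j) \<omega>) * \<eta> k j \<omega>)\<^sup>2 * (t k (Suc j) - t k j)) / 2) \<longlonglongrightarrow> L \<omega>"
        unfolding L_def
      proof (rule exponent_tendsto[where t=t and N=N and \<delta>="\<lambda>k. (1 / 2) ^ k" and S="\<lambda>k s. S k s \<omega>" and \<eta>="\<lambda>k j. \<eta> k j \<omega>"])
        show "continuous_on {0..T} (\<lambda>s. I s \<omega>)" using elim(5) by (rule continuous_on_subset) auto
        show "(\<lambda>k. \<Sum>j<N k. (\<eta> k j \<omega>)\<^sup>2 * ((dW k j \<omega>)\<^sup>2 - (t k (Suc j) - t k j))) \<longlonglongrightarrow> 0"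
          using elim(3) by (simp add: dW_def)
        show "S k s \<omega> = \<eta> k j \<omega>" if "j < N k" "t k j < s" "s \<le> t k (Suc j)" for k j s using S(1) that by blast
        show "J k (t k (Suc j)) \<omega> - J k (t k j) \<omega> = \<eta> k j \<omega> * dW k j \<omega>" if "j < N k" for k j
          using J(2)[OF that] by (simp add: dW_def)
      qed (use t S(2) J(1) half elim in auto)
      then show ?case unfolding V_eq x_def d_def by (intro tendsto_ennrealI tendsto_exp)
    qed
    then have AE_eq: "AE \<omega> in M. liminf (\<lambda>k. V k \<omega>) = ennreal (exp (L \<omega>))"
      by eventually_elim (rule lim_imp_Liminf, auto)
    have "(\<integral>\<^sup>+\<omega>. liminf (\<lambda>k. V k \<omega>) \<partial>M) \<le> liminf (\<lambda>k. \<integral>\<^sup>+\<omega>. V k \<omega> \<partial>M)"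
      by (rule nn_integral_liminf) (rule V_meas)
    also have "\<dots> \<le> 1"
      using V_le by (intro Liminf_le) auto
    finally have le_1: "(\<integral>\<^sup>+\<omega>. liminf (\<lambda>k. V k \<omega>) \<partial>M) \<le> 1" .
    have "(\<lambda>\<omega>. liminf (\<lambda>k. V k \<omega>)) \<in> borel_measurable M"
      using V_meas by measurable
    then show ?thesis using le_1 AE_eq unfolding L_def by (rule that)
  qed
qed

text \<open>Markov's inequality at the level n^2 makes the probabilities summable. When
  \<open>V\<close> is an exponential, this level costs only 2 ln n in the exponent.\<close>

lemma borel_cantelli_nn_integral:
  fixes V :: "nat \<Rightarrow> 'a \<Rightarrow> ennreal"
  assumes V [measurable]: "\<And>n. V n \<in> borel_measurable M" and le: "\<And>n. n > 0 \<Longrightarrow> (\<integral>\<^sup>+\<omega>. V n \<omega> \<partial>M) \<le> ennreal C"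
  shows "AE \<omega> in M. \<forall>\<^sub>F n in sequentially. V n \<omega> \<le> ennreal ((real n)\<^sup>2)"
proof -
  define A where "A n = {\<omega>\<in>space M. ennreal ((real n)\<^sup>2) < V n \<omega>}" for n
  have A: "A n \<in> events" for n unfolding A_def by measurable
  have bound: "prob (A n) \<le> \<bar>C\<bar> * (1 / (real n)\<^sup>2)" if n: "n > 0" for n
  proof -
    have "emeasure M (A n) \<le> emeasure M {\<omega>\<in>space M. 1 \<le> ennreal (1 / (real n)\<^sup>2) * V n \<omega>}"
    proof (rule emeasure_mono)
      show "A n \<subseteq> {\<omega>\<in>space M. 1 \<le> ennreal (1 / (real n)\<^sup>2) * V n \<omega>}"
      proof (safe)
        fix \<omega> assume "\<omega> \<in> A n"
        then have *: "ennreal ((real n)\<^sup>2) \<le> V n \<omega>" "\<omega> \<in> space M" by (auto simp: A_def)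
        have "1 = ennreal (1 / (real n)\<^sup>2) * ennreal ((real n)\<^sup>2)"
          using n by (subst ennreal_mult[symmetric]) auto
        also have "\<dots> \<le> ennreal (1 / (real n)\<^sup>2) * V n \<omega>" using * by (intro mult_left_mono) auto
        finally show "1 \<le> ennreal (1 / (real n)\<^sup>2) * V n \<omega>" .
      qed (auto simp: A_def)
    qed measurable
    also have "\<dots> \<le> ennreal (1 / (real n)\<^sup>2) * (\<integral>\<^sup>+\<omega>. V n \<omega> * indicator (space M) \<omega> \<partial>M)"
      by (intro nn_integral_Markov_inequality) auto
    also have "(\<integral>\<^sup>+\<omega>. V n \<omega> * indicator (space M) \<omega> \<partial>M) = (\<integral>\<^sup>+\<omega>. V n \<omega> \<partial>M)"
      by (intro nn_integral_cong) simp
    also have "\<dots> \<le> ennreal \<bar>C\<bar>" using le[OF n] by (rule order_trans) (intro ennreal_leI abs_ge_self)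
    finally have "emeasure M (A n) \<le> ennreal (1 / (real n)\<^sup>2) * ennreal \<bar>C\<bar>" by (simp add: mult_left_mono)
    also have "\<dots> = ennreal (\<bar>C\<bar> * (1 / (real n)\<^sup>2))"
      by (subst ennreal_mult[symmetric]) (auto simp: mult.commute)
    finally show ?thesis by (simp add: emeasure_eq_measure)
  qed
  have "AE \<omega> in M. \<forall>\<^sub>F n in sequentially. \<omega> \<in> space M - A n"
  proof (rule borel_cantelli_AE1[OF A])
    show "summable (\<lambda>n. prob (A n))"
    proof (rule summable_comparison_test'[where N=1])
      show "summable (\<lambda>n. \<bar>C\<bar> * (1 / (real n)\<^sup>2))"
        using inverse_power_summable[of 2, where ?'a=real] by (intro summable_mult) (simp add: inverse_eq_divide)
      show "norm (prob (A n)) \<le> \<bar>C\<bar> * (1 / (real n)\<^sup>2)" if "n \<ge> 1" for n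
        using bound[of n] that by simp
    qed
  qed (simp add: less_top[symmetric])
  then show ?thesis
    by eventually_elim (auto elim!: eventually_mono simp: A_def not_less)
qed

end

section \<open>Long-time averages of the Cox--Ingersoll--Ross process\<close>

lemma set_integral_lborel_nonneg:
  fixes f :: "real \<Rightarrow> real"
  assumes "\<And>s. s \<in> A \<Longrightarrow> 0 \<le> f s"
  shows "0 \<le> (LINT s:A|lborel. f s)"
  unfolding set_lebesgue_integral_def using assms by (intro integral_nonneg_AE) (auto simp: indicator_def)

lemma set_integral_Icc_diff:
  fixes f :: "real \<Rightarrow> real"
  assumes f: "set_integrable lborel {a..c} f" and "a \<le> b" "b \<le> c"
  shows "(LINT s:{a..c}|lborel. f s) - (LINT s:{a..b}|lborel. f s) = (LINT s:{b..c}|lborel. f s)"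
proof -
  have "{a..c} = {a..b} \<union> {b..c}" using assms by auto
  moreover have "set_integrable lborel {a..b} f" "set_integrable lborel {b..c} f"
    by (rule set_integrable_subset[OF f]; use assms in auto)+
  ultimately have "(LINT s:{a..c}|lborel. f s) = (LINT s:{a..b}|lborel. f s) + (LINT s:{b..c}|lborel. f s)"
    using AE_lborel_singleton[of b] by (simp only:) (intro set_integral_Un_AE; auto elim!: eventually_mono)
  then show ?thesis by simp
qed

text \<open>Integration by parts for functions given as primitives of continuous densities, the form
  in which the drift part of the process and the deterministic weights arise.\<close>

lemma set_integral_product_rule:
  fixes x y g h :: "real \<Rightarrow> real"
  assumes T: "0 \<le> T" and g: "continuous_on {0..T} g" and h: "continuous_on {0..T} h"
    and x: "\<And>s. s \<in> {0..T} \<Longrightarrow> x s = x0 + (LINT u:{0..s}|lborel. g u)"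
    and y: "\<And>s. s \<in> {0..T} \<Longrightarrow> y s = y0 + (LINT u:{0..s}|lborel. h u)"
  shows "(LINT s:{0..T}|lborel. x s * h s) + (LINT s:{0..T}|lborel. g s * y s) = x T * y T - x0 * y0"
proof -
  have deriv: "(z has_real_derivative k s) (at s within {0..T})"
    if k: "continuous_on {0..T} k" and z: "\<And>s. s \<in> {0..T} \<Longrightarrow> z s = z0 + (LINT u:{0..s}|lborel. k u)" and s: "s \<in> {0..T}"
    for z k z0 s
  proof -
    have "((\<lambda>s. z0 + integral {0..s} k) has_real_derivative k s) (at s within {0..T})"
      by (rule DERIV_cong[OF DERIV_add[OF DERIV_const integral_has_real_derivative[OF k s]]]) simp
    then show ?thesis
    proof (rule has_field_derivative_transform_within[OF _ zero_less_one s])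
      fix s' assume s': "s' \<in> {0..T}"
      have "set_integrable lborel {0..s'} k"
        using s' by (intro borel_integrable_atLeastAtMost' continuous_on_subset[OF k]) auto
      then show "z0 + integral {0..s'} k = z s'"
        using z[OF s'] by (simp add: set_borel_integral_eq_integral(2))
    qed
  qed
  have cont: "continuous_on {0..T} x" "continuous_on {0..T} y"
    by (rule DERIV_continuous_on[OF deriv[OF g x]] DERIV_continuous_on[OF deriv[OF h y]]; assumption)+
  have ftc: "(LINT s:{0..T}|lborel. x s * h s + g s * y s) = x T * y T - x 0 * y 0"
    unfolding set_lebesgue_integral_def
  proof (rule integral_FTC_atLeastAtMost[OF T])
    show "continuous_on {0..T} (\<lambda>s. x s * h s + g s * y s)" by (intro continuous_intros cont g h)
    fix s assume "0 \<le> s" "s \<le> T"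
    then have s: "s \<in> {0..T}" by simp
    show "((\<lambda>s. x s * y s) has_vector_derivative x s * h s + g s * y s) (at s within {0..T})"
    proof -
      have "((\<lambda>s. x s * y s) has_real_derivative g s * y s + h s * x s) (at s within {0..T})"
        by (rule DERIV_mult[OF deriv[OF g x s] deriv[OF h y s]])
      moreover have "g s * y s + h s * x s = x s * h s + g s * y s" by simp
      ultimately show ?thesis unfolding has_real_derivative_iff_has_vector_derivative by simp
    qed
  qed
  have "(LINT u:{0..0}|lborel. k u) = 0" if "continuous_on {0..T} k" for k :: "real \<Rightarrow> real"
    using set_integral_grid[of 0 "\<lambda>_. 0" k] borel_integrable_atLeastAtMost'[OF continuous_on_subset[OF that], of 0 0] T
    by simp
  then have "x 0 = x0" "y 0 = y0" using x[of 0] y[of 0] T g h by auto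
  moreover have "(LINT s:{0..T}|lborel. x s * h s + g s * y s) =
      (LINT s:{0..T}|lborel. x s * h s) + (LINT s:{0..T}|lborel. g s * y s)"
    by (intro set_integral_add(2) borel_integrable_atLeastAtMost' continuous_intros cont g h)
  ultimately show ?thesis using ftc by simp
qed

text \<open>For n^4 \<le> T \<le> (n + 1)^4, monotonicity encloses f T / T between f (n^4) / (n +
  1)^4 and f ((n + 1)^4) / n^4. Because (n + 1)^4 / n^4 tends to 1, both ends have the limit
  \<open>L\<close>.\<close>

lemma average_tendsto_of_subsequence:
  fixes f :: "real \<Rightarrow> real"
  assumes mono: "\<And>x y. 0 \<le> x \<Longrightarrow> x \<le> y \<Longrightarrow> f x \<le> f y" and nonneg: "\<And>x. 0 \<le> x \<Longrightarrow> 0 \<le> f x"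
    and lim: "(\<lambda>n. f (real n ^ 4) / real n ^ 4) \<longlonglongrightarrow> L"
  shows "((\<lambda>T. f T / T) \<longlongrightarrow> L) at_top"
proof -
  define n where "n T = nat \<lfloor>root 4 T\<rfloor>" for T :: real
  have n_top: "filterlim n sequentially at_top"
  proof -
    have "filterlim (\<lambda>T::real. root 4 T) at_top at_top"
    proof (rule filterlim_at_top_mono[OF filterlim_compose[OF sqrt_at_top sqrt_at_top]])
      show "\<forall>\<^sub>F T in at_top. sqrt (sqrt T) \<le> root 4 T"
        by (intro always_eventually allI) (simp add: sqrt_def flip: real_root_mult_exp)
    qed
    then show ?thesis unfolding n_def
      by (intro filterlim_compose[OF filterlim_nat_sequentially] filterlim_compose[OF filterlim_floor_sequentially])
  qed
  have ratio: "(\<lambda>n. real (Suc n) ^ 4 / real n ^ 4) \<longlonglongrightarrow> 1"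
  proof -
    have "(\<lambda>n. (1 + inverse (real n)) ^ 4) \<longlonglongrightarrow> (1 + 0) ^ 4"
      by (intro tendsto_intros lim_inverse_n)
    moreover have "\<forall>\<^sub>F n in sequentially. (1 + inverse (real n)) ^ 4 = real (Suc n) ^ 4 / real n ^ 4"
      using eventually_gt_at_top[of 0]
    proof eventually_elim
      case (elim n)
      then have "1 + inverse (real n) = real (Suc n) / real n" by (simp add: field_simps)
      then show ?case by (simp only: power_divide)
    qed
    ultimately show ?thesis by (auto elim: Lim_transform_eventually)
  qed
  have lim_Suc: "(\<lambda>n. f (real (Suc n) ^ 4) / real (Suc n) ^ 4) \<longlonglongrightarrow> L"
    using LIMSEQ_Suc[OF lim] .
  have cancel: "x / p * inverse (q / p) = x / q" "q \<noteq> 0 \<Longrightarrow> x / q * (q / p) = x / p" if "p \<noteq> 0" for x p q :: real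
    using that by (simp_all add: field_simps)
  have up: "(\<lambda>n. f (real (Suc n) ^ 4) / real n ^ 4) \<longlonglongrightarrow> L"
  proof -
    have "(\<lambda>n. f (real (Suc n) ^ 4) / real (Suc n) ^ 4 * (real (Suc n) ^ 4 / real n ^ 4)) \<longlonglongrightarrow> L * 1"
      by (intro tendsto_mult lim_Suc ratio)
    moreover have "f (real (Suc n) ^ 4) / real (Suc n) ^ 4 * (real (Suc n) ^ 4 / real n ^ 4) = f (real (Suc n) ^ 4) / real n ^ 4" for n
      by (cases "n = 0") (simp_all del: of_nat_Suc add: cancel(2))
    ultimately show ?thesis by simp
  qed
  have lo: "(\<lambda>n. f (real n ^ 4) / real (Suc n) ^ 4) \<longlonglongrightarrow> L"
  proof -
    have "(\<lambda>n. f (real n ^ 4) / real n ^ 4 * inverse (real (Suc n) ^ 4 / real n ^ 4)) \<longlonglongrightarrow> L * inverse 1"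
      by (intro tendsto_mult tendsto_inverse lim ratio) auto
    moreover have "\<forall>\<^sub>F n in sequentially. f (real n ^ 4) / real n ^ 4 * inverse (real (Suc n) ^ 4 / real n ^ 4) = f (real n ^ 4) / real (Suc n) ^ 4"
      using eventually_gt_at_top[of 0] by eventually_elim (rule cancel(1), simp)
    ultimately show ?thesis by (auto elim: Lim_transform_eventually)
  qed
  show ?thesis
  proof (rule tendsto_sandwich[OF _ _ filterlim_compose[OF lo n_top] filterlim_compose[OF up n_top]])
    have ev: "\<forall>\<^sub>F T in at_top. 0 < T \<and> (0::real) < real (n T) ^ 4 \<and> real (n T) ^ 4 \<le> T \<and> T \<le> real (Suc (n T)) ^ 4"
      using eventually_ge_at_top[of 1]
    proof eventually_elim
      case (elim T)
      have r1: "1 \<le> root 4 T" using elim by simp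
      then have le: "real (n T) \<le> root 4 T" "root 4 T \<le> real (Suc (n T))" "1 \<le> n T"
        unfolding n_def by linarith+
      have "root 4 T ^ 4 = T" using elim by simp
      then show ?case using le power_mono[of "real (n T)" "root 4 T" 4] power_mono[of "root 4 T" "real (Suc (n T))" 4] r1 elim
        by auto
    qed
    show "\<forall>\<^sub>F T in at_top. f (real (n T) ^ 4) / real (Suc (n T)) ^ 4 \<le> f T / T"
      using ev by eventually_elim (intro frac_le mono nonneg; auto)
    show "\<forall>\<^sub>F T in at_top. f T / T \<le> f (real (Suc (n T)) ^ 4) / real (n T) ^ 4"
      using ev by eventually_elim (intro frac_le mono nonneg; auto)
  qed
qed

text \<open>The error may contain \<rho> itself. As soon as \<alpha> is below b / 2, half of b
  \<rho> absorbs it, which bounds \<rho>, and then the whole error tends to 0. This is the shape of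
  the estimate for the average of \<open>r\<close>, whose bracket is a multiple of its
  integral.\<close>

lemma tendsto_of_relative_error:
  fixes \<rho> \<alpha> \<beta> :: "nat \<Rightarrow> real"
  assumes b: "b > 0" and \<rho>: "\<And>n. 0 \<le> \<rho> n" and \<alpha>: "\<alpha> \<longlonglongrightarrow> 0" and \<beta>: "\<beta> \<longlonglongrightarrow> 0"
    and bound: "\<forall>\<^sub>F n in sequentially. \<bar>b * \<rho> n - a\<bar> \<le> \<alpha> n * \<rho> n + \<beta> n"
  shows "\<rho> \<longlonglongrightarrow> a / b"
proof -
  have "\<forall>\<^sub>F n in sequentially. \<alpha> n < b / 2" "\<forall>\<^sub>F n in sequentially. \<beta> n < 1"
    using b by (intro order_tendstoD(2)[OF \<alpha>] order_tendstoD(2)[OF \<beta>]; simp)+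
  then have \<rho>_le: "\<forall>\<^sub>F n in sequentially. \<rho> n \<le> 2 * (a + 1) / b"
    using bound
  proof eventually_elim
    case (elim n)
    have "\<alpha> n * \<rho> n \<le> b / 2 * \<rho> n" using elim(1) \<rho>[of n] by (intro mult_right_mono) auto
    also have "\<dots> = b * \<rho> n / 2" by simp
    finally have "b * \<rho> n \<le> 2 * (a + 1)" using elim by (simp add: abs_le_iff)
    then show ?case using b by (simp add: field_simps)
  qed
  have "(\<lambda>n. b * \<rho> n - a) \<longlonglongrightarrow> 0"
  proof (rule Lim_null_comparison)
    show "\<forall>\<^sub>F n in sequentially. norm (b * \<rho> n - a) \<le> \<bar>\<alpha> n\<bar> * \<bar>2 * (a + 1) / b\<bar> + \<beta> n"
      using bound \<rho>_le
    proof eventually_elim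
      case (elim n)
      have "\<alpha> n * \<rho> n \<le> \<bar>\<alpha> n\<bar> * \<bar>2 * (a + 1) / b\<bar>"
        using order_trans[OF elim(2) abs_ge_self] \<rho>[of n] by (intro mult_mono) auto
      then show ?case using elim(1) by simp
    qed
    have "(\<lambda>n. \<bar>\<alpha> n\<bar> * \<bar>2 * (a + 1) / b\<bar> + \<beta> n) \<longlonglongrightarrow> \<bar>0\<bar> * \<bar>2 * (a + 1) / b\<bar> + 0"
      by (intro tendsto_intros \<alpha> \<beta>)
    then show "(\<lambda>n. \<bar>\<alpha> n\<bar> * \<bar>2 * (a + 1) / b\<bar> + \<beta> n) \<longlonglongrightarrow> 0" by simp
  qed
  then have "(\<lambda>n. (b * \<rho> n - a + a) / b) \<longlonglongrightarrow> (0 + a) / b" using b by (intro tendsto_intros) auto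
  then show ?thesis using b by simp
qed

text \<open>The 27 is 3^3, from cubing y / 3 \<le> exp (y / 3).\<close>

lemma power3_le_exp: "y ^ 3 \<le> 27 * exp y" if "0 \<le> y" for y :: real
proof -
  have "(y / 3) ^ 3 \<le> exp (y / 3) ^ 3"
    using that exp_ge_add_one_self[of "y / 3"] by (intro power_mono) linarith+
  also have "\<dots> = exp y" by (simp flip: exp_of_nat_mult)
  finally show ?thesis by (simp add: power_divide)
qed

lemma set_integral_Icc_linear:
  fixes f g :: "real \<Rightarrow> real"
  assumes "continuous_on {0..T} f" "continuous_on {0..T} g"
  shows "(LINT s:{0..T}|lborel. c * f s + d * g s) = c * (LINT s:{0..T}|lborel. f s) + d * (LINT s:{0..T}|lborel. g s)"
  using assms by (subst set_integral_add) (auto intro!: borel_integrable_atLeastAtMost' set_integrable_mult_right)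

section \<open>The process and its Ito integral part along a typical path\<close>

locale cir = wiener M W for M :: "'a measure" and W +
  fixes r :: "real \<Rightarrow> 'a \<Rightarrow> real" and a b \<sigma> r0 :: real
  assumes pos: "a > 0" "b > 0" "\<sigma> > 0" "r0 > 0"
    and cir: "cir_process M W a b \<sigma> r0 r"
begin

text \<open>Fixed once by choice, so that the integral property and the equation, asserted jointly
  under an existential quantifier, refer to the same process.\<close>

definition I :: "real \<Rightarrow> 'a \<Rightarrow> real" where
  "I = (SOME I. has_ito_integral M F W (\<lambda>t \<omega>. \<sigma> * sqrt (r t \<omega>)) I \<and>
     (AE \<omega> in M. \<forall>t\<ge>0. r t \<omega> = r0 + (LINT s:{0..t}|lborel. a - b * r s \<omega>) + I t \<omega>))"

lemma ito: "has_ito_integral M F W (\<lambda>t \<omega>. \<sigma> * sqrt (r t \<omega>)) I"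
  and sde: "AE \<omega> in M. \<forall>t\<ge>0. r t \<omega> = r0 + (LINT s:{0..t}|lborel. a - b * r s \<omega>) + I t \<omega>"
proof -
  have "\<exists>I. has_ito_integral M F W (\<lambda>t \<omega>. \<sigma> * sqrt (r t \<omega>)) I \<and>
     (AE \<omega> in M. \<forall>t\<ge>0. r t \<omega> = r0 + (LINT s:{0..t}|lborel. a - b * r s \<omega>) + I t \<omega>)"
    using cir unfolding cir_process_def strong_solution_def by (elim conjE)
  from someI_ex[OF this] show "has_ito_integral M F W (\<lambda>t \<omega>. \<sigma> * sqrt (r t \<omega>)) I"
    "AE \<omega> in M. \<forall>t\<ge>0. r t \<omega> = r0 + (LINT s:{0..t}|lborel. a - b * r s \<omega>) + I t \<omega>"
    unfolding I_def by - (elim conjE, assumption)+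
qed

lemma r_measurable_F: "t \<ge> 0 \<Longrightarrow> r t \<in> borel_measurable (F t)"
  using cir unfolding cir_process_def strong_solution_def by (elim conjE) simp

lemma r_measurable: "t \<ge> 0 \<Longrightarrow> r t \<in> borel_measurable M"
  by (rule F_subset_M[OF r_measurable_F])

lemma I_measurable_F: "t \<ge> 0 \<Longrightarrow> I t \<in> borel_measurable (F t)"
  using ito unfolding has_ito_integral_def by (elim conjE) simp

text \<open>The path properties under which the identities for \<open>r\<close> and \<open>I\<close>
  are pure calculus; they hold together almost surely.\<close>

definition good :: "'a \<Rightarrow> bool" where
  "good \<omega> \<longleftrightarrow> (\<forall>t\<ge>0. 0 \<le> r t \<omega>) \<and> continuous_on {0..} (\<lambda>t. r t \<omega>) \<and> continuous_on {0..} (\<lambda>t. I t \<omega>) \<and>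
     (\<forall>t\<ge>0. r t \<omega> = r0 + (LINT s:{0..t}|lborel. a - b * r s \<omega>) + I t \<omega>)"

lemma AE_good: "AE \<omega> in M. good \<omega>"
proof -
  have "AE \<omega> in M. continuous_on {0..} (\<lambda>t. I t \<omega>)"
    using ito unfolding has_ito_integral_def by (elim conjE)
  moreover have "AE \<omega> in M. continuous_on {0..} (\<lambda>t. r t \<omega>)" "AE \<omega> in M. \<forall>t\<ge>0. 0 \<le> r t \<omega>"
    using cir unfolding cir_process_def strong_solution_def by - (elim conjE, assumption)+
  ultimately show ?thesis
    using sde by eventually_elim (simp add: good_def)
qed

context
  fixes \<omega> assumes good: "good \<omega>"
begin

lemma r_nonneg: "0 \<le> t \<Longrightarrow> 0 \<le> r t \<omega>"
  using good unfolding good_def by blast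

lemma r_continuous: "0 \<le> x \<Longrightarrow> continuous_on {x..y} (\<lambda>t. r t \<omega>)"
  using good by (auto simp: good_def intro: continuous_on_subset)

lemma I_continuous: "continuous_on {0..T} (\<lambda>t. I t \<omega>)"
  using good by (auto simp: good_def intro: continuous_on_subset)

lemma drift_eq: "0 \<le> t \<Longrightarrow> r t \<omega> - I t \<omega> = r0 + (LINT s:{0..t}|lborel. a - b * r s \<omega>)"
  using good by (simp add: good_def)

lemma set_integral_drift:
  assumes "0 \<le> T"
  shows "(LINT s:{0..T}|lborel. a - b * r s \<omega>) = a * T - b * int_r r T \<omega>"
proof -
  have "(LINT s:{0..T}|lborel. a * 1 + (- b) * r s \<omega>) =
      a * (LINT s:{0..T}|lborel. 1) + (- b) * (LINT s:{0..T}|lborel. r s \<omega>)"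
    by (intro set_integral_Icc_linear r_continuous continuous_intros) auto
  also have "(LINT s:{0..T}|lborel. 1) = T" using assms by (simp add: set_lebesgue_integral_def)
  finally show ?thesis by (simp add: int_r_def mult.commute)
qed

lemma I_eq: "0 \<le> T \<Longrightarrow> I T \<omega> = r T \<omega> - r0 - a * T + b * int_r r T \<omega>"
  using drift_eq[of T] set_integral_drift[of T] by simp

lemma set_integral_diffusion:
  "(LINT s:{0..T}|lborel. g s * (\<sigma> * sqrt (r s \<omega>))\<^sup>2) = \<sigma>\<^sup>2 * (LINT s:{0..T}|lborel. g s * r s \<omega>)"
proof -
  have "(LINT s:{0..T}|lborel. g s * (\<sigma> * sqrt (r s \<omega>))\<^sup>2) = (LINT s:{0..T}|lborel. \<sigma>\<^sup>2 * (g s * r s \<omega>))"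
    by (intro set_lebesgue_integral_cong) (auto simp: power_mult_distrib r_nonneg)
  then show ?thesis by simp
qed

end

section \<open>Exponential bounds for the process\<close>

text \<open>The weight is the constant \<theta>. The bracket of \<theta> I is \<theta>^2 \<sigma>^2
  \<integral> r dt, and \<open>I T\<close> is read off from the equation, so no stochastic integral
  remains.\<close>

lemma exp_bound_linear:
  assumes T: "T > 0"
  obtains V where "V \<in> borel_measurable M" "(\<integral>\<^sup>+\<omega>. V \<omega> \<partial>M) \<le> 1"
    "AE \<omega> in M. V \<omega> = ennreal (exp (\<theta> * (r T \<omega> - r0 - a * T + b * int_r r T \<omega>) - \<theta>\<^sup>2 * \<sigma>\<^sup>2 / 2 * int_r r T \<omega>))"
proof -
  have 1: "(\<lambda>_. \<theta>) \<in> borel_measurable (F s)" for s by simp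
  have 2: "AE \<omega> in M. continuous_on {0..T} (\<lambda>s. \<theta>)" by simp
  have 3: "AE \<omega> in M. set_integrable lborel {0..T} (\<lambda>s. 0 :: real)" by (simp add: set_integrable_def)
  have 4: "AE \<omega> in M. \<forall>x y. 0 \<le> x \<longrightarrow> x \<le> y \<longrightarrow> y \<le> T \<longrightarrow> \<theta> - \<theta> = (LINT s:{x..y}|lborel. 0)"
    by (simp add: set_lebesgue_integral_def)
  show ?thesis
  proof (rule exp_ito_integral_le_1[OF ito T 1 2 3 4, where c=0])
    fix V assume V: "V \<in> borel_measurable M" "(\<integral>\<^sup>+\<omega>. V \<omega> \<partial>M) \<le> 1"
      and eq: "AE \<omega> in M. V \<omega> = ennreal (exp (\<theta> * I T \<omega> - (LINT s:{0..T}|lborel. I s \<omega> * 0)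
        + 0 * ((I T \<omega>)\<^sup>2 - (LINT s:{0..T}|lborel. (\<sigma> * sqrt (r s \<omega>))\<^sup>2)) / 2
        - (LINT s:{0..T}|lborel. (\<theta> + 0 * I s \<omega>)\<^sup>2 * (\<sigma> * sqrt (r s \<omega>))\<^sup>2) / 2))"
    show thesis
    proof (rule that[OF V])
      show "AE \<omega> in M. V \<omega> = ennreal (exp (\<theta> * (r T \<omega> - r0 - a * T + b * int_r r T \<omega>) - \<theta>\<^sup>2 * \<sigma>\<^sup>2 / 2 * int_r r T \<omega>))"
        using eq AE_good
      proof eventually_elim
        case (elim \<omega>)
        have qv: "(LINT s:{0..T}|lborel. (\<theta> + 0 * I s \<omega>)\<^sup>2 * (\<sigma> * sqrt (r s \<omega>))\<^sup>2) = \<sigma>\<^sup>2 * (\<theta>\<^sup>2 * int_r r T \<omega>)"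
          unfolding set_integral_diffusion[OF elim(2)] by (simp add: int_r_def)
        have "(LINT s:{0..T}|lborel. I s \<omega> * 0) = 0" by (simp add: set_lebesgue_integral_def)
        then show ?case unfolding elim(1) qv using T I_eq[OF elim(2), of T] by (simp add: mult_ac)
      qed
    qed
  qed
qed

text \<open>The weight is \<theta> r, written as \<theta> (r - I) + \<theta> I with a first part of
  bounded variation. Expressing \<integral> r dI by path functionals reproduces Ito's formula for
  r^2; the \<open>\<sigma>\<^sup>2 / 2\<close> beside \<open>a\<close> is its correction
  term.\<close>

lemma exp_bound_quadratic:
  assumes T: "T > 0"
  obtains V where "V \<in> borel_measurable M" "(\<integral>\<^sup>+\<omega>. V \<omega> \<partial>M) \<le> 1"
    "AE \<omega> in M. V \<omega> = ennreal (exp (\<theta> * (((r T \<omega>)\<^sup>2 - r0\<^sup>2) / 2 - (a + \<sigma>\<^sup>2 / 2) * int_r r T \<omega> + b * int_r2 r T \<omega>)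
       - \<theta>\<^sup>2 * \<sigma>\<^sup>2 / 2 * (LINT s:{0..T}|lborel. (r s \<omega>) ^ 3)))"
proof -
  have 1: "(\<lambda>\<omega>. \<theta> * (r s \<omega> - I s \<omega>)) \<in> borel_measurable (F s)" if "0 \<le> s" "s \<le> T" for s
    using r_measurable_F[OF that(1)] I_measurable_F[OF that(1)] by measurable
  have 2: "AE \<omega> in M. continuous_on {0..T} (\<lambda>s. \<theta> * (r s \<omega> - I s \<omega>))"
    using AE_good by eventually_elim (intro continuous_intros r_continuous I_continuous, auto)
  have 3: "AE \<omega> in M. set_integrable lborel {0..T} (\<lambda>s. \<theta> * (a - b * r s \<omega>))"
    using AE_good by eventually_elim (intro borel_integrable_atLeastAtMost' continuous_intros r_continuous, auto)
  have 4: "AE \<omega> in M. \<forall>x y. 0 \<le> x \<longrightarrow> x \<le> y \<longrightarrow> y \<le> T \<longrightarrow>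
      \<theta> * (r y \<omega> - I y \<omega>) - \<theta> * (r x \<omega> - I x \<omega>) = (LINT s:{x..y}|lborel. \<theta> * (a - b * r s \<omega>))"
    using AE_good
  proof (eventually_elim, intro allI impI)
    fix \<omega> x y assume \<omega>: "good \<omega>" and xy: "0 \<le> x" "x \<le> y" "y \<le> T"
    have "set_integrable lborel {0..y} (\<lambda>s. a - b * r s \<omega>)"
      using \<omega> by (intro borel_integrable_atLeastAtMost' continuous_intros r_continuous) auto
    from set_integral_Icc_diff[OF this xy(1,2)] drift_eq[OF \<omega>, of x] drift_eq[OF \<omega>, of y] xy
    have "(r y \<omega> - I y \<omega>) - (r x \<omega> - I x \<omega>) = (LINT s:{x..y}|lborel. a - b * r s \<omega>)" by simp
    then show "\<theta> * (r y \<omega> - I y \<omega>) - \<theta> * (r x \<omega> - I x \<omega>) = (LINT s:{x..y}|lborel. \<theta> * (a - b * r s \<omega>))"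
      by (simp flip: right_diff_distrib)
  qed
  show ?thesis
  proof (rule exp_ito_integral_le_1[OF ito T 1 2 3 4, where c=\<theta>])
    fix V assume V: "V \<in> borel_measurable M" "(\<integral>\<^sup>+\<omega>. V \<omega> \<partial>M) \<le> 1"
      and eq: "AE \<omega> in M. V \<omega> = ennreal (exp (\<theta> * (r T \<omega> - I T \<omega>) * I T \<omega> - (LINT s:{0..T}|lborel. I s \<omega> * (\<theta> * (a - b * r s \<omega>)))
        + \<theta> * ((I T \<omega>)\<^sup>2 - (LINT s:{0..T}|lborel. (\<sigma> * sqrt (r s \<omega>))\<^sup>2)) / 2
        - (LINT s:{0..T}|lborel. (\<theta> * (r s \<omega> - I s \<omega>) + \<theta> * I s \<omega>)\<^sup>2 * (\<sigma> * sqrt (r s \<omega>))\<^sup>2) / 2))"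
    show thesis
    proof (rule that[OF V])
      show "AE \<omega> in M. V \<omega> = ennreal (exp (\<theta> * (((r T \<omega>)\<^sup>2 - r0\<^sup>2) / 2 - (a + \<sigma>\<^sup>2 / 2) * int_r r T \<omega> + b * int_r2 r T \<omega>)
         - \<theta>\<^sup>2 * \<sigma>\<^sup>2 / 2 * (LINT s:{0..T}|lborel. (r s \<omega>) ^ 3)))"
        using eq AE_good
      proof eventually_elim
        case (elim \<omega>)
        note \<omega> = elim(2)
        define D where "D s = r s \<omega> - I s \<omega>" for s
        define R where "R = int_r r T \<omega>"
        define Q where "Q = int_r2 r T \<omega>"
        have rc: "continuous_on {0..T} (\<lambda>s. r s \<omega>)" by (rule r_continuous[OF \<omega>]) simp
        have hc: "continuous_on {0..T} (\<lambda>s. a - b * r s \<omega>)" by (intro continuous_intros rc)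
        have Dc: "continuous_on {0..T} D" unfolding D_def by (intro continuous_intros rc I_continuous[OF \<omega>])
        have D: "D s = r0 + (LINT u:{0..s}|lborel. a - b * r u \<omega>)" if "s \<in> {0..T}" for s
          using drift_eq[OF \<omega>] that by (simp add: D_def)
        \<comment> \<open>\<open>D\<close> is the drift part of \<open>r\<close> and
          \<open>a - b * r s \<omega>\<close> is its derivative, so the ordinary product rule
          applies to D^2.\<close>
        have DD: "(LINT s:{0..T}|lborel. D s * (a - b * r s \<omega>)) = ((D T)\<^sup>2 - r0\<^sup>2) / 2"
          using set_integral_product_rule[OF _ hc hc D D] T by (simp add: power2_eq_square mult.commute)
        have rh: "(LINT s:{0..T}|lborel. a * r s \<omega> + (- b) * (r s \<omega>)\<^sup>2) = a * R + (- b) * Q"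
          unfolding R_def Q_def int_r_def int_r2_def by (intro set_integral_Icc_linear continuous_intros rc)
        have "(LINT s:{0..T}|lborel. I s \<omega> * (\<theta> * (a - b * r s \<omega>))) =
            (LINT s:{0..T}|lborel. \<theta> * (a * r s \<omega> + (- b) * (r s \<omega>)\<^sup>2) + (- \<theta>) * (D s * (a - b * r s \<omega>)))"
          by (intro set_lebesgue_integral_cong) (auto simp: D_def power2_eq_square algebra_simps)
        also have "\<dots> = \<theta> * (a * R + (- b) * Q) + (- \<theta>) * (((D T)\<^sup>2 - r0\<^sup>2) / 2)"
          unfolding rh[symmetric] DD[symmetric] by (intro set_integral_Icc_linear continuous_intros rc hc Dc)
        finally have e1: "(LINT s:{0..T}|lborel. I s \<omega> * (\<theta> * (a - b * r s \<omega>))) =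
          \<theta> * (a * R - b * Q) - \<theta> * (((D T)\<^sup>2 - r0\<^sup>2) / 2)" by simp
        have e2: "(LINT s:{0..T}|lborel. (\<sigma> * sqrt (r s \<omega>))\<^sup>2) = \<sigma>\<^sup>2 * R"
          using set_integral_diffusion[OF \<omega>, of T "\<lambda>_. 1"] by (simp add: R_def int_r_def)
        have "(LINT s:{0..T}|lborel. (\<theta> * (r s \<omega> - I s \<omega>) + \<theta> * I s \<omega>)\<^sup>2 * (\<sigma> * sqrt (r s \<omega>))\<^sup>2) =
          \<sigma>\<^sup>2 * (LINT s:{0..T}|lborel. \<theta>\<^sup>2 * (r s \<omega>) ^ 3)"
          unfolding set_integral_diffusion[OF \<omega>]
          by (intro arg_cong2[where f="(*)"] set_lebesgue_integral_cong) (auto simp: algebra_simps power2_eq_square power3_eq_cube)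
        then have e3: "(LINT s:{0..T}|lborel. (\<theta> * (r s \<omega> - I s \<omega>) + \<theta> * I s \<omega>)\<^sup>2 * (\<sigma> * sqrt (r s \<omega>))\<^sup>2) =
          \<theta>\<^sup>2 * \<sigma>\<^sup>2 * (LINT s:{0..T}|lborel. (r s \<omega>) ^ 3)" by simp
        \<comment> \<open>The squares combine through D I + D^2 / 2 + I^2 / 2 = r^2 / 2 at time
          \<open>T\<close>.\<close>
        have "\<theta> * (r T \<omega> - I T \<omega>) * I T \<omega> - (\<theta> * (a * R - b * Q) - \<theta> * (((D T)\<^sup>2 - r0\<^sup>2) / 2))
          + \<theta> * ((I T \<omega>)\<^sup>2 - \<sigma>\<^sup>2 * R) / 2
          = \<theta> * (((r T \<omega>)\<^sup>2 - r0\<^sup>2) / 2 - (a + \<sigma>\<^sup>2 / 2) * R + b * Q)"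
          unfolding D_def by (simp add: power2_eq_square field_simps)
        then show ?case unfolding elim(1) e1 e2 e3 R_def Q_def by simp
      qed
    qed
  qed
qed

lemma set_integral_exp_growth:
  fixes \<beta> T :: real
  assumes "x \<le> y"
  shows "(LINT s:{x..y}|lborel. \<beta> * exp (\<beta> * (s - T))) = exp (\<beta> * (y - T)) - exp (\<beta> * (x - T))"
  unfolding set_lebesgue_integral_def
  by (rule integral_FTC_atLeastAtMost[OF assms])
    (auto simp flip: has_real_derivative_iff_has_vector_derivative intro!: derivative_eq_intros continuous_intros)

text \<open>The weight E_s = \<kappa> exp (\<beta> (s - T)) with \<kappa> = b / \<sigma>^2 and
  \<beta> = b / 2 lets mean reversion pay for the bracket. By parts, \<integral> E dI is E_T r_T -
  E_0 r_0 - a \<integral> E ds + (b - \<beta>) \<integral> E r ds, while half its bracket is at most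
  (b / 2) \<integral> E r ds because E \<le> \<kappa>. The two integrals of E r balance, and
  \<integral> E ds \<le> \<kappa> / \<beta> gives a bound that does not depend on
  \<open>T\<close>.\<close>

lemma exp_moment:
  assumes T: "T > 0"
  shows "(\<integral>\<^sup>+\<omega>. ennreal (exp (b / \<sigma>\<^sup>2 * r T \<omega>)) \<partial>M) \<le> ennreal (exp (b / \<sigma>\<^sup>2 * (r0 + 2 * a / b)))"
proof -
  define \<kappa> where "\<kappa> = b / \<sigma>\<^sup>2"
  define \<beta> where "\<beta> = b / 2"
  define E where "E s = \<kappa> * exp (\<beta> * (s - T))" for s
  have \<kappa>: "\<kappa> > 0" "\<sigma>\<^sup>2 * \<kappa> = b" using pos by (simp_all add: \<kappa>_def)
  have \<beta>: "\<beta> > 0" using pos by (simp add: \<beta>_def)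
  have Ec: "continuous_on A E" for A unfolding E_def by (intro continuous_intros)
  have E_range: "0 < E s" "s \<le> T \<Longrightarrow> E s \<le> \<kappa>" for s using \<kappa> \<beta> by (auto simp: E_def mult_le_0_iff)
  have E_diff: "E y - E x = (LINT s:{x..y}|lborel. \<beta> * E s)" if "x \<le> y" for x y
  proof -
    have "(LINT s:{x..y}|lborel. \<beta> * E s) = (LINT s:{x..y}|lborel. \<kappa> * (\<beta> * exp (\<beta> * (s - T))))"
      by (intro set_lebesgue_integral_cong) (auto simp: E_def)
    also have "\<dots> = \<kappa> * (LINT s:{x..y}|lborel. \<beta> * exp (\<beta> * (s - T)))"
      by (rule set_integral_mult_right)
    also have "\<dots> = E y - E x" unfolding set_integral_exp_growth[OF that] E_def by (rule right_diff_distrib)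
    finally show ?thesis by simp
  qed
  have 1: "(\<lambda>_. E s) \<in> borel_measurable (F s)" for s by simp
  have 2: "AE \<omega> in M. continuous_on {0..T} E" using Ec by simp
  have 3: "AE \<omega> in M. set_integrable lborel {0..T} (\<lambda>s. \<beta> * E s)"
    by (intro AE_I2 borel_integrable_atLeastAtMost' continuous_intros Ec)
  have 4: "AE \<omega> in M. \<forall>x y. 0 \<le> x \<longrightarrow> x \<le> y \<longrightarrow> y \<le> T \<longrightarrow> E y - E x = (LINT s:{x..y}|lborel. \<beta> * E s)"
    using E_diff by simp
  show ?thesis
  proof (rule exp_ito_integral_le_1[OF ito T 1 2 3 4, where c=0])
    fix V assume V: "V \<in> borel_measurable M" "(\<integral>\<^sup>+\<omega>. V \<omega> \<partial>M) \<le> 1"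
      and eq: "AE \<omega> in M. V \<omega> = ennreal (exp (E T * I T \<omega> - (LINT s:{0..T}|lborel. I s \<omega> * (\<beta> * E s))
        + 0 * ((I T \<omega>)\<^sup>2 - (LINT s:{0..T}|lborel. (\<sigma> * sqrt (r s \<omega>))\<^sup>2)) / 2
        - (LINT s:{0..T}|lborel. (E s + 0 * I s \<omega>)\<^sup>2 * (\<sigma> * sqrt (r s \<omega>))\<^sup>2) / 2))"
    have "AE \<omega> in M. ennreal (exp (\<kappa> * r T \<omega>)) \<le> ennreal (exp (\<kappa> * (r0 + 2 * a / b))) * V \<omega>"
      using eq AE_good
    proof eventually_elim
      case (elim \<omega>)
      note \<omega> = elim(2)
      define D where "D s = r s \<omega> - I s \<omega>" for s
      have rc: "continuous_on {0..T} (\<lambda>s. r s \<omega>)" by (rule r_continuous[OF \<omega>]) simp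
      have hc: "continuous_on {0..T} (\<lambda>s. a - b * r s \<omega>)" by (intro continuous_intros rc)
      have Dc: "continuous_on {0..T} D" unfolding D_def by (intro continuous_intros rc I_continuous[OF \<omega>])
      have D: "D s = r0 + (LINT u:{0..s}|lborel. a - b * r u \<omega>)" if "s \<in> {0..T}" for s
        using drift_eq[OF \<omega>] that by (simp add: D_def)
      have E0: "E s = E 0 + (LINT u:{0..s}|lborel. \<beta> * E u)" if "s \<in> {0..T}" for s
        using E_diff[of 0 s] that by simp
      define A where "A = (LINT s:{0..T}|lborel. E s)"
      define B where "B = (LINT s:{0..T}|lborel. E s * r s \<omega>)"
      define G where "G = (LINT s:{0..T}|lborel. (E s)\<^sup>2 * r s \<omega>)"
      have ED: "(LINT s:{0..T}|lborel. E s * (a - b * r s \<omega>)) + (LINT s:{0..T}|lborel. \<beta> * E s * D s) = E T * D T - E 0 * r0"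
        using T by (intro set_integral_product_rule E0 D hc continuous_intros Ec) auto
      have Eh: "(LINT s:{0..T}|lborel. E s * (a - b * r s \<omega>)) = a * A - b * B"
      proof -
        have "(LINT s:{0..T}|lborel. E s * (a - b * r s \<omega>)) = (LINT s:{0..T}|lborel. a * E s + (- b) * (E s * r s \<omega>))"
          by (intro set_lebesgue_integral_cong) (auto simp: algebra_simps)
        also have "\<dots> = a * A + (- b) * B" unfolding A_def B_def by (intro set_integral_Icc_linear continuous_intros Ec rc)
        finally show ?thesis by simp
      qed
      have IE: "(LINT s:{0..T}|lborel. I s \<omega> * (\<beta> * E s)) = \<beta> * B - (LINT s:{0..T}|lborel. \<beta> * E s * D s)"
      proof -
        have "(LINT s:{0..T}|lborel. I s \<omega> * (\<beta> * E s)) = (LINT s:{0..T}|lborel. \<beta> * (E s * r s \<omega>) + (- 1) * (\<beta> * E s * D s))"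
          by (intro set_lebesgue_integral_cong) (auto simp: D_def algebra_simps)
        also have "\<dots> = \<beta> * B + (- 1) * (LINT s:{0..T}|lborel. \<beta> * E s * D s)"
          unfolding B_def by (intro set_integral_Icc_linear continuous_intros Ec rc Dc)
        finally show ?thesis by simp
      qed
      have qv: "(LINT s:{0..T}|lborel. (E s + 0 * I s \<omega>)\<^sup>2 * (\<sigma> * sqrt (r s \<omega>))\<^sup>2) = \<sigma>\<^sup>2 * G"
        unfolding set_integral_diffusion[OF \<omega>] by (simp add: G_def)
      have A_le: "\<beta> * A \<le> \<kappa>"
        using E_diff[of 0 T] E_range(1)[of 0] E_range(2)[of T] T by (simp add: A_def)
      have G_le: "\<sigma>\<^sup>2 * G \<le> b * B"
      proof -
        have "G \<le> (LINT s:{0..T}|lborel. \<kappa> * (E s * r s \<omega>))"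
          unfolding G_def
        proof (rule set_integral_mono)
          fix s assume s: "s \<in> {0..T}"
          have "E s * E s * r s \<omega> \<le> \<kappa> * E s * r s \<omega>"
            using E_range[of s] s r_nonneg[OF \<omega>, of s] by (intro mult_right_mono) auto
          then show "(E s)\<^sup>2 * r s \<omega> \<le> \<kappa> * (E s * r s \<omega>)" by (simp add: power2_eq_square mult.assoc)
        qed (intro borel_integrable_atLeastAtMost' continuous_intros Ec rc)+
        then have "\<sigma>\<^sup>2 * G \<le> \<sigma>\<^sup>2 * (\<kappa> * B)" by (intro mult_left_mono) (auto simp: B_def)
        then show ?thesis using \<kappa>(2) by (simp add: mult.assoc[symmetric])
      qed
      have "a * A \<le> a * (2 * \<kappa> / b)"
        using A_le pos by (intro mult_left_mono) (auto simp: \<beta>_def field_simps)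
      moreover have "E 0 * r0 \<le> \<kappa> * r0" using E_range(2)[of 0] T pos by (intro mult_right_mono) auto
      moreover have "E T = \<kappa>" by (simp add: E_def)
      moreover have "\<kappa> * I T \<omega> = \<kappa> * r T \<omega> - \<kappa> * D T" by (simp add: D_def right_diff_distrib)
      ultimately have "\<kappa> * r T \<omega> \<le> \<kappa> * (r0 + 2 * a / b) +
         (E T * I T \<omega> - (LINT s:{0..T}|lborel. I s \<omega> * (\<beta> * E s)) - \<sigma>\<^sup>2 * G / 2)"
        using ED G_le unfolding Eh IE by (simp add: \<beta>_def algebra_simps)
      then have "exp (\<kappa> * r T \<omega>) \<le> exp (\<kappa> * (r0 + 2 * a / b)) *
         exp (E T * I T \<omega> - (LINT s:{0..T}|lborel. I s \<omega> * (\<beta> * E s)) - \<sigma>\<^sup>2 * G / 2)"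
        by (simp flip: exp_add)
      then show ?case unfolding elim(1) qv by (subst ennreal_mult[symmetric]) (auto intro: ennreal_leI)
    qed
    then have "(\<integral>\<^sup>+\<omega>. ennreal (exp (\<kappa> * r T \<omega>)) \<partial>M) \<le> (\<integral>\<^sup>+\<omega>. ennreal (exp (\<kappa> * (r0 + 2 * a / b))) * V \<omega> \<partial>M)"
      by (rule nn_integral_mono_AE)
    also have "\<dots> = ennreal (exp (\<kappa> * (r0 + 2 * a / b))) * (\<integral>\<^sup>+\<omega>. V \<omega> \<partial>M)"
      by (rule nn_integral_cmult[OF V(1)])
    also have "\<dots> \<le> ennreal (exp (\<kappa> * (r0 + 2 * a / b))) * 1" by (intro mult_left_mono V(2)) simp
    finally show ?thesis by (simp add: \<kappa>_def)
  qed
qed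

end

section \<open>Almost sure bounds along the times n^4\<close>

context cir
begin

text \<open>The moment bound is available at fixed times, and \<open>r\<close> is not given as
  jointly measurable in time and \<omega>. Riemann sums together with Fatou's lemma therefore play
  the role of Tonelli's theorem.\<close>

lemma cubic_moment:
  assumes T: "T > 0"
  obtains V where "V \<in> borel_measurable M"
    "(\<integral>\<^sup>+\<omega>. V \<omega> \<partial>M) \<le> ennreal (27 / (b / \<sigma>\<^sup>2) ^ 3 * exp (b / \<sigma>\<^sup>2 * (r0 + 2 * a / b)))"
    "AE \<omega> in M. V \<omega> = ennreal ((LINT s:{0..T}|lborel. (r s \<omega>) ^ 3) / T)"
proof -
  define \<kappa> where "\<kappa> = b / \<sigma>\<^sup>2"
  define C where "C = 27 / \<kappa> ^ 3 * exp (\<kappa> * (r0 + 2 * a / b))"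
  have \<kappa>: "\<kappa> > 0" using pos by (simp add: \<kappa>_def)
  define t where "t k j = T * real j / real (Suc k)" for k j
  have t_pos: "t k (Suc j) > 0" for k j using T by (simp add: t_def)
  have t_diff: "t k (Suc j) - t k j = T / real (Suc k)" for k j
    by (simp add: t_def add_divide_distrib distrib_left)
  have t_less: "t k j < t k (Suc j)" for k j
  proof -
    have "0 < T / real (Suc k)" using T by simp
    then show ?thesis using t_diff[of k j] by linarith
  qed
  \<comment> \<open>Right end points are used because the exponential moment bound is stated for
    positive times.\<close>
  define V where "V k \<omega> = (\<Sum>j<Suc k. ennreal (1 / real (Suc k)) * ennreal ((r (t k (Suc j)) \<omega>) ^ 3))" for k \<omega>
  have rm [measurable]: "r (t k (Suc j)) \<in> borel_measurable M" for k j
    using t_pos[of k j] by (intro r_measurable) simp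
  have V_meas [measurable]: "V k \<in> borel_measurable M" for k
    unfolding V_def by measurable
  have r3: "(\<integral>\<^sup>+\<omega>. ennreal ((r s \<omega>) ^ 3) \<partial>M) \<le> ennreal C" if s: "s > 0" for s
  proof -
    have [measurable]: "r s \<in> borel_measurable M" using s by (intro r_measurable) simp
    have "(\<integral>\<^sup>+\<omega>. ennreal ((r s \<omega>) ^ 3) \<partial>M) \<le> (\<integral>\<^sup>+\<omega>. ennreal (27 / \<kappa> ^ 3) * ennreal (exp (\<kappa> * r s \<omega>)) \<partial>M)"
    proof (rule nn_integral_mono_AE)
      show "AE \<omega> in M. ennreal ((r s \<omega>) ^ 3) \<le> ennreal (27 / \<kappa> ^ 3) * ennreal (exp (\<kappa> * r s \<omega>))"
        using AE_good
      proof eventually_elim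
        case (elim \<omega>)
        have "(\<kappa> * r s \<omega>) ^ 3 \<le> 27 * exp (\<kappa> * r s \<omega>)"
          using r_nonneg[OF elim, of s] s \<kappa> by (intro power3_le_exp) auto
        then have "(r s \<omega>) ^ 3 \<le> 27 / \<kappa> ^ 3 * exp (\<kappa> * r s \<omega>)"
          using \<kappa> by (simp add: power_mult_distrib field_simps)
        then show ?case using \<kappa> by (subst ennreal_mult[symmetric]) (auto intro: ennreal_leI)
      qed
    qed
    also have "\<dots> = ennreal (27 / \<kappa> ^ 3) * (\<integral>\<^sup>+\<omega>. ennreal (exp (\<kappa> * r s \<omega>)) \<partial>M)"
      by (rule nn_integral_cmult) measurable
    also have "\<dots> \<le> ennreal (27 / \<kappa> ^ 3) * ennreal (exp (\<kappa> * (r0 + 2 * a / b)))"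
      unfolding \<kappa>_def by (intro mult_left_mono exp_moment s) auto
    also have "\<dots> = ennreal C"
      unfolding C_def using \<kappa> by (subst ennreal_mult[symmetric]) auto
    finally show ?thesis .
  qed
  have V_le: "(\<integral>\<^sup>+\<omega>. V k \<omega> \<partial>M) \<le> ennreal C" for k
  proof -
    have "(\<integral>\<^sup>+\<omega>. V k \<omega> \<partial>M) = (\<Sum>j<Suc k. ennreal (1 / real (Suc k)) * (\<integral>\<^sup>+\<omega>. ennreal ((r (t k (Suc j)) \<omega>) ^ 3) \<partial>M))"
      unfolding V_def by (subst nn_integral_sum) (auto intro!: sum.cong nn_integral_cmult simp del: of_nat_Suc sum.lessThan_Suc)
    also have "\<dots> \<le> (\<Sum>j<Suc k. ennreal (1 / real (Suc k)) * ennreal C)"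
      by (intro sum_mono mult_left_mono r3 t_pos) auto
    also have "\<dots> = ennreal (real (Suc k) * (1 / real (Suc k) * C))"
      using \<kappa> by (simp add: C_def ennreal_mult[symmetric] ennreal_of_nat_eq_real_of_nat del: of_nat_Suc)
    also have "\<dots> = ennreal C" by simp
    finally show ?thesis .
  qed
  have lim: "AE \<omega> in M. (\<lambda>k. V k \<omega>) \<longlonglongrightarrow> ennreal ((LINT s:{0..T}|lborel. (r s \<omega>) ^ 3) / T)"
    using AE_good
  proof eventually_elim
    case (elim \<omega>)
    have rc: "continuous_on {0..T} (\<lambda>s. (r s \<omega>) ^ 3)" using r_continuous[OF elim, of 0 T] by (intro continuous_intros) auto
    have one: "(LINT s:{x..y}|lborel. 1) = y - x" if "x \<le> y" for x y :: real
      using that by (simp add: set_lebesgue_integral_def)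
    have mesh: "(\<lambda>k. T / real (Suc k)) \<longlonglongrightarrow> 0"
      using LIMSEQ_Suc[OF lim_const_over_n[of T]] by simp
    have "(\<lambda>k. (\<Sum>j<Suc k. (r (t k (Suc j)) \<omega>) ^ 3 * (LINT s:{t k j..t k (Suc j)}|lborel. 1))
       - (LINT s:{0..T}|lborel. (r s \<omega>) ^ 3 * 1)) \<longlonglongrightarrow> 0"
    proof (rule riemann_sum_tendsto[where \<delta>="\<lambda>k. T / real (Suc k)" and B=T and p="\<lambda>k j. t k (Suc j)" and \<Phi>="\<lambda>_ s. (r s \<omega>) ^ 3"])
      show "t k 0 = 0" "t k (Suc k) = T" for k by (simp_all add: t_def)
      show "t k j < t k (Suc j)" "t k (Suc j) - t k j \<le> T / real (Suc k)" "t k (Suc j) \<in> {t k j..t k (Suc j)}" for k j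
        using t_diff[of k j] t_less[of k j] by auto
      show "set_integrable lborel {0..T} (\<lambda>s. 1 :: real)" by (intro borel_integrable_atLeastAtMost' continuous_intros)
      show "(LINT s:{0..T}|lborel. \<bar>1 :: real\<bar>) \<le> T" using one[of 0 T] T by simp
    qed (use mesh rc in \<open>auto intro: uniform_limit_const\<close>)
    moreover have "(\<Sum>j<Suc k. (r (t k (Suc j)) \<omega>) ^ 3 * (LINT s:{t k j..t k (Suc j)}|lborel. 1)) =
      T * (\<Sum>j<Suc k. 1 / real (Suc k) * (r (t k (Suc j)) \<omega>) ^ 3)" for k
    proof -
      have "(LINT s:{t k j..t k (Suc j)}|lborel. 1) = T * (1 / real (Suc k))" for j
        using one[of "t k j" "t k (Suc j)"] t_diff[of k j] t_less[of k j] by (simp del: of_nat_Suc)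
      then show ?thesis by (simp only: sum_distrib_left mult_ac)
    qed
    ultimately have "(\<lambda>k. T * (\<Sum>j<Suc k. 1 / real (Suc k) * (r (t k (Suc j)) \<omega>) ^ 3)) \<longlonglongrightarrow> (LINT s:{0..T}|lborel. (r s \<omega>) ^ 3)"
      by (simp add: LIM_zero_iff del: of_nat_Suc sum.lessThan_Suc)
    then have "(\<lambda>k. T * (\<Sum>j<Suc k. 1 / real (Suc k) * (r (t k (Suc j)) \<omega>) ^ 3) / T) \<longlonglongrightarrow> (LINT s:{0..T}|lborel. (r s \<omega>) ^ 3) / T"
      using T by (intro tendsto_intros) auto
    then have "(\<lambda>k. ennreal (\<Sum>j<Suc k. 1 / real (Suc k) * (r (t k (Suc j)) \<omega>) ^ 3)) \<longlonglongrightarrow> ennreal ((LINT s:{0..T}|lborel. (r s \<omega>) ^ 3) / T)"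
      using T by (intro tendsto_ennrealI) simp
    moreover have "ennreal (\<Sum>j<Suc k. 1 / real (Suc k) * (r (t k (Suc j)) \<omega>) ^ 3) = V k \<omega>" for k
    proof -
      have nn: "0 \<le> (r (t k (Suc j)) \<omega>) ^ 3" for j
        using r_nonneg[OF elim, of "t k (Suc j)"] t_pos[of k j] by simp
      have "V k \<omega> = (\<Sum>j<Suc k. ennreal (1 / real (Suc k) * (r (t k (Suc j)) \<omega>) ^ 3))"
        unfolding V_def using nn by (intro sum.cong refl ennreal_mult[symmetric]) auto
      also have "\<dots> = ennreal (\<Sum>j<Suc k. 1 / real (Suc k) * (r (t k (Suc j)) \<omega>) ^ 3)"
        using nn by (intro sum_ennreal mult_nonneg_nonneg) auto
      finally show ?thesis by simp
    qed
    ultimately show ?case by simp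
  qed
  have "(\<integral>\<^sup>+\<omega>. liminf (\<lambda>k. V k \<omega>) \<partial>M) \<le> liminf (\<lambda>k. \<integral>\<^sup>+\<omega>. V k \<omega> \<partial>M)"
    by (rule nn_integral_liminf) (rule V_meas)
  also have "\<dots> \<le> ennreal C" using V_le by (intro Liminf_le) auto
  finally have le: "(\<integral>\<^sup>+\<omega>. liminf (\<lambda>k. V k \<omega>) \<partial>M) \<le> ennreal C" .
  have m: "(\<lambda>\<omega>. liminf (\<lambda>k. V k \<omega>)) \<in> borel_measurable M" by measurable
  have "AE \<omega> in M. liminf (\<lambda>k. V k \<omega>) = ennreal ((LINT s:{0..T}|lborel. (r s \<omega>) ^ 3) / T)"
    using lim by eventually_elim (rule lim_imp_Liminf, auto)
  with m le show ?thesis unfolding C_def \<kappa>_def by (rule that)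
qed

text \<open>Borel-Cantelli at the level n^2 for quantities that contain path integrals: at each n a
  measurable majorant with bounded integral stands in for \<open>g n\<close>.\<close>

lemma eventually_le_square:
  fixes g :: "nat \<Rightarrow> 'a \<Rightarrow> real"
  assumes "\<And>n. n > 0 \<Longrightarrow> \<exists>V\<in>borel_measurable M. (\<integral>\<^sup>+\<omega>. V \<omega> \<partial>M) \<le> ennreal C \<and> (AE \<omega> in M. ennreal (g n \<omega>) \<le> V \<omega>)"
  shows "AE \<omega> in M. \<forall>\<^sub>F n in sequentially. g n \<omega> \<le> (real n)\<^sup>2"
proof -
  obtain V where V: "\<And>n. n > 0 \<Longrightarrow> V n \<in> borel_measurable M" "\<And>n. n > 0 \<Longrightarrow> (\<integral>\<^sup>+\<omega>. V n \<omega> \<partial>M) \<le> ennreal C"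
    "\<And>n. n > 0 \<Longrightarrow> AE \<omega> in M. ennreal (g n \<omega>) \<le> V n \<omega>"
    using assms by metis
  \<comment> \<open>The hypothesis provides majorants for positive n, matching positive horizons
    n^4; at n = 0 the value 0 is a placeholder.\<close>
  define V' where "V' n = (if n > 0 then V n else (\<lambda>_. 0))" for n
  have "AE \<omega> in M. \<forall>\<^sub>F n in sequentially. V' n \<omega> \<le> ennreal ((real n)\<^sup>2)"
  proof (rule borel_cantelli_nn_integral)
    show "V' n \<in> borel_measurable M" for n using V(1) by (simp add: V'_def)
    show "(\<integral>\<^sup>+\<omega>. V' n \<omega> \<partial>M) \<le> ennreal C" if "n > 0" for n using V(2)[OF that] that by (simp add: V'_def)
  qed
  moreover have "AE \<omega> in M. \<forall>n. n > 0 \<longrightarrow> ennreal (g n \<omega>) \<le> V n \<omega>"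
    using V(3) by (subst AE_all_countable) auto
  ultimately show ?thesis
  proof eventually_elim
    case (elim \<omega>)
    from elim(1) eventually_gt_at_top[of "0::nat"] show ?case
    proof eventually_elim
      case (elim n)
      have "ennreal (g n \<omega>) \<le> V n \<omega>"
        using \<open>\<forall>n. n > 0 \<longrightarrow> ennreal (g n \<omega>) \<le> V n \<omega>\<close> elim(2) by blast
      also have "\<dots> = V' n \<omega>" using elim(2) by (simp add: V'_def)
      also have "\<dots> \<le> ennreal ((real n)\<^sup>2)" by (rule elim(1))
      finally have "ennreal (g n \<omega>) \<le> ennreal ((real n)\<^sup>2)" .
      then show ?case by (simp add: ennreal_le_iff)
    qed
  qed
qed

lemma eventually_le_ln:
  fixes x :: "nat \<Rightarrow> 'a \<Rightarrow> real"
  assumes "\<And>n. n > 0 \<Longrightarrow> \<exists>V\<in>borel_measurable M. (\<integral>\<^sup>+\<omega>. V \<omega> \<partial>M) \<le> ennreal C \<and> (AE \<omega> in M. ennreal (exp (x n \<omega>)) \<le> V \<omega>)"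
  shows "AE \<omega> in M. \<forall>\<^sub>F n in sequentially. x n \<omega> \<le> 2 * ln (real n)"
proof -
  have "AE \<omega> in M. \<forall>\<^sub>F n in sequentially. exp (x n \<omega>) \<le> (real n)\<^sup>2"
    by (rule eventually_le_square) (rule assms)
  then show ?thesis
  proof eventually_elim
    case (elim \<omega>)
    then show ?case using eventually_gt_at_top[of "0::nat"]
    proof eventually_elim
      case (elim n)
      then have "ln (exp (x n \<omega>)) \<le> ln ((real n)\<^sup>2)" by (subst ln_le_cancel_iff) auto
      then show ?case using elim by (simp add: ln_realpow)
      qed
qed
qed

text \<open>Here \<theta> = c / n on the horizon n^4, with c = 1 and c = -1 in mind. After division
  by \<theta> the bracket costs a multiple of 1 / n times \<integral> r dt, a vanishing relative
  error, and the logarithm costs 2 n ln n, negligible against n^4.\<close>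

lemma martingale_linear_bound:
  "AE \<omega> in M. \<forall>\<^sub>F n in sequentially. (c / real n) * (r (real n ^ 4) \<omega> - r0 - a * real n ^ 4 + b * int_r r (real n ^ 4) \<omega>)
     - (c / real n)\<^sup>2 * \<sigma>\<^sup>2 / 2 * int_r r (real n ^ 4) \<omega> \<le> 2 * ln (real n)"
proof (rule eventually_le_ln[where C=1])
  fix n :: nat assume n: "n > 0"
  then have T: "real n ^ 4 > 0" by simp
  show "\<exists>V\<in>borel_measurable M. (\<integral>\<^sup>+\<omega>. V \<omega> \<partial>M) \<le> ennreal 1 \<and> (AE \<omega> in M. ennreal (exp ((c / real n) * (r (real n ^ 4) \<omega> - r0 - a * real n ^ 4 + b * int_r r (real n ^ 4) \<omega>)
     - (c / real n)\<^sup>2 * \<sigma>\<^sup>2 / 2 * int_r r (real n ^ 4) \<omega>)) \<le> V \<omega>)"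
    by (rule exp_bound_linear[OF T, of "c / real n"]) (auto elim!: eventually_mono)
qed

text \<open>Here \<theta> = c / n^3. With \<integral> r^3 dt at most n^6 the bracket costs order n^3
  and the logarithm 2 n^3 ln n, both negligible against n^4; with \<theta> = c / n this bound would
  let the bracket cost order n^5.\<close>

lemma martingale_quadratic_bound:
  "AE \<omega> in M. \<forall>\<^sub>F n in sequentially. (c / real n ^ 3) * (((r (real n ^ 4) \<omega>)\<^sup>2 - r0\<^sup>2) / 2 - (a + \<sigma>\<^sup>2 / 2) * int_r r (real n ^ 4) \<omega> + b * int_r2 r (real n ^ 4) \<omega>)
     - (c / real n ^ 3)\<^sup>2 * \<sigma>\<^sup>2 / 2 * (LINT s:{0..real n ^ 4}|lborel. (r s \<omega>) ^ 3) \<le> 2 * ln (real n)"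
proof (rule eventually_le_ln[where C=1])
  fix n :: nat assume n: "n > 0"
  then have T: "real n ^ 4 > 0" by simp
  show "\<exists>V\<in>borel_measurable M. (\<integral>\<^sup>+\<omega>. V \<omega> \<partial>M) \<le> ennreal 1 \<and> (AE \<omega> in M. ennreal (exp ((c / real n ^ 3) * (((r (real n ^ 4) \<omega>)\<^sup>2 - r0\<^sup>2) / 2 - (a + \<sigma>\<^sup>2 / 2) * int_r r (real n ^ 4) \<omega> + b * int_r2 r (real n ^ 4) \<omega>)
     - (c / real n ^ 3)\<^sup>2 * \<sigma>\<^sup>2 / 2 * (LINT s:{0..real n ^ 4}|lborel. (r s \<omega>) ^ 3))) \<le> V \<omega>)"
    by (rule exp_bound_quadratic[OF T, of "c / real n ^ 3"]) (auto elim!: eventually_mono)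
qed

text \<open>Controls the boundary terms r_T and r_T^2 left at the end of the horizon by the
  equations for r and r^2.\<close>

lemma r_log_bound: "AE \<omega> in M. \<forall>\<^sub>F n in sequentially. b / \<sigma>\<^sup>2 * r (real n ^ 4) \<omega> \<le> 2 * ln (real n)"
proof (rule eventually_le_ln)
  fix n :: nat assume n: "n > 0"
  then have T: "real n ^ 4 > 0" by simp
  have "(\<lambda>\<omega>. ennreal (exp (b / \<sigma>\<^sup>2 * r (real n ^ 4) \<omega>))) \<in> borel_measurable M"
    using r_measurable[of "real n ^ 4"] by measurable
  then show "\<exists>V\<in>borel_measurable M. (\<integral>\<^sup>+\<omega>. V \<omega> \<partial>M) \<le> ennreal (exp (b / \<sigma>\<^sup>2 * (r0 + 2 * a / b))) \<and>
     (AE \<omega> in M. ennreal (exp (b / \<sigma>\<^sup>2 * r (real n ^ 4) \<omega>)) \<le> V \<omega>)"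
    using exp_moment[OF T] by (intro bexI conjI) auto
qed

text \<open>A crude bound that loses a factor n^2 against the mean, which the small weight n^-3 of
  the quadratic estimate can afford.\<close>

lemma cubic_bound: "AE \<omega> in M. \<forall>\<^sub>F n in sequentially. (LINT s:{0..real n ^ 4}|lborel. (r s \<omega>) ^ 3) / real n ^ 4 \<le> (real n)\<^sup>2"
proof (rule eventually_le_square)
  fix n :: nat assume n: "n > 0"
  then have T: "real n ^ 4 > 0" by simp
  show "\<exists>V\<in>borel_measurable M. (\<integral>\<^sup>+\<omega>. V \<omega> \<partial>M) \<le> ennreal (27 / (b / \<sigma>\<^sup>2) ^ 3 * exp (b / \<sigma>\<^sup>2 * (r0 + 2 * a / b))) \<and>
     (AE \<omega> in M. ennreal ((LINT s:{0..real n ^ 4}|lborel. (r s \<omega>) ^ 3) / real n ^ 4) \<le> V \<omega>)"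
    by (rule cubic_moment[OF T]) (auto elim!: eventually_mono)
qed

end

section \<open>Limits of the time averages\<close>

context cir
begin

text \<open>Real analysis on one path. The equation for r makes b times the average of r close to
  \<open>a\<close>; the equation for r^2 makes b times the average of r^2 close to a + \<sigma>^2 /
  2 times the average of r.\<close>

lemma averages_along_subsequence:
  "AE \<omega> in M. (\<lambda>n. int_r r (real n ^ 4) \<omega> / real n ^ 4) \<longlonglongrightarrow> a / b \<and>
     (\<lambda>n. int_r2 r (real n ^ 4) \<omega> / real n ^ 4) \<longlonglongrightarrow> (a + \<sigma>\<^sup>2 / 2) * (a / b) / b"
  using AE_good martingale_linear_bound[of 1] martingale_linear_bound[of "-1"]
    martingale_quadratic_bound[of 1] martingale_quadratic_bound[of "-1"] r_log_bound cubic_bound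
proof eventually_elim
  case (elim \<omega>)
  define R where "R n = int_r r (real n ^ 4) \<omega>" for n :: nat
  define Q where "Q n = int_r2 r (real n ^ 4) \<omega>" for n :: nat
  define x where "x n = r (real n ^ 4) \<omega>" for n :: nat
  define K where "K n = (LINT s:{0..real n ^ 4}|lborel. (r s \<omega>) ^ 3)" for n :: nat
  define \<kappa> where "\<kappa> = b / \<sigma>\<^sup>2"
  define l where "l n = ln (real n) / real n" for n :: nat
  define u where "u n = 1 / real n" for n :: nat
  have \<kappa>: "\<kappa> > 0" using pos by (simp add: \<kappa>_def)
  have l: "l \<longlonglongrightarrow> 0" unfolding l_def by (rule lim_ln_over_n)
  have u: "u \<longlonglongrightarrow> 0" unfolding u_def by (rule lim_1_over_n)
  have R_nonneg: "0 \<le> R n" for n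
    unfolding R_def int_r_def using r_nonneg[OF elim(1)] by (intro set_integral_lborel_nonneg) auto
  have x_nonneg: "0 \<le> x n" for n unfolding x_def by (intro r_nonneg[OF elim(1)]) simp
  \<comment> \<open>The six almost sure bounds, with the weights \<theta> divided out and each pair
    of signs merged into an absolute value.\<close>
  have ev: "\<forall>\<^sub>F n in sequentially. n > 0 \<and> x n \<le> 2 / \<kappa> * ln (real n) \<and> K n \<le> real n ^ 6 \<and>
      \<bar>x n - r0 - a * real n ^ 4 + b * R n\<bar> \<le> \<sigma>\<^sup>2 / 2 / real n * R n + 2 * real n * ln (real n) \<and>
      \<bar>((x n)\<^sup>2 - r0\<^sup>2) / 2 - (a + \<sigma>\<^sup>2 / 2) * R n + b * Q n\<bar> \<le> \<sigma>\<^sup>2 / 2 / real n ^ 3 * K n + 2 * real n ^ 3 * ln (real n)"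
    using elim(2-) eventually_gt_at_top[of "0::nat"]
  proof eventually_elim
    case (elim n)
    have n: "real n > 0" using elim by simp
    \<comment> \<open>\<open>m\<close> is 1 / \<theta>, so multiplying by it isolates
      \<open>X\<close>.\<close>
    have two_sided: "\<bar>X\<bar> \<le> \<sigma>\<^sup>2 / 2 / m * Y + m * L"
      if "1 / m * X - (1 / m)\<^sup>2 * \<sigma>\<^sup>2 / 2 * Y \<le> L" "- 1 / m * X - (- 1 / m)\<^sup>2 * \<sigma>\<^sup>2 / 2 * Y \<le> L" "m > 0"
      for X Y L m :: real
    proof -
      have "m * (1 / m * X - (1 / m)\<^sup>2 * \<sigma>\<^sup>2 / 2 * Y) \<le> m * L" "m * (- 1 / m * X - (- 1 / m)\<^sup>2 * \<sigma>\<^sup>2 / 2 * Y) \<le> m * L"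
        using that by (auto intro: mult_left_mono)
      then have "X - \<sigma>\<^sup>2 / 2 / m * Y \<le> m * L" "- X - \<sigma>\<^sup>2 / 2 / m * Y \<le> m * L"
        using that(3) by (simp_all add: right_diff_distrib power2_eq_square)
      then show ?thesis by linarith
    qed
    have "\<bar>x n - r0 - a * real n ^ 4 + b * R n\<bar> \<le> \<sigma>\<^sup>2 / 2 / real n * R n + real n * (2 * ln (real n))"
      using two_sided[of "real n" "x n - r0 - a * real n ^ 4 + b * R n" "R n" "2 * ln (real n)"] elim(1,2) n
      by (simp add: x_def R_def)
    moreover have "\<bar>((x n)\<^sup>2 - r0\<^sup>2) / 2 - (a + \<sigma>\<^sup>2 / 2) * R n + b * Q n\<bar> \<le> \<sigma>\<^sup>2 / 2 / real n ^ 3 * K n + real n ^ 3 * (2 * ln (real n))"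
      using two_sided[of "real n ^ 3" "((x n)\<^sup>2 - r0\<^sup>2) / 2 - (a + \<sigma>\<^sup>2 / 2) * R n + b * Q n" "K n" "2 * ln (real n)"] elim(3,4) n
      by (simp add: x_def R_def Q_def K_def)
    moreover have "x n \<le> 2 / \<kappa> * ln (real n)"
      using elim(5) \<kappa> unfolding \<kappa>_def[symmetric] x_def[symmetric] by (simp add: field_simps)
    moreover have "K n \<le> real n ^ 6"
    proof -
      have "K n \<le> (real n)\<^sup>2 * real n ^ 4" using elim(6) n by (simp add: K_def pos_divide_le_eq)
      then show ?thesis by (simp flip: power_add)
    qed
    ultimately show ?case using elim(7) by (simp add: mult_ac)
  qed
  have \<rho>: "(\<lambda>n. R n / real n ^ 4) \<longlonglongrightarrow> a / b"
  proof (rule tendsto_of_relative_error)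
    show "0 \<le> R n / real n ^ 4" for n using R_nonneg by simp
    have "(\<lambda>n. \<sigma>\<^sup>2 / 2 * u n) \<longlonglongrightarrow> \<sigma>\<^sup>2 / 2 * 0" by (intro tendsto_intros u)
    then show "(\<lambda>n. \<sigma>\<^sup>2 / 2 * u n) \<longlonglongrightarrow> 0" by simp
    have "(\<lambda>n. (2 + 2 / \<kappa>) * l n + r0 * u n) \<longlonglongrightarrow> (2 + 2 / \<kappa>) * 0 + r0 * 0" by (intro tendsto_intros u l)
    then show "(\<lambda>n. (2 + 2 / \<kappa>) * l n + r0 * u n) \<longlonglongrightarrow> 0" by simp
    show "\<forall>\<^sub>F n in sequentially. \<bar>b * (R n / real n ^ 4) - a\<bar> \<le> \<sigma>\<^sup>2 / 2 * u n * (R n / real n ^ 4) + ((2 + 2 / \<kappa>) * l n + r0 * u n)"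
      using ev
    proof eventually_elim
      case (elim n)
      define m where "m = real n"
      have m: "1 \<le> m" using elim by (simp add: m_def)
      define L where "L = ln m"
      have L: "0 \<le> L" using m by (simp add: L_def)
      have "\<bar>b * R n - a * m ^ 4\<bar> \<le> \<sigma>\<^sup>2 / 2 / m * R n + 2 * m * L + 2 / \<kappa> * L + r0"
        using elim x_nonneg[of n] pos(4) unfolding m_def L_def by (simp only: abs_le_iff) linarith
      \<comment> \<open>Every error except the one proportional to \<open>R n\<close> is inflated to
        n^4 times one of the null sequences (ln n) / n and 1 / n, so that division by n^4 finishes
        the estimate.\<close>
      also have "\<dots> \<le> \<sigma>\<^sup>2 / 2 / m * R n + 2 * (m ^ 4 * (L / m)) + 2 / \<kappa> * (m ^ 4 * (L / m)) + r0 * (m ^ 4 * (1 / m))"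
      proof -
        have m3: "m ^ 4 = m ^ 3 * m" by (simp add: eval_nat_numeral)
        have "1 \<le> m ^ 3" using m by simp
        then have "L \<le> m ^ 3 * L" "1 \<le> m ^ 3" using L by (simp_all add: mult_le_cancel_right1)
        moreover have "m * L \<le> m ^ 3 * L" using m L power_increasing[of 1 3 m] by (intro mult_right_mono) auto
        moreover have "m ^ 4 * (L / m) = m ^ 3 * L" "m ^ 4 * (1 / m) = m ^ 3" using m by (simp_all add: m3)
        ultimately show ?thesis using \<kappa> pos(4)
          by (intro add_mono) (auto intro!: mult_left_mono divide_right_mono simp: mult.assoc)
      qed
      finally have "\<bar>b * R n - a * m ^ 4\<bar> / m ^ 4 \<le> (\<sigma>\<^sup>2 / 2 / m * R n + 2 * (m ^ 4 * (L / m)) + 2 / \<kappa> * (m ^ 4 * (L / m)) + r0 * (m ^ 4 * (1 / m))) / m ^ 4"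
        using m by (intro divide_right_mono) auto
      moreover have "\<bar>b * R n - a * m ^ 4\<bar> / m ^ 4 = \<bar>b * (R n / m ^ 4) - a\<bar>"
      proof -
        have "\<bar>b * R n - a * m ^ 4\<bar> / m ^ 4 = \<bar>(b * R n - a * m ^ 4) / m ^ 4\<bar>" using m by (simp add: abs_divide)
        also have "(b * R n - a * m ^ 4) / m ^ 4 = b * (R n / m ^ 4) - a" using m by (simp add: diff_divide_distrib)
        finally show ?thesis .
      qed
      moreover have "(\<sigma>\<^sup>2 / 2 / m * R n + 2 * (m ^ 4 * (L / m)) + 2 / \<kappa> * (m ^ 4 * (L / m)) + r0 * (m ^ 4 * (1 / m))) / m ^ 4
        = \<sigma>\<^sup>2 / 2 * (1 / m) * (R n / m ^ 4) + ((2 + 2 / \<kappa>) * (L / m) + r0 * (1 / m))"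
      proof -
        have c: "y * (m ^ 4 * z) / m ^ 4 = y * z" for y z using m by simp
        show ?thesis unfolding add_divide_distrib c by (simp add: distrib_right add_divide_distrib)
      qed
      ultimately show ?case by (simp add: u_def l_def m_def L_def)
    qed
  qed (use pos in simp)
  \<comment> \<open>The bracket is bounded outright by \<open>K n \<le> real n ^ 6\<close>, so this
    error is absolute and not relative; the limit for \<open>Q\<close> then follows from the one for
    \<open>R\<close>.\<close>
  have "(\<lambda>n. b * (Q n / real n ^ 4) - (a + \<sigma>\<^sup>2 / 2) * (R n / real n ^ 4)) \<longlonglongrightarrow> 0"
  proof (rule Lim_null_comparison)
    have "(\<lambda>n. (\<sigma>\<^sup>2 / 2 + r0\<^sup>2 / 2) * u n + 2 * l n + (2 / \<kappa>)\<^sup>2 / 2 * (l n)\<^sup>2) \<longlonglongrightarrow> (\<sigma>\<^sup>2 / 2 + r0\<^sup>2 / 2) * 0 + 2 * 0 + (2 / \<kappa>)\<^sup>2 / 2 * 0\<^sup>2"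
      by (intro tendsto_intros u l)
    then show "(\<lambda>n. (\<sigma>\<^sup>2 / 2 + r0\<^sup>2 / 2) * u n + 2 * l n + (2 / \<kappa>)\<^sup>2 / 2 * (l n)\<^sup>2) \<longlonglongrightarrow> 0" by simp
    show "\<forall>\<^sub>F n in sequentially. norm (b * (Q n / real n ^ 4) - (a + \<sigma>\<^sup>2 / 2) * (R n / real n ^ 4)) \<le>
        (\<sigma>\<^sup>2 / 2 + r0\<^sup>2 / 2) * u n + 2 * l n + (2 / \<kappa>)\<^sup>2 / 2 * (l n)\<^sup>2"
      using ev
    proof eventually_elim
      case (elim n)
      define m where "m = real n"
      have m: "1 \<le> m" using elim by (simp add: m_def)
      define L where "L = ln m"
      have L: "0 \<le> L" using m by (simp add: L_def)
      have "(x n)\<^sup>2 \<le> (2 / \<kappa> * L)\<^sup>2" using elim x_nonneg[of n] by (intro power_mono) (auto simp: L_def m_def)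
      then have x2: "(x n)\<^sup>2 \<le> (2 / \<kappa>)\<^sup>2 * L\<^sup>2" by (simp only: power_mult_distrib)
      have K: "\<sigma>\<^sup>2 / 2 / m ^ 3 * K n \<le> \<sigma>\<^sup>2 / 2 * m ^ 3"
      proof -
        have "\<sigma>\<^sup>2 / 2 / m ^ 3 * K n \<le> \<sigma>\<^sup>2 / 2 / m ^ 3 * m ^ 6"
          using elim m by (intro mult_left_mono) (auto simp: m_def)
        also have "m ^ 6 = m ^ 3 * m ^ 3" by (simp flip: power_add)
        also have "\<sigma>\<^sup>2 / 2 / m ^ 3 * (m ^ 3 * m ^ 3) = \<sigma>\<^sup>2 / 2 * m ^ 3"
        proof -
          have cancel: "y / p * (p * p) = y * p" if "p \<noteq> 0" for y p :: real using that by simp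
          show ?thesis by (rule cancel) (use m in simp)
        qed
        finally show ?thesis .
      qed
      have sum_bound: "\<bar>((x n)\<^sup>2 - r0\<^sup>2) / 2 - (a + \<sigma>\<^sup>2 / 2) * R n + b * Q n\<bar> \<le> \<sigma>\<^sup>2 / 2 * m ^ 3 + 2 * m ^ 3 * L"
        using elim K unfolding m_def L_def by linarith
      have "\<bar>b * Q n - (a + \<sigma>\<^sup>2 / 2) * R n\<bar> \<le> \<sigma>\<^sup>2 / 2 * m ^ 3 + 2 * (m ^ 3 * L) + (2 / \<kappa>)\<^sup>2 / 2 * L\<^sup>2 + r0\<^sup>2 / 2"
      proof -
        \<comment> \<open>Moves the boundary term (y - w) / 2 to the error side; its two parts have
          opposite signs and are estimated separately.\<close>
        have triangle: "\<bar>z\<bar> \<le> p + q / 2 + w / 2" if "\<bar>(y - w) / 2 + z\<bar> \<le> p" "0 \<le> y" "y \<le> q" "0 \<le> w" for y z w p q :: real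
        proof (rule abs_leI)
          have "(y - w) / 2 + z \<le> p" "- ((y - w) / 2 + z) \<le> p" using that(1) by (simp_all only: abs_le_iff)
          then show "z \<le> p + q / 2 + w / 2" "- z \<le> p + q / 2 + w / 2" using that(2-) by (simp_all add: field_simps)
        qed
        have "((x n)\<^sup>2 - r0\<^sup>2) / 2 - (a + \<sigma>\<^sup>2 / 2) * R n + b * Q n =
          ((x n)\<^sup>2 - r0\<^sup>2) / 2 + (b * Q n - (a + \<sigma>\<^sup>2 / 2) * R n)" by simp
        from triangle[OF sum_bound[unfolded this] zero_le_power2 x2 zero_le_power2]
        show ?thesis by (simp only: mult.assoc times_divide_eq_left)
      qed
      also have "\<dots> \<le> \<sigma>\<^sup>2 / 2 * (m ^ 4 * (1 / m)) + 2 * (m ^ 4 * (L / m)) + (2 / \<kappa>)\<^sup>2 / 2 * (m ^ 4 * (L / m)\<^sup>2) + r0\<^sup>2 / 2 * (m ^ 4 * (1 / m))"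
      proof -
        have m3: "m ^ 4 = m ^ 3 * m" "m ^ 4 = m\<^sup>2 * m\<^sup>2" by (simp_all add: eval_nat_numeral)
        have "m ^ 4 * (L / m) = m ^ 3 * L" "m ^ 4 * (1 / m) = m ^ 3" using m by (simp_all add: m3(1))
        moreover have "m ^ 4 * (L / m)\<^sup>2 = m\<^sup>2 * L\<^sup>2"
        proof -
          have "m ^ 4 * (L / m)\<^sup>2 = m\<^sup>2 * (m * (L / m))\<^sup>2" by (simp only: m3(2) power_mult_distrib mult.assoc)
          then show ?thesis using m by simp
        qed
        moreover have "1 * L\<^sup>2 \<le> m\<^sup>2 * L\<^sup>2" using m by (intro mult_right_mono) auto
        moreover have "1 \<le> m ^ 3" using m by simp
        then have "r0\<^sup>2 / 2 * 1 \<le> r0\<^sup>2 / 2 * m ^ 3" by (intro mult_left_mono) auto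
        ultimately show ?thesis
          by (intro add_mono) (auto intro!: mult_left_mono)
      qed
      finally have "\<bar>b * Q n - (a + \<sigma>\<^sup>2 / 2) * R n\<bar> / m ^ 4 \<le>
        (\<sigma>\<^sup>2 / 2 * (m ^ 4 * (1 / m)) + 2 * (m ^ 4 * (L / m)) + (2 / \<kappa>)\<^sup>2 / 2 * (m ^ 4 * (L / m)\<^sup>2) + r0\<^sup>2 / 2 * (m ^ 4 * (1 / m))) / m ^ 4"
        using m by (intro divide_right_mono) auto
      moreover have "\<bar>b * Q n - (a + \<sigma>\<^sup>2 / 2) * R n\<bar> / m ^ 4 = \<bar>b * (Q n / m ^ 4) - (a + \<sigma>\<^sup>2 / 2) * (R n / m ^ 4)\<bar>"
      proof -
        have "\<bar>b * Q n - (a + \<sigma>\<^sup>2 / 2) * R n\<bar> / m ^ 4 = \<bar>(b * Q n - (a + \<sigma>\<^sup>2 / 2) * R n) / m ^ 4\<bar>" using m by (simp add: abs_divide)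
        then show ?thesis by (simp add: diff_divide_distrib)
      qed
      moreover have "(\<sigma>\<^sup>2 / 2 * (m ^ 4 * (1 / m)) + 2 * (m ^ 4 * (L / m)) + (2 / \<kappa>)\<^sup>2 / 2 * (m ^ 4 * (L / m)\<^sup>2) + r0\<^sup>2 / 2 * (m ^ 4 * (1 / m))) / m ^ 4
         = (\<sigma>\<^sup>2 / 2 + r0\<^sup>2 / 2) * (1 / m) + 2 * (L / m) + (2 / \<kappa>)\<^sup>2 / 2 * (L / m)\<^sup>2"
      proof -
        have c: "y * (m ^ 4 * z) / m ^ 4 = y * z" for y z using m by simp
        show ?thesis unfolding add_divide_distrib c by (simp add: distrib_right add_divide_distrib)
      qed
      ultimately show ?case by (simp add: u_def l_def m_def L_def)
    qed
  qed
  from tendsto_add[OF this tendsto_mult[OF tendsto_const[of "a + \<sigma>\<^sup>2 / 2"] \<rho>]]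
  have "(\<lambda>n. b * (Q n / real n ^ 4)) \<longlonglongrightarrow> (a + \<sigma>\<^sup>2 / 2) * (a / b)" by simp
  then have "(\<lambda>n. b * (Q n / real n ^ 4) / b) \<longlonglongrightarrow> (a + \<sigma>\<^sup>2 / 2) * (a / b) / b"
    by (rule tendsto_divide[OF _ tendsto_const]) (use pos in simp)
  then have "(\<lambda>n. Q n / real n ^ 4) \<longlonglongrightarrow> (a + \<sigma>\<^sup>2 / 2) * (a / b) / b" using pos by simp
  with \<rho> show ?case by (simp add: R_def Q_def)
qed

lemma averages_tendsto:
  "AE \<omega> in M. ((\<lambda>T. int_r r T \<omega> / T) \<longlongrightarrow> a / b) at_top \<and>
     ((\<lambda>T. int_r2 r T \<omega> / T) \<longlongrightarrow> (a + \<sigma>\<^sup>2 / 2) * (a / b) / b) at_top"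
  using averages_along_subsequence AE_good
proof eventually_elim
  case (elim \<omega>)
  have mono: "(LINT s:{0..x}|lborel. f s) \<le> (LINT s:{0..y}|lborel. f s)"
    if "0 \<le> x" "x \<le> y" "continuous_on {0..y} f" "\<And>s. 0 \<le> s \<Longrightarrow> 0 \<le> f s" for x y and f :: "real \<Rightarrow> real"
  proof -
    have "0 \<le> (LINT s:{x..y}|lborel. f s)" using that by (intro set_integral_lborel_nonneg) auto
    then show ?thesis using set_integral_Icc_diff[OF borel_integrable_atLeastAtMost'[OF that(3)] that(1,2)] by simp
  qed
  have rc: "continuous_on {0..y} (\<lambda>s. r s \<omega>)" for y using r_continuous[OF elim(2)] by simp
  have rn: "0 \<le> s \<Longrightarrow> 0 \<le> r s \<omega>" for s by (rule r_nonneg[OF elim(2)])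
  have "((\<lambda>T. int_r r T \<omega> / T) \<longlongrightarrow> a / b) at_top"
  proof (rule average_tendsto_of_subsequence)
    show "int_r r x \<omega> \<le> int_r r y \<omega>" if "0 \<le> x" "x \<le> y" for x y
      unfolding int_r_def by (intro mono that rc rn)
    show "0 \<le> int_r r x \<omega>" if "0 \<le> x" for x
      unfolding int_r_def using rn by (intro set_integral_lborel_nonneg) auto
  qed (use elim in simp)
  moreover have "((\<lambda>T. int_r2 r T \<omega> / T) \<longlongrightarrow> (a + \<sigma>\<^sup>2 / 2) * (a / b) / b) at_top"
  proof (rule average_tendsto_of_subsequence)
    show "int_r2 r x \<omega> \<le> int_r2 r y \<omega>" if "0 \<le> x" "x \<le> y" for x y
      unfolding int_r2_def by (intro mono that continuous_intros rc) auto
    show "0 \<le> int_r2 r x \<omega>" if "0 \<le> x" for x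
      unfolding int_r2_def by (intro set_integral_lborel_nonneg) auto
  qed (use elim in simp)
  ultimately show ?case by simp
qed

end

section \<open>Consistency of the estimators\<close>

theorem theorem8:
  fixes M :: "'a measure"
    and W r :: "real \<Rightarrow> 'a \<Rightarrow> real"
    and a b \<sigma> r0 :: real
  assumes "a > 0" and "b > 0" and "\<sigma> > 0" and "r0 > 0"
    and "wiener_process M W"
    and "cir_process M W a b \<sigma> r0 r"
  shows "AE \<omega> in M. ((\<lambda>T. a_est \<sigma> r T \<omega>) \<longlongrightarrow> a) at_top \<and>
                    ((\<lambda>T. b_est \<sigma> r T \<omega>) \<longlongrightarrow> b) at_top"
proof -
  interpret cir M W r a b \<sigma> r0
    using assms by unfold_locales auto
  show ?thesis
    using averages_tendsto
  proof eventually_elim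
    case (elim \<omega>)
    define A where "A = (\<lambda>T. int_r r T \<omega> / T)"
    define B where "B = (\<lambda>T. int_r2 r T \<omega> / T)"
    have A: "(A \<longlongrightarrow> a / b) at_top" and B: "(B \<longlongrightarrow> (a + \<sigma>\<^sup>2 / 2) * (a / b) / b) at_top"
      using elim unfolding A_def B_def by blast+
    \<comment> \<open>This is the limit of the empirical variance of the path. It is positive, so
      the quotient rule for limits applies to both estimators.\<close>
    have var: "(a + \<sigma>\<^sup>2 / 2) * (a / b) / b - (a / b)\<^sup>2 = \<sigma>\<^sup>2 * a / (2 * b\<^sup>2)"
      using assms by (simp add: field_simps power2_eq_square)
    have var_ne: "(a + \<sigma>\<^sup>2 / 2) * (a / b) / b - (a / b)\<^sup>2 \<noteq> 0"
      unfolding var using assms by simp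
    have lim_a: "((\<lambda>T. \<sigma>\<^sup>2 / 2 * ((A T)\<^sup>2 / (B T - (A T)\<^sup>2))) \<longlongrightarrow> \<sigma>\<^sup>2 / 2 * ((a / b)\<^sup>2 / (\<sigma>\<^sup>2 * a / (2 * b\<^sup>2)))) at_top"
      unfolding var[symmetric] using var_ne by (intro tendsto_intros A B)
    have lim_b: "((\<lambda>T. \<sigma>\<^sup>2 / 2 * (A T / (B T - (A T)\<^sup>2))) \<longlongrightarrow> \<sigma>\<^sup>2 / 2 * (a / b / (\<sigma>\<^sup>2 * a / (2 * b\<^sup>2)))) at_top"
      unfolding var[symmetric] using var_ne by (intro tendsto_intros A B)
    \<comment> \<open>Cancelling T^2 from numerator and denominator expresses both estimators
      through the averages \<open>A\<close> and \<open>B\<close>.\<close>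
    have scale: "T * int_r2 r T \<omega> - (int_r r T \<omega>)\<^sup>2 = T\<^sup>2 * (B T - (A T)\<^sup>2)"
      "(int_r r T \<omega>)\<^sup>2 = T\<^sup>2 * (A T)\<^sup>2" "T * int_r r T \<omega> = T\<^sup>2 * A T" if "T > 0" for T
      using that by (simp_all add: A_def B_def power2_eq_square field_simps)
    have "\<forall>\<^sub>F T in at_top. \<sigma>\<^sup>2 / 2 * ((A T)\<^sup>2 / (B T - (A T)\<^sup>2)) = a_est \<sigma> r T \<omega>"
      using eventually_gt_at_top[of 0] 
    proof eventually_elim
      case (elim T)
      show ?case unfolding a_est_def scale(1)[OF elim] unfolding scale(2)[OF elim] using elim by simp
    qed
    moreover have "\<forall>\<^sub>F T in at_top. \<sigma>\<^sup>2 / 2 * (A T / (B T - (A T)\<^sup>2)) = b_est \<sigma> r T \<omega>"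
      using eventually_gt_at_top[of 0] 
    proof eventually_elim
      case (elim T)
      show ?case unfolding b_est_def scale(1)[OF elim] unfolding scale(3)[OF elim] using elim by simp
    qed
    moreover have "\<sigma>\<^sup>2 / 2 * ((a / b)\<^sup>2 / (\<sigma>\<^sup>2 * a / (2 * b\<^sup>2))) = a" "\<sigma>\<^sup>2 / 2 * (a / b / (\<sigma>\<^sup>2 * a / (2 * b\<^sup>2))) = b"
      using assms by (simp_all add: field_simps power2_eq_square)
    ultimately show ?case
      using Lim_transform_eventually[OF lim_a] Lim_transform_eventually[OF lim_b] by simp
  qed
qed

end
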